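(* Let $1 \le t \le 5$ and $n \ge 1$ be integers, and let $\mathbf d = (d_1,\dots,d_t) \in \mathbb Z_{\ge 0}^t$ with $d_1 \le d_2 \le \dots \le d_t = n$. For each prime power $q$ (a power of a prime $p$), let $P_q \le \mathrm{GL}_n(q)$ be the parabolic subgroup that is the stabilizer of the flag $0 \subseteq \mathbb F_q^{d_1} \subseteq \mathbb F_q^{d_2} \subseteq \dots \subseteq \mathbb F_q^{d_t} = \mathbb F_q^n$, and let $U_q = O_p(P_q)$. Then, as a function of $q$, the number $k(U_q)$ of conjugacy classes of $U_q$ is a polynomial in $q$ with integer coefficients; that is, there is a polynomial $f \in \mathbb Z[X]$ (depending only on $\mathbf d$) such that $k(U_q) = f(q)$ for every prime power $q$.
   Context: $\mathbb F_q^{d}$ denotes the span of the first $d$ standard basis vectors of $\mathbb F_q^n$. Every stabilizer in $\mathrm{GL}_n(q)$ of a flag $0 \subseteq V_1 \subseteq \dots \subseteq V_t = \mathbb F_q^n$ (a flag of length $t$) is conjugate to one of the groups $P_q$ for a suitable $\mathbf d$. $O_p(P)$ denotes the largest normal $p$-subgroup of $P$; for $P = P_q$ it is the unipotent radical $\{u \in \mathrm{GL}_n(q) \mid (u-1)V_i \subseteq V_{i-1} \text{ for all } i=1,\dots,t\}$, where $V_i = \mathbb F_q^{d_i}$ and $V_0 = 0$. $k(U)$ is the number of conjugacy classes of the finite group $U$. *)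

theory Defs
  imports
    "HOL-Algebra.Group_Action"
    "HOL-Computational_Algebra.Polynomial"
    "Jordan_Normal_Form.VS_Connect"
begin

text \<open>
  The field \<open>\<bbbF>\<^sub>q\<close> has to vary inside a single proposition, because the polynomial counting
  conjugacy classes is chosen before \<open>q\<close>. A field is therefore a record with an explicit
  carrier, and the operations on \<open>'a mat\<close> and \<open>'a vec\<close> are defined relative to it
  instead of through type classes. Every finite field is isomorphic to one whose elements
  are natural numbers, so quantifying over all fields of type \<open>nat ring\<close> with exactly
  \<open>q\<close> elements covers every model of \<open>\<bbbF>\<^sub>q\<close>.
\<close>

definition matrix_monoid :: "('a, 'b) ring_scheme \<Rightarrow> nat \<Rightarrow> 'a mat monoid" where
  "matrix_monoid R n =
    \<lparr>carrier = {A \<in> carrier_mat n n. \<forall>i<n. \<forall>j<n. A $$ (i, j) \<in> carrier R},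
     monoid.mult = (\<lambda>A B. mat n n (\<lambda>(i, j). \<Oplus>\<^bsub>R\<^esub>k\<in>{..<n}. A $$ (i, k) \<otimes>\<^bsub>R\<^esub> B $$ (k, j))),
     one = mat n n (\<lambda>(i, j). if i = j then \<one>\<^bsub>R\<^esub> else \<zero>\<^bsub>R\<^esub>)\<rparr>"

definition GL :: "nat \<Rightarrow> ('a, 'b) ring_scheme \<Rightarrow> 'a mat monoid" where
  "GL n R = units_of (matrix_monoid R n)"

text \<open>
  The record type of modules extends the one of rings; the ring multiplication and unit of
  a module carry no information and are left undefined.
\<close>

definition coord_space :: "('a, 'b) ring_scheme \<Rightarrow> nat \<Rightarrow> ('a, 'a vec) module" where
  "coord_space R n =
    \<lparr>carrier = {v \<in> carrier_vec n. \<forall>i<n. v $ i \<in> carrier R},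
     monoid.mult = undefined,
     one = undefined,
     zero = vec n (\<lambda>i. \<zero>\<^bsub>R\<^esub>),
     add = (\<lambda>v w. vec n (\<lambda>i. v $ i \<oplus>\<^bsub>R\<^esub> w $ i)),
     smult = (\<lambda>c v. vec n (\<lambda>i. c \<otimes>\<^bsub>R\<^esub> v $ i))\<rparr>"

definition std_basis_vec :: "('a, 'b) ring_scheme \<Rightarrow> nat \<Rightarrow> nat \<Rightarrow> 'a vec" where
  "std_basis_vec R n j = vec n (\<lambda>i. if i = j then \<one>\<^bsub>R\<^esub> else \<zero>\<^bsub>R\<^esub>)"

definition std_subspace :: "('a, 'b) ring_scheme \<Rightarrow> nat \<Rightarrow> nat \<Rightarrow> 'a vec set" where
  "std_subspace R n d = LinearCombinations.module.span R (coord_space R n) (std_basis_vec R n ` {..<d})"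

definition mat_apply :: "('a, 'b) ring_scheme \<Rightarrow> nat \<Rightarrow> 'a mat \<Rightarrow> 'a vec \<Rightarrow> 'a vec" where
  "mat_apply R n A v = vec n (\<lambda>i. \<Oplus>\<^bsub>R\<^esub>j\<in>{..<n}. A $$ (i, j) \<otimes>\<^bsub>R\<^esub> v $ j)"

text \<open>
  The list \<open>ds\<close> is \<open>(d\<^sub>1, \<dots>, d\<^sub>t)\<close>, and a flag is the list of its subspaces
  \<open>V\<^sub>1, \<dots>, V\<^sub>t\<close>. Being stabilized means \<open>g V\<^sub>i = V\<^sub>i\<close> for every \<open>i\<close>.
\<close>

definition std_flag :: "('a, 'b) ring_scheme \<Rightarrow> nat \<Rightarrow> nat list \<Rightarrow> 'a vec set list" where
  "std_flag R n ds = map (std_subspace R n) ds"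

definition parabolic :: "('a, 'b) ring_scheme \<Rightarrow> nat \<Rightarrow> nat list \<Rightarrow> 'a mat monoid" where
  "parabolic R n ds =
    (GL n R)\<lparr>carrier := stabilizer (GL n R) (\<lambda>g. map ((`) (mat_apply R n g))) (std_flag R n ds)\<rparr>"

text \<open>
  The order on subgroups is inclusion. For a finite group the greatest normal \<open>p\<close>-subgroup always
  exists. Since \<open>card\<close> is 0 on infinite sets, the cardinality condition entails finiteness.
\<close>

definition p_core :: "nat \<Rightarrow> ('a, 'b) monoid_scheme \<Rightarrow> 'a set" where
  "p_core p G = (GREATEST N. N \<lhd> G \<and> (\<exists>k. card N = p ^ k))"

definition conj_class_number :: "('a, 'b) monoid_scheme \<Rightarrow> nat" where
  "conj_class_number G =
    card (orbits G (carrier G) (\<lambda>g x. g \<otimes>\<^bsub>G\<^esub> x \<otimes>\<^bsub>G\<^esub> inv\<^bsub>G\<^esub> g))"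

definition unipotent_radical ::
    "nat \<Rightarrow> ('a, 'b) ring_scheme \<Rightarrow> nat \<Rightarrow> nat list \<Rightarrow> 'a mat monoid" where
  "unipotent_radical p R n ds =
    (parabolic R n ds)\<lparr>carrier := p_core p (parabolic R n ds)\<rparr>"

end

theory Submission
  imports
    Defs
    "HOL-Library.Function_Algebras"
    "HOL-Library.Product_Plus"
    "HOL-Algebra.Weak_Morphisms"
    "HOL-Number_Theory.Residues"
begin

text \<open>
  By Burnside's lemma, \<open>k(U) |U|\<close> is the number of commuting pairs in the algebra of strictly block upper
  triangular matrices. Number the blocks by \<open>0, \<dots>, 4\<close> and let \<open>A\<close> be the index set of the blocks \<open>0, 1\<close>
  and \<open>B\<close> that of the blocks \<open>2, 3, 4\<close>. The \<open>A \<times> B\<close> blocks of a pair enter the commutator linearly, and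
  duality replaces them by one matrix \<open>Z\<close> on \<open>B \<times> A\<close> that commutes with the diagonal parts \<open>x\<close> and \<open>y\<close> of
  the pair. The number of these \<open>(x, y)\<close> is invariant under triangular row and column operations on \<open>Z\<close>,
  so elimination reduces \<open>Z\<close> to a partial permutation matrix, at the cost of factors that are polynomials
  in \<open>q\<close>. For such \<open>Z\<close> the condition \<open>xy = yx\<close> only involves the products of the blocks \<open>2 \<times> 3\<close> and
  \<open>3 \<times> 4\<close>; dualizing it as well and eliminating once more leaves coordinate subspaces, whose
  cardinalities are powers of \<open>q\<close>. Hence \<open>q\<^sup>m k(U)\<close> is an integer polynomial \<open>g(q)\<close> for some \<open>m\<close>. Since \<open>p\<close>
  divides \<open>g(p)\<close> for all primes \<open>p\<close> if \<open>m > 0\<close>, the polynomial \<open>g\<close> is divisible by \<open>X\<^sup>m\<close>.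
\<close>

text \<open>The split into two and three blocks leaves a single quadratic condition: strictly
  triangular matrices on two blocks multiply to zero, on three blocks they have one product block.
  Everything else about a commuting pair is linear once the diagonal parts are fixed, and a linear
  condition may be replaced by its dual at the cost of a power of \<open>q\<close>. Counts are
  therefore handled only up to such powers, and the denominator is removed once, at the very end.
  The obstacle is that \<open>Z\<close> may not be brought to rank normal form: compensating an
  operation on \<open>Z\<close> conjugates \<open>x\<close> and \<open>y\<close>, which has to
  preserve their triangular pattern. Only triangular operations are available, so the normal forms
  are the partial matchings of a Bruhat decomposition, a finite set independent of \<open>q\<close>.
  Such a matching ties entries of \<open>x\<close> in the two diagonal parts together, and the
  second problem lives on an irregular pattern \<open>Q\<close>; the second elimination succeeds
  because the rows and columns of \<open>Q\<close> are nested for a suitable reordering of the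
  indices. Since operations are invertible, invariance of a count follows from an injection in one
  direction.\<close>

section \<open>Counting over finite fields inside a commutative ring\<close>

text \<open>
  The ambient ring need not have a unit: \<open>e\<close> is a unit for \<open>K\<close> only. This is what allows all finite
  fields to be subsets of one fixed type (\<open>ring_family\<close> below).
\<close>

locale finite_subfield =
  fixes K :: "'a::comm_ring set" and e :: 'a
  assumes finite_K: "finite K"
    and diff_K: "x \<in> K \<Longrightarrow> y \<in> K \<Longrightarrow> x - y \<in> K"
    and mult_K: "x \<in> K \<Longrightarrow> y \<in> K \<Longrightarrow> x * y \<in> K"
    and unit_K [simp]: "e \<in> K"
    and unit_nonzero [simp]: "e \<noteq> 0"
    and unit_mult [simp]: "x \<in> K \<Longrightarrow> e * x = x"
    and inverse_ex: "x \<in> K \<Longrightarrow> x \<noteq> 0 \<Longrightarrow> \<exists>y\<in>K. x * y = e"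
begin

lemma zero_K [simp]: "0 \<in> K"
  using diff_K[OF unit_K unit_K] by simp

lemma uminus_K: "x \<in> K \<Longrightarrow> - x \<in> K"
  using diff_K[OF zero_K] by simp

lemma add_K: "x \<in> K \<Longrightarrow> y \<in> K \<Longrightarrow> x + y \<in> K"
  using diff_K[of x "- y"] uminus_K by simp

lemma sum_K: "(\<And>i. i \<in> I \<Longrightarrow> f i \<in> K) \<Longrightarrow> sum f I \<in> K"
  by (induction I rule: infinite_finite_induct) (auto intro: add_K)

lemmas closed_K = add_K diff_K uminus_K mult_K sum_K zero_K unit_K

lemma mult_unit [simp]: "x \<in> K \<Longrightarrow> x * e = x"
  by (simp add: mult.commute)

lemma card_K_pos: "0 < card K"
  using finite_K unit_K by (auto simp: card_gt_0_iff simp del: unit_K)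

end

text \<open>Vectors, matrices and spaces of matrices with a zero pattern are all encoded by total
  functions vanishing off \<open>P\<close>. Sums and differences are then the pointwise ones of the
  function type, and no dimensions have to match.\<close>

definition supported :: "'a::zero set \<Rightarrow> 'i set \<Rightarrow> ('i \<Rightarrow> 'a) set" where
  "supported K P = {f. (\<forall>i\<in>P. f i \<in> K) \<and> (\<forall>i. i \<notin> P \<longrightarrow> f i = 0)}"

lemma supported_zero: "f \<in> supported K P \<Longrightarrow> i \<notin> P \<Longrightarrow> f i = 0"
  by (simp add: supported_def)

lemma card_supported_power:
  assumes "finite P"
  shows "card (supported K P) = card K ^ card P"
proof -
  have "bij_betw (\<lambda>f. restrict f P) (supported K P) (P \<rightarrow>\<^sub>E K)"
    by (rule bij_betw_byWitness[where f' = "\<lambda>f i. if i \<in> P then f i else 0"])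
       (auto simp: supported_def fun_eq_iff PiE_def Pi_def extensional_def)
  then have "card (supported K P) = card (P \<rightarrow>\<^sub>E K)"
    by (rule bij_betw_same_card)
  then show ?thesis
    using assms by (simp add: card_PiE)
qed

context finite_subfield
begin

lemma supported_K: "f \<in> supported K P \<Longrightarrow> f i \<in> K"
  by (cases "i \<in> P") (auto simp: supported_def)

lemma finite_supported: "finite P \<Longrightarrow> finite (supported K P)"
proof -
  assume "finite P"
  then have "card (supported K P) > 0"
    using card_K_pos by (simp add: card_supported_power)
  then show ?thesis
    using card_gt_0_iff by blast
qed

lemma supported_add: "f \<in> supported K P \<Longrightarrow> g \<in> supported K P \<Longrightarrow> f + g \<in> supported K P"
  and supported_diff: "f \<in> supported K P \<Longrightarrow> g \<in> supported K P \<Longrightarrow> f - g \<in> supported K P"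
  by (auto simp: supported_def intro: closed_K)

lemma supported_zero_fun [simp]: "0 \<in> supported K P" "(\<lambda>_. 0) \<in> supported K P"
  by (auto simp: supported_def)

lemma supported_mono: "f \<in> supported K P \<Longrightarrow> P \<subseteq> Q \<Longrightarrow> f \<in> supported K Q"
  using supported_K[of f P] by (auto simp: supported_def)

lemma supported_delta: "i \<in> P \<Longrightarrow> (\<lambda>j. if j = i then e else 0) \<in> supported K P"
  by (auto simp: supported_def)

end

text \<open>
  The rank-nullity theorem for a bilinear form, without dimensions: for fixed \<open>v\<close> the difference
  \<open>#{w. b v w = 0} - #{w. b v w = e}\<close> is \<open>card W\<close> if \<open>v\<close> lies in the left radical and \<open>0\<close>
  otherwise, and this difference summed over \<open>v\<close> is symmetric in the two arguments.
\<close>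

lemma (in finite_subfield) card_radicals:
  fixes b :: "'v::ab_group_add \<Rightarrow> 'w::ab_group_add \<Rightarrow> 'a"
  assumes fin: "finite V" "finite W"
    and V: "\<And>v v'. v \<in> V \<Longrightarrow> v' \<in> V \<Longrightarrow> v - v' \<in> V"
    and W: "\<And>w w'. w \<in> W \<Longrightarrow> w' \<in> W \<Longrightarrow> w - w' \<in> W"
    and b1: "\<And>v v' w. b (v + v') w = b v w + b v' w"
    and b2: "\<And>v w w'. b v (w + w') = b v w + b v w'"
    and n1: "\<And>v w. v \<in> V \<Longrightarrow> w \<in> W \<Longrightarrow> b v w \<noteq> 0 \<Longrightarrow> \<exists>w'\<in>W. b v w' = e"
    and n2: "\<And>v w. v \<in> V \<Longrightarrow> w \<in> W \<Longrightarrow> b v w \<noteq> 0 \<Longrightarrow> \<exists>v'\<in>V. b v' w = e"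
  shows "card {v \<in> V. \<forall>w\<in>W. b v w = 0} * card W = card {w \<in> W. \<forall>v\<in>V. b v w = 0} * card V"
proof -
  have half: "(\<Sum>x\<in>X. int (card {y\<in>Y. c x y = 0}) - int (card {y\<in>Y. c x y = e})) =
      int (card {x \<in> X. \<forall>y\<in>Y. c x y = 0} * card Y)"
    if "finite X" "finite Y" and Y: "\<And>y y'. y \<in> Y \<Longrightarrow> y' \<in> Y \<Longrightarrow> y - y' \<in> Y"
      and c: "\<And>x y y'. c x (y + y') = c x y + c x y'"
      and n: "\<And>x y. x \<in> X \<Longrightarrow> y \<in> Y \<Longrightarrow> c x y \<noteq> 0 \<Longrightarrow> \<exists>y'\<in>Y. c x y' = e"
    for X :: "'x set" and Y :: "'y::ab_group_add set" and c
  proof -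
    have Yadd: "y + y' \<in> Y" if "y \<in> Y" "y' \<in> Y" for y y'
      using Y[OF that(1) Y[OF Y[OF that(2,2)] that(2)]] by simp
    have cd: "c x (y - y') = c x y - c x y'" for x y y'
      using c[of x "y - y'" y'] by simp
    have "int (card {y\<in>Y. c x y = 0}) - int (card {y\<in>Y. c x y = e}) =
        (if \<forall>y\<in>Y. c x y = 0 then int (card Y) else 0)" if x: "x \<in> X" for x
    proof (cases "\<forall>y\<in>Y. c x y = 0")
      case True
      then have "{y\<in>Y. c x y = 0} = Y" "{y\<in>Y. c x y = e} = {}"
        by auto
      then show ?thesis
        using True by (simp only: if_True card.empty) simp
    next
      case False
      then obtain z where z: "z \<in> Y" "c x z = e"
        using n x by blast
      \<comment> \<open>If the form does not vanish at \<open>x\<close>, translation by an element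
        \<open>z\<close> of value \<open>e\<close> matches the zero fibre with the \<open>e\<close>
        fibre, so the two counts cancel. Assumption \<open>n\<close> supplies \<open>z\<close> where
        a vector space would allow rescaling.\<close>
      have "bij_betw (\<lambda>y. y + z) {y\<in>Y. c x y = 0} {y\<in>Y. c x y = e}"
        by (rule bij_betw_byWitness[where f' = "\<lambda>y. y - z"])
           (use z Yadd Y in \<open>auto simp: c cd\<close>)
      then have "card {y\<in>Y. c x y = 0} = card {y\<in>Y. c x y = e}"
        by (rule bij_betw_same_card)
      then show ?thesis
        by (subst if_not_P[OF False]) simp
    qed
    then have "(\<Sum>x\<in>X. int (card {y\<in>Y. c x y = 0}) - int (card {y\<in>Y. c x y = e})) =
      (\<Sum>x\<in>X. if \<forall>y\<in>Y. c x y = 0 then int (card Y) else 0)"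
      by (rule sum.cong[OF refl])
    also have "\<dots> = int (card {x \<in> X. \<forall>y\<in>Y. c x y = 0} * card Y)"
      using \<open>finite X\<close> by (simp add: sum.If_cases Int_def)
    finally show ?thesis .
  qed
  have swap: "(\<Sum>v\<in>V. int (card {w\<in>W. b v w = c})) = (\<Sum>w\<in>W. int (card {v\<in>V. b v w = c}))" for c
  proof -
    have "(\<Sum>v\<in>V. int (card {w\<in>W. b v w = c})) = (\<Sum>v\<in>V. \<Sum>w\<in>W. if b v w = c then 1 else 0)"
      using fin by (simp add: sum.If_cases Int_def)
    also have "\<dots> = (\<Sum>w\<in>W. \<Sum>v\<in>V. if b v w = c then 1 else 0)"
      by (rule sum.swap)
    also have "\<dots> = (\<Sum>w\<in>W. int (card {v\<in>V. b v w = c}))"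
      using fin by (simp add: sum.If_cases Int_def)
    finally show ?thesis .
  qed
  have "int (card {v \<in> V. \<forall>w\<in>W. b v w = 0} * card W) =
      (\<Sum>v\<in>V. int (card {w\<in>W. b v w = 0}) - int (card {w\<in>W. b v w = e}))"
    by (rule half[OF fin W b2 n1, symmetric])
  also have "\<dots> = (\<Sum>w\<in>W. int (card {v\<in>V. b v w = 0}) - int (card {v\<in>V. b v w = e}))"
    by (simp add: sum_subtractf swap)
  also have "\<dots> = int (card {w \<in> W. \<forall>v\<in>V. b v w = 0} * card V)"
    by (rule half[OF fin(2,1) V, of "\<lambda>w v. b v w"]) (use b1 n2 in auto)
  finally show ?thesis
    by (simp only: of_nat_eq_iff)
qed

text \<open>Polynomial in \<open>card K\<close> up to a power of \<open>card K\<close> in the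
  denominator, with \<open>g\<close> and \<open>m\<close> uniform over all finite subfields of one
  ring type. The denominator is allowed because passing to a dual count can divide by the size of
  the dual space.\<close>

definition laurent_count :: "('a::comm_ring set \<Rightarrow> 'a \<Rightarrow> int) \<Rightarrow> bool" where
  "laurent_count c \<longleftrightarrow> (\<exists>g :: int poly. \<exists>m :: nat. \<forall>K e. finite_subfield K e \<longrightarrow>
     c K e * int (card K) ^ m = poly g (int (card K)))"

lemma laurent_count_cong:
  assumes "laurent_count c'" "\<And>K e. finite_subfield K e \<Longrightarrow> c K e = c' K e"
  shows "laurent_count c"
  using assms unfolding laurent_count_def by simp

lemma laurent_count_poly: "laurent_count (\<lambda>K e. poly g (int (card K)))"
  unfolding laurent_count_def by (intro exI[of _ g] exI[of _ 0]) simp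

lemma laurent_count_power: "laurent_count (\<lambda>K e. int (card K) ^ m)"
  using laurent_count_poly[of "Polynomial.monom 1 m"] by (simp add: poly_monom)

lemma laurent_count_const: "laurent_count (\<lambda>K e. c)"
  using laurent_count_poly[of "[:c:]"] by simp

lemma laurent_count_add:
  assumes "laurent_count c" "laurent_count d"
  shows "laurent_count (\<lambda>K e. c K e + d K e)"
proof -
  from assms obtain g m h k where
    "\<And>K e. finite_subfield K e \<Longrightarrow> c K e * int (card K) ^ m = poly g (int (card K))"
    "\<And>K e. finite_subfield K e \<Longrightarrow> d K e * int (card K) ^ k = poly h (int (card K))"
    unfolding laurent_count_def by blast
  then have *: "c K e * int (card K) ^ m * int (card K) ^ k +
      d K e * int (card K) ^ k * int (card K) ^ m =
      poly (g * Polynomial.monom 1 k + h * Polynomial.monom 1 m) (int (card K))" if "finite_subfield K e" for K e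
    using that by (simp add: poly_monom)
  have "(c K e + d K e) * int (card K) ^ (m + k) =
      poly (g * Polynomial.monom 1 k + h * Polynomial.monom 1 m) (int (card K))" if "finite_subfield K e" for K e
    unfolding *[OF that, symmetric] by (simp add: power_add algebra_simps)
  then show ?thesis
    unfolding laurent_count_def by blast
qed

lemma laurent_count_mult:
  assumes "laurent_count c" "laurent_count d"
  shows "laurent_count (\<lambda>K e. c K e * d K e)"
proof -
  from assms obtain g m h k where
    "\<And>K e. finite_subfield K e \<Longrightarrow> c K e * int (card K) ^ m = poly g (int (card K))"
    "\<And>K e. finite_subfield K e \<Longrightarrow> d K e * int (card K) ^ k = poly h (int (card K))"
    unfolding laurent_count_def by blast
  then have *: "(c K e * int (card K) ^ m) * (d K e * int (card K) ^ k) =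
      poly (g * h) (int (card K))" if "finite_subfield K e" for K e
    using that by simp
  have "(c K e * d K e) * int (card K) ^ (m + k) = poly (g * h) (int (card K))"
    if "finite_subfield K e" for K e
    unfolding *[OF that, symmetric] by (simp add: power_add)
  then show ?thesis
    unfolding laurent_count_def by blast
qed

lemma laurent_count_sum:
  assumes "\<And>i. i \<in> I \<Longrightarrow> laurent_count (c i)"
  shows "laurent_count (\<lambda>K e. \<Sum>i\<in>I. c i K e)"
  using assms
  by (induction I rule: infinite_finite_induct)
     (auto intro: laurent_count_const laurent_count_add)

lemma laurent_count_cancel:
  assumes "laurent_count d"
    and "\<And>K e. finite_subfield K e \<Longrightarrow> c K e * int (card K) ^ m = d K e"
  shows "laurent_count c"
proof -
  from assms(1) obtain h k where
    "\<And>K e. finite_subfield K e \<Longrightarrow> d K e * int (card K) ^ k = poly h (int (card K))"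
    unfolding laurent_count_def by blast
  then have "c K e * int (card K) ^ (m + k) = poly h (int (card K))"
    if "finite_subfield K e" for K e
    using that assms(2)[OF that] by (simp add: power_add flip: mult.assoc)
  then show ?thesis
    unfolding laurent_count_def by blast
qed

section \<open>Elimination\<close>

text \<open>
  The keys \<open>\<rho>\<close> and \<open>\<kappa>\<close> order the row and the column indices: a row may only be added to rows of smaller
  key, and a column only to columns of larger key.
\<close>

definition row_op :: "'i \<Rightarrow> 'a::comm_ring \<Rightarrow> ('i \<Rightarrow> 'a) \<Rightarrow> ('i \<times> 'j \<Rightarrow> 'a) \<Rightarrow> 'i \<times> 'j \<Rightarrow> 'a" where
  "row_op i0 c u Z = (\<lambda>(i, j). if i = i0 then c * Z (i0, j) else Z (i, j) + u i * Z (i0, j))"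

definition col_op :: "'j \<Rightarrow> ('j \<Rightarrow> 'a::comm_ring) \<Rightarrow> ('i \<times> 'j \<Rightarrow> 'a) \<Rightarrow> 'i \<times> 'j \<Rightarrow> 'a" where
  "col_op j0 v Z = (\<lambda>(i, j). Z (i, j) + Z (i, j0) * v j)"

text \<open>Scaling is included for rows only, since one scalar suffices to normalize a pivot; it is
  merged with the additions so that a single row operation produces a whole pivot column.\<close>

definition elim_invariant ::
    "'a::comm_ring set \<Rightarrow> ('i \<Rightarrow> nat) \<Rightarrow> ('j \<Rightarrow> nat) \<Rightarrow> 'i set \<Rightarrow> 'j set \<Rightarrow> (('i \<times> 'j \<Rightarrow> 'a) \<Rightarrow> int) \<Rightarrow> bool" where
  "elim_invariant K \<rho> \<kappa> R C f \<longleftrightarrow> (\<forall>Z\<in>supported K (R \<times> C).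
     (\<forall>i\<in>R. \<forall>c\<in>K - {0}. \<forall>u\<in>supported K {k\<in>R. \<rho> k < \<rho> i}. f (row_op i c u Z) = f Z) \<and>
     (\<forall>j\<in>C. \<forall>v\<in>supported K {k\<in>C. \<kappa> j < \<kappa> k}. f (col_op j v Z) = f Z))"

lemma elim_invariant_row:
  assumes "elim_invariant K \<rho> \<kappa> R C f" "Z \<in> supported K (R \<times> C)" "i \<in> R" "c \<in> K - {0}"
    "u \<in> supported K {k\<in>R. \<rho> k < \<rho> i}"
  shows "f (row_op i c u Z) = f Z"
  using assms unfolding elim_invariant_def by simp

lemma elim_invariant_col:
  assumes "elim_invariant K \<rho> \<kappa> R C f" "Z \<in> supported K (R \<times> C)" "j \<in> C"
    "v \<in> supported K {k\<in>C. \<kappa> j < \<kappa> k}"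
  shows "f (col_op j v Z) = f Z"
  using assms unfolding elim_invariant_def by simp

text \<open>Rook placements: at most one position per row and per column. They index the normal
  forms that elimination leaves.\<close>

definition partial_matchings :: "'i set \<Rightarrow> 'j set \<Rightarrow> ('i \<times> 'j) set set" where
  "partial_matchings R C = {w. w \<subseteq> R \<times> C \<and> inj_on fst w \<and> inj_on snd w}"

definition matching_matrix :: "'a::zero \<Rightarrow> ('i \<times> 'j) set \<Rightarrow> 'i \<times> 'j \<Rightarrow> 'a" where
  "matching_matrix e w = (\<lambda>p. if p \<in> w then e else 0)"

lemma partial_matchings_row:
  "w \<in> partial_matchings R C \<Longrightarrow> (i, j) \<in> w \<Longrightarrow> (i, j') \<in> w \<Longrightarrow> j = j'"
  unfolding partial_matchings_def using inj_onD[of fst w "(i, j)" "(i, j')"] by simp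

lemma partial_matchings_col:
  "w \<in> partial_matchings R C \<Longrightarrow> (i, j) \<in> w \<Longrightarrow> (i', j) \<in> w \<Longrightarrow> i = i'"
  unfolding partial_matchings_def using inj_onD[of snd w "(i, j)" "(i', j)"] by simp

lemma partial_matchings_insert:
  assumes "w \<in> partial_matchings (R - {i}) (C - {j})" "i \<in> R" "j \<in> C"
  shows "insert (i, j) w \<in> partial_matchings R C"
  using assms unfolding partial_matchings_def inj_on_def by fastforce

context finite_subfield
begin

text \<open>Each operation is undone by one of the same shape, with parameters \<open>d\<close> and
  \<open>- (d * u k)\<close> for a row and \<open>- v\<close> for a column. Applying the inequality
  to both gives equality, so users of this rule need to construct only one injection.\<close>

lemma elim_invariantI:
  fixes f :: "('i \<times> 'j \<Rightarrow> 'a) \<Rightarrow> int"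
  assumes row: "\<And>Z i c u. Z \<in> supported K (R \<times> C) \<Longrightarrow> i \<in> R \<Longrightarrow> c \<in> K - {0} \<Longrightarrow>
      u \<in> supported K {k\<in>R. \<rho> k < \<rho> i} \<Longrightarrow> f Z \<le> f (row_op i c u Z)"
    and col: "\<And>Z j v. Z \<in> supported K (R \<times> C) \<Longrightarrow> j \<in> C \<Longrightarrow>
      v \<in> supported K {k\<in>C. \<kappa> j < \<kappa> k} \<Longrightarrow> f Z \<le> f (col_op j v Z)"
  shows "elim_invariant K \<rho> \<kappa> R C f"
  unfolding elim_invariant_def
proof (intro ballI conjI)
  fix Z :: "'i \<times> 'j \<Rightarrow> 'a" assume Z: "Z \<in> supported K (R \<times> C)"
  then have ZK: "Z p \<in> K" for p
    by (rule supported_K)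
  fix k0 c u assume k0: "k0 \<in> R" and c: "c \<in> K - {0}" and u: "u \<in> supported K {k\<in>R. \<rho> k < \<rho> k0}"
  obtain d where d: "d \<in> K" "c * d = e"
    using inverse_ex c by blast
  have cd: "d * (c * x) = x" if "x \<in> K" for x
    using d that by (metis mult.assoc mult.commute unit_mult)
  have "d \<noteq> 0"
    using d unit_nonzero by auto
  have uK: "u k \<in> K" for k
    using supported_K[OF u] by simp
  have u': "(\<lambda>k. - (d * u k)) \<in> supported K {k\<in>R. \<rho> k < \<rho> k0}"
    using u d(1) by (auto simp: supported_def intro!: closed_K)
  have Z': "row_op k0 c u Z \<in> supported K (R \<times> C)"
    using Z ZK uK c k0 u by (auto simp: supported_def row_op_def intro!: closed_K)
  have "row_op k0 d (\<lambda>k. - (d * u k)) (row_op k0 c u Z) = Z"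
  proof
    fix p
    have "d * u k * (c * Z (k0, i)) = u k * Z (k0, i)" for k i
      using cd[of "u k * Z (k0, i)"] uK ZK by (simp add: closed_K ac_simps)
    then show "row_op k0 d (\<lambda>k. - (d * u k)) (row_op k0 c u Z) p = Z p"
      by (cases p) (auto simp: row_op_def cd ZK)
  qed
  then show "f (row_op k0 c u Z) = f Z"
    using row[OF Z k0 c u] row[OF Z' k0 _ u', of d] d(1) \<open>d \<noteq> 0\<close> by simp
next
  fix Z :: "'i \<times> 'j \<Rightarrow> 'a" assume Z: "Z \<in> supported K (R \<times> C)"
  then have ZK: "Z p \<in> K" for p
    by (rule supported_K)
  fix i0 v assume i0: "i0 \<in> C" and v: "v \<in> supported K {i\<in>C. \<kappa> i0 < \<kappa> i}"
  have vK: "v k \<in> K" for k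
    using supported_K[OF v] by simp
  have v': "- v \<in> supported K {i\<in>C. \<kappa> i0 < \<kappa> i}"
    using v by (auto simp: supported_def intro!: closed_K)
  have Z': "col_op i0 v Z \<in> supported K (R \<times> C)"
    using Z ZK vK i0 v by (auto simp: supported_def col_op_def intro!: closed_K)
  have "v i0 = 0"
    using v by (simp add: supported_def)
  then have "col_op i0 (- v) (col_op i0 v Z) = Z"
    by (auto simp: col_op_def fun_eq_iff)
  then show "f (col_op i0 v Z) = f Z"
    using col[OF Z i0 v] col[OF Z' i0 v'] by simp
qed

text \<open>Such a matrix arises in exactly one way from a pivot value, the entries above it in
  column \<open>j0\<close>, the rest of row \<open>i0\<close>, and a matrix on the remaining rows
  and columns; by invariance \<open>f\<close> depends only on the last. The three factors count the
  other choices. As \<open>j0\<close> has the least key, every other column may be cleared with it;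
  rows of larger key than \<open>i0\<close> vanish in column \<open>j0\<close> already.\<close>

lemma pivot_sum:
  fixes f :: "('i \<times> 'j \<Rightarrow> 'a) \<Rightarrow> int"
  assumes fin: "finite R" "finite C" and inj: "inj_on \<rho> R" "inj_on \<kappa> C"
    and inv: "elim_invariant K \<rho> \<kappa> R C f"
    and i0: "i0 \<in> R" and j0: "j0 \<in> C" and min: "\<And>j. j \<in> C \<Longrightarrow> \<kappa> j0 \<le> \<kappa> j"
  shows "(\<Sum>Z | Z \<in> supported K (R \<times> C) \<and> Z (i0, j0) \<noteq> 0 \<and> (\<forall>i\<in>R. \<rho> i0 < \<rho> i \<longrightarrow> Z (i, j0) = 0). f Z) =
    (int (card K) - 1) * int (card K) ^ card {i\<in>R. \<rho> i < \<rho> i0} * int (card K) ^ card (C - {j0}) *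
    (\<Sum>Z\<in>supported K ((R - {i0}) \<times> (C - {j0})). f (\<lambda>p. matching_matrix e {(i0, j0)} p + Z p))"
proof -
  let ?U = "supported K {i\<in>R. \<rho> i < \<rho> i0}" and ?V = "supported K (C - {j0})"
    and ?W = "supported K ((R - {i0}) \<times> (C - {j0}))"
  let ?S = "{Z. Z \<in> supported K (R \<times> C) \<and> Z (i0, j0) \<noteq> 0 \<and> (\<forall>i\<in>R. \<rho> i0 < \<rho> i \<longrightarrow> Z (i, j0) = 0)}"
  let ?E = "matching_matrix e {(i0, j0)} :: 'i \<times> 'j \<Rightarrow> 'a"
  define iv where "iv a = (SOME b. b \<in> K \<and> a * b = e)" for a
  have iv: "iv a \<in> K" "a * iv a = e" if "a \<in> K" "a \<noteq> 0" for a
    using someI_ex[of "\<lambda>b. b \<in> K \<and> a * b = e"] inverse_ex[OF that] unfolding iv_def by auto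
  have iv': "a * (iv a * x) = x" "iv a * (a * x) = x" if "a \<in> K" "a \<noteq> 0" "x \<in> K" for a x
    using iv[OF that(1,2)] that(3) by (metis mult.assoc mult.commute unit_mult)+
  \<comment> \<open>\<open>h\<close> assembles a matrix from its parameters and \<open>g\<close>
    reads them off again; the last component of \<open>g\<close> is the Schur complement of the
    pivot.\<close>
  define h where "h = (\<lambda>(a, u, v, Z). \<lambda>(i, j). if i = i0 then (if j = j0 then a else a * v j)
       else if j = j0 then u i else Z (i, j) + u i * v j :: 'a)"
  define g where "g Z = (Z (i0, j0), (\<lambda>i. if i = i0 then 0 else Z (i, j0)),
      (\<lambda>j. if j = j0 then 0 else iv (Z (i0, j0)) * Z (i0, j)),
      (\<lambda>(i, j). if i = i0 \<or> j = j0 then 0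
        else Z (i, j) - Z (i, j0) * (iv (Z (i0, j0)) * Z (i0, j))))" for Z :: "'i \<times> 'j \<Rightarrow> 'a"
  have V_eq: "{k\<in>C. \<kappa> j0 < \<kappa> k} = C - {j0}"
  proof -
    have "\<kappa> j0 < \<kappa> k \<longleftrightarrow> k \<noteq> j0" if "k \<in> C" for k
      using min[OF that] inj_onD[OF inj(2) _ j0 that] by (auto simp: order.strict_iff_order)
    then show ?thesis by auto
  qed
  have ltR: "\<rho> i < \<rho> i0 \<or> i = i0 \<or> \<rho> i0 < \<rho> i" if "i \<in> R" for i
    using inj_onD[OF inj(1) _ that i0] by linarith
  have zero: "v j0 = 0" "u i0 = 0" "\<And>i. Z (i, j0) = 0" "\<And>j. Z (i0, j) = 0"
    and inK: "\<And>j. v j \<in> K" "\<And>i. u i \<in> K" "\<And>p. Z p \<in> K"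
    if "u \<in> ?U" "v \<in> ?V" "Z \<in> ?W" for u v Z
    using that(1,2,3) supported_K[OF that(1)] supported_K[OF that(2)] supported_K[OF that(3)]
    by (simp_all add: supported_def)
  have h_eq: "h (a, u, v, Z) = row_op i0 a u (col_op j0 v (\<lambda>p. ?E p + Z p))"
    if "a \<in> K" "u \<in> ?U" "v \<in> ?V" "Z \<in> ?W" for a u v Z
    using zero[OF that(2-4)] inK[OF that(2-4)] that(1)
    by (auto simp: fun_eq_iff row_op_def col_op_def matching_matrix_def h_def)
  have bij: "bij_betw h ((K - {0}) \<times> ?U \<times> ?V \<times> ?W) ?S"
  proof (rule bij_betw_byWitness[where f' = g])
    show "\<forall>x\<in>(K - {0}) \<times> ?U \<times> ?V \<times> ?W. g (h x) = x"
    proof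
      fix x assume "x \<in> (K - {0}) \<times> ?U \<times> ?V \<times> ?W"
      then obtain a u v Z where x: "x = (a, u, v, Z)" "a \<in> K" "a \<noteq> 0" "u \<in> ?U" "v \<in> ?V" "Z \<in> ?W"
        by auto
      show "g (h x) = x"
        using zero[OF x(4-6)] inK[OF x(4-6)] x(1-3)
        by (auto simp: fun_eq_iff g_def h_def iv')
    qed
    show "\<forall>Z\<in>?S. h (g Z) = Z"
    proof
      fix Z assume Z: "Z \<in> ?S"
      then have "Z p \<in> K" for p
        using supported_K[of Z "R \<times> C"] by simp
      then show "h (g Z) = Z"
        using Z by (auto simp: fun_eq_iff g_def h_def iv')
    qed
    show "h ` ((K - {0}) \<times> ?U \<times> ?V \<times> ?W) \<subseteq> ?S"
    proof
      fix y assume "y \<in> h ` ((K - {0}) \<times> ?U \<times> ?V \<times> ?W)"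
      then obtain a u v Z where x: "y = h (a, u, v, Z)" "a \<in> K" "a \<noteq> 0" "u \<in> ?U" "v \<in> ?V" "Z \<in> ?W"
        by auto
      show "y \<in> ?S"
        using inK[OF x(4-6)] x i0 j0 ltR
        by (auto simp: supported_def h_def intro!: closed_K)
    qed
    show "g ` ?S \<subseteq> (K - {0}) \<times> ?U \<times> ?V \<times> ?W"
    proof
      fix y assume "y \<in> g ` ?S"
      then obtain Z where Z: "y = g Z" "Z \<in> ?S"
        by auto
      then have "Z p \<in> K" for p
        using supported_K[of Z "R \<times> C"] by simp
      moreover have "Z (i, j0) = 0" if "i \<noteq> i0" "\<not> \<rho> i < \<rho> i0" for i
        using Z ltR[of i] that by (cases "i \<in> R") (auto simp: supported_def)
      ultimately show "y \<in> (K - {0}) \<times> ?U \<times> ?V \<times> ?W"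
        using Z iv(1)[of "Z (i0, j0)"] by (auto simp: supported_def g_def intro!: closed_K)
    qed
  qed
  have f_h: "f (h (a, u, v, Z)) = f (\<lambda>p. ?E p + Z p)"
    if "a \<in> K - {0}" "u \<in> ?U" "v \<in> ?V" "Z \<in> ?W" for a u v Z
  proof -
    have 1: "(\<lambda>p. ?E p + Z p) \<in> supported K (R \<times> C)"
      using that(4) i0 j0 inK[OF that(2-4)] by (auto simp: supported_def matching_matrix_def)
    have 2: "col_op j0 v (\<lambda>p. ?E p + Z p) \<in> supported K (R \<times> C)"
      using that i0 j0 inK[OF that(2-4)]
      by (auto simp: supported_def col_op_def matching_matrix_def intro!: closed_K)
    have "f (row_op i0 a u (col_op j0 v (\<lambda>p. ?E p + Z p))) = f (col_op j0 v (\<lambda>p. ?E p + Z p))"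
      by (rule elim_invariant_row[OF inv 2 i0 that(1,2)])
    also have "\<dots> = f (\<lambda>p. ?E p + Z p)"
      by (rule elim_invariant_col[OF inv 1 j0]) (use that(3) V_eq in simp)
    finally show ?thesis
      using h_eq[OF _ that(2-4), of a] that(1) by simp
  qed
  have "(\<Sum>Z\<in>?S. f Z) = (\<Sum>x\<in>(K - {0}) \<times> ?U \<times> ?V \<times> ?W. f (h x))"
    using sum.reindex_bij_betw[OF bij, of f] by (simp only:)
  also have "\<dots> = (\<Sum>(a, u, v, Z)\<in>(K - {0}) \<times> ?U \<times> ?V \<times> ?W. f (\<lambda>p. ?E p + Z p))"
    by (rule sum.cong) (use f_h in auto)
  also have "\<dots> = int (card (K - {0})) * (int (card ?U) * (int (card ?V) * (\<Sum>Z\<in>?W. f (\<lambda>p. ?E p + Z p))))"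
    by (simp only: sum.cartesian_product' prod.case sum_constant)
  finally have "(\<Sum>Z\<in>?S. f Z) = int (card (K - {0})) * (int (card ?U) * (int (card ?V) * (\<Sum>Z\<in>?W. f (\<lambda>p. ?E p + Z p))))" .
  moreover have "card ?U = card K ^ card {i\<in>R. \<rho> i < \<rho> i0}" "card ?V = card K ^ card (C - {j0})"
    using fin by (simp_all add: card_supported_power)
  moreover have "int (card (K - {0})) = int (card K) - 1"
    using card_K_pos by (simp add: finite_K of_nat_diff)
  ultimately show ?thesis
    by (simp only: mult.assoc of_nat_power)
qed

end

text \<open>Induction on the number of columns. The column of least key is zero or has a unique
  nonzero row of largest key; pivoting there removes one row and one column. The tree of cases does
  not depend on \<open>K\<close>, and its leaves are the partial matchings.\<close>

lemma laurent_count_matrix_sum: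
  fixes f :: "'a::comm_ring set \<Rightarrow> 'a \<Rightarrow> ('i \<times> 'j \<Rightarrow> 'a) \<Rightarrow> int"
  assumes "finite R" "finite C" "inj_on \<rho> R" "inj_on \<kappa> C"
    and "\<And>K e. finite_subfield K e \<Longrightarrow> elim_invariant K \<rho> \<kappa> R C (f K e)"
    and "\<And>w. w \<in> partial_matchings R C \<Longrightarrow> laurent_count (\<lambda>K e. f K e (matching_matrix e w))"
  shows "laurent_count (\<lambda>K e. \<Sum>Z\<in>supported K (R \<times> C). f K e Z)"
  using assms
proof (induction "card C" arbitrary: R C f)
  case 0
  then have "C = {}"
    by simp
  then have "supported K (R \<times> C) = {\<lambda>_. 0}" for K :: "'a set"
    by (auto simp: supported_def)
  then show ?case
    using "0.prems"(6)[of "{}"] by (simp add: partial_matchings_def matching_matrix_def)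
next
  case (Suc n)
  from Suc.hyps(2) have "C \<noteq> {}"
    by auto
  then have "Min (\<kappa> ` C) \<in> \<kappa> ` C"
    using Suc.prems(2) by (intro Min_in) auto
  then obtain j0 where "j0 \<in> C" and eq: "\<kappa> j0 = Min (\<kappa> ` C)"
    by auto
  have j0: "j0 \<in> C" "\<And>j. j \<in> C \<Longrightarrow> \<kappa> j0 \<le> \<kappa> j"
    using \<open>j0 \<in> C\<close> Suc.prems(2) unfolding eq by (auto intro: Min_le)
  let ?S = "\<lambda>K i0. {Z. Z \<in> supported K (R \<times> C) \<and> Z (i0, j0) \<noteq> (0::'a) \<and>
    (\<forall>i\<in>R. \<rho> i0 < \<rho> i \<longrightarrow> Z (i, j0) = 0)}"
  let ?T = "\<lambda>K i0. supported K ((R - {i0}) \<times> (C - {j0})) :: ('i \<times> 'j \<Rightarrow> 'a) set"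
  \<comment> \<open>The pivot just found is absorbed into the summand, which is why the induction
    runs over arbitrary \<open>f\<close>. Operations on the remaining rows and columns leave the
    pivot entry alone, so invariance is inherited.\<close>
  define f' where "f' i0 K e = (\<lambda>Z. f K e (\<lambda>p. matching_matrix e {(i0, j0)} p + Z p))" for i0 K e
  have split: "(\<Sum>Z\<in>supported K (R \<times> C). f K e Z) =
      (\<Sum>Z\<in>supported K (R \<times> (C - {j0})). f K e Z) + (\<Sum>i0\<in>R. \<Sum>Z\<in>?S K i0. f K e Z)"
    if "finite_subfield K e" for K e
  proof -
    interpret finite_subfield K e by fact
    have eq: "supported K (R \<times> C) = supported K (R \<times> (C - {j0})) \<union> (\<Union>i0\<in>R. ?S K i0)"
    proof (intro equalityI subsetI)
      fix Z assume Z: "Z \<in> supported K (R \<times> C)"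
      show "Z \<in> supported K (R \<times> (C - {j0})) \<union> (\<Union>i0\<in>R. ?S K i0)"
      proof (cases "\<exists>i\<in>R. Z (i, j0) \<noteq> 0")
        case True
        let ?X = "{i\<in>R. Z (i, j0) \<noteq> 0}"
        have X: "finite (\<rho> ` ?X)" "\<rho> ` ?X \<noteq> {}"
          using True Suc.prems(1) by auto
        obtain i0 where i0: "Max (\<rho> ` ?X) = \<rho> i0" "i0 \<in> ?X"
          by (rule imageE[OF Max_in[OF X]])
        have "Z (i, j0) = 0" if i: "i \<in> R" "\<rho> i0 < \<rho> i" for i
        proof (rule ccontr)
          assume "Z (i, j0) \<noteq> 0"
          then have "\<rho> i \<in> \<rho> ` ?X"
            using i(1) by blast
          then show False
            using Max_ge[OF X(1)] i(2) unfolding i0(1) by fastforce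
        qed
        then show ?thesis
          using Z i0(2) by auto
      next
        case False
        then show ?thesis
          using Z by (auto simp: supported_def)
      qed
    next
      fix Z assume "Z \<in> supported K (R \<times> (C - {j0})) \<union> (\<Union>i0\<in>R. ?S K i0)"
      then show "Z \<in> supported K (R \<times> C)"
        using supported_mono[of Z "R \<times> (C - {j0})" "R \<times> C"] by auto
    qed
    have fin: "finite (supported K (R \<times> C) :: ('i \<times> 'j \<Rightarrow> 'a) set)"
      using Suc.prems(1,2) by (intro finite_supported) auto
    have "(\<Sum>Z\<in>(\<Union>i0\<in>R. ?S K i0). f K e Z) = (\<Sum>i0\<in>R. \<Sum>Z\<in>?S K i0. f K e Z)"
    proof (rule sum.UNION_disjoint)
      show "\<forall>i\<in>R. finite (?S K i)"
        using fin by auto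
      show "\<forall>i\<in>R. \<forall>i'\<in>R. i \<noteq> i' \<longrightarrow> ?S K i \<inter> ?S K i' = {}"
      proof (intro ballI impI)
        fix i i' assume "i \<in> R" "i' \<in> R" "i \<noteq> i'"
        then have "\<rho> i < \<rho> i' \<or> \<rho> i' < \<rho> i"
          using inj_onD[OF Suc.prems(3), of i i'] by linarith
        then show "?S K i \<inter> ?S K i' = {}"
          using \<open>i \<in> R\<close> \<open>i' \<in> R\<close> by auto
      qed
    qed (rule Suc.prems(1))
    moreover have "supported K (R \<times> (C - {j0})) \<inter> (\<Union>i0\<in>R. ?S K i0) = {}"
      by (auto simp: supported_def)
    moreover have "finite (supported K (R \<times> (C - {j0})) :: ('i \<times> 'j \<Rightarrow> 'a) set)" "finite (\<Union>i0\<in>R. ?S K i0)"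
      by (rule finite_subset[OF _ fin], use eq in blast)+
    moreover have "(\<Sum>Z\<in>supported K (R \<times> C). f K e Z) =
        (\<Sum>Z\<in>supported K (R \<times> (C - {j0})) \<union> (\<Union>i0\<in>R. ?S K i0). f K e Z)"
      by (rule sum.cong[OF eq refl])
    ultimately show ?thesis
      by (simp only: sum.union_disjoint)
  qed
  have "laurent_count (\<lambda>K e. \<Sum>Z\<in>supported K (R \<times> (C - {j0})). f K e Z)"
  proof (rule Suc.hyps(1))
    show "n = card (C - {j0})"
      using Suc.hyps(2) Suc.prems(2) j0(1) by simp
    fix K e assume K: "finite_subfield K (e :: 'a)"
    then interpret finite_subfield K e .
    show "elim_invariant K \<rho> \<kappa> R (C - {j0}) (f K e)"
      unfolding elim_invariant_def
    proof (intro ballI conjI)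
      fix Z :: "'i \<times> 'j \<Rightarrow> 'a" assume "Z \<in> supported K (R \<times> (C - {j0}))"
      then have Z: "Z \<in> supported K (R \<times> C)"
        by (rule supported_mono) auto
      fix i c u assume "i \<in> R" "c \<in> K - {0}" "u \<in> supported K {k \<in> R. \<rho> k < \<rho> i}"
      then show "f K e (row_op i c u Z) = f K e Z"
        by (intro elim_invariant_row[OF Suc.prems(5)[OF K] Z])
    next
      fix Z :: "'i \<times> 'j \<Rightarrow> 'a" assume "Z \<in> supported K (R \<times> (C - {j0}))"
      then have Z: "Z \<in> supported K (R \<times> C)"
        by (rule supported_mono) auto
      fix j v assume j: "j \<in> C - {j0}" and v: "v \<in> supported K {k \<in> C - {j0}. \<kappa> j < \<kappa> k}"
      have "v \<in> supported K {k \<in> C. \<kappa> j < \<kappa> k}"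
        by (rule supported_mono[OF v]) auto
      then show "f K e (col_op j v Z) = f K e Z"
        using j by (intro elim_invariant_col[OF Suc.prems(5)[OF K] Z]) simp_all
    qed
  next
    fix w assume "w \<in> partial_matchings R (C - {j0})"
    then have "w \<in> partial_matchings R C"
      by (auto simp: partial_matchings_def)
    then show "laurent_count (\<lambda>K e. f K e (matching_matrix e w))"
      by (rule Suc.prems(6))
  qed (use Suc.prems(1-4) in \<open>auto simp: inj_on_def\<close>)
  moreover have "laurent_count (\<lambda>K e. \<Sum>i0\<in>R. \<Sum>Z\<in>?S K i0. f K e Z)"
  proof (rule laurent_count_sum)
    fix i0 assume i0: "i0 \<in> R"
    have "laurent_count (\<lambda>K e. \<Sum>Z\<in>?T K i0. f' i0 K e Z)"
    proof (rule Suc.hyps(1))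
      show "n = card (C - {j0})"
        using Suc.hyps(2) Suc.prems(2) j0(1) by simp
      fix K e assume K: "finite_subfield K (e :: 'a)"
      then interpret finite_subfield K e .
      let ?E = "matching_matrix e {(i0, j0)} :: 'i \<times> 'j \<Rightarrow> 'a"
      show "elim_invariant K \<rho> \<kappa> (R - {i0}) (C - {j0}) (f' i0 K e)"
        unfolding elim_invariant_def
      proof (intro ballI conjI)
        fix Z assume Z: "Z \<in> ?T K i0"
        then have EZ: "(\<lambda>p. ?E p + Z p) \<in> supported K (R \<times> C)"
          using supported_K[OF Z] i0 j0(1) by (auto simp: supported_def matching_matrix_def)
        fix i c u assume i: "i \<in> R - {i0}" and c: "c \<in> K - {0}"
          and u: "u \<in> supported K {k \<in> R - {i0}. \<rho> k < \<rho> i}"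
        have "row_op i c u (\<lambda>p. ?E p + Z p) = (\<lambda>p. ?E p + row_op i c u Z p)"
          using i by (auto simp: row_op_def fun_eq_iff matching_matrix_def algebra_simps)
        moreover have "f K e (row_op i c u (\<lambda>p. ?E p + Z p)) = f K e (\<lambda>p. ?E p + Z p)"
        proof (rule elim_invariant_row[OF Suc.prems(5)[OF K] EZ _ c])
          show "i \<in> R"
            using i by simp
          show "u \<in> supported K {k \<in> R. \<rho> k < \<rho> i}"
            by (rule supported_mono[OF u]) auto
        qed
        ultimately show "f' i0 K e (row_op i c u Z) = f' i0 K e Z"
          by (simp add: f'_def)
      next
        fix Z assume Z: "Z \<in> ?T K i0"
        then have EZ: "(\<lambda>p. ?E p + Z p) \<in> supported K (R \<times> C)"
          using supported_K[OF Z] i0 j0(1) by (auto simp: supported_def matching_matrix_def)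
        fix j v assume j: "j \<in> C - {j0}" and v: "v \<in> supported K {k \<in> C - {j0}. \<kappa> j < \<kappa> k}"
        have "col_op j v (\<lambda>p. ?E p + Z p) = (\<lambda>p. ?E p + col_op j v Z p)"
          using j by (auto simp: col_op_def fun_eq_iff matching_matrix_def algebra_simps)
        moreover have "f K e (col_op j v (\<lambda>p. ?E p + Z p)) = f K e (\<lambda>p. ?E p + Z p)"
        proof (rule elim_invariant_col[OF Suc.prems(5)[OF K] EZ])
          show "j \<in> C"
            using j by simp
          show "v \<in> supported K {k \<in> C. \<kappa> j < \<kappa> k}"
            by (rule supported_mono[OF v]) auto
        qed
        ultimately show "f' i0 K e (col_op j v Z) = f' i0 K e Z"
          by (simp add: f'_def)
      qed
    next
      fix w assume w: "w \<in> partial_matchings (R - {i0}) (C - {j0})"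
      then have "(i0, j0) \<notin> w"
        by (auto simp: partial_matchings_def)
      then have "(\<lambda>p. matching_matrix e {(i0, j0)} p + matching_matrix e w p) =
          matching_matrix e (insert (i0, j0) w)" for e :: 'a
        by (auto simp: matching_matrix_def fun_eq_iff)
      then show "laurent_count (\<lambda>K e. f' i0 K e (matching_matrix e w))"
        using Suc.prems(6)[OF partial_matchings_insert[OF w i0 j0(1)]] by (simp add: f'_def)
    qed (use Suc.prems(1-4) in \<open>auto simp: inj_on_def\<close>)
    then have "laurent_count (\<lambda>K e. poly [:-1, 1:] (int (card K)) *
        int (card K) ^ card {i\<in>R. \<rho> i < \<rho> i0} * int (card K) ^ card (C - {j0}) *
        (\<Sum>Z\<in>?T K i0. f' i0 K e Z))"
      by (intro laurent_count_mult laurent_count_poly laurent_count_power)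
    note * = this
    have eq: "(\<Sum>Z\<in>?S K i0. f K e Z) = poly [:-1, 1:] (int (card K)) *
        int (card K) ^ card {i\<in>R. \<rho> i < \<rho> i0} * int (card K) ^ card (C - {j0}) *
        (\<Sum>Z\<in>?T K i0. f' i0 K e Z)" if K: "finite_subfield K e" for K e
    proof -
      interpret finite_subfield K e
        by (rule K)
      have "poly [:-1, 1:] (int (card K)) = int (card K) - 1"
        by simp
      moreover have "(\<Sum>Z\<in>?S K i0. f K e Z) = (int (card K) - 1) *
        int (card K) ^ card {i\<in>R. \<rho> i < \<rho> i0} * int (card K) ^ card (C - {j0}) *
        (\<Sum>Z\<in>?T K i0. f' i0 K e Z)"
        unfolding f'_def
        by (rule pivot_sum[of R C \<rho> \<kappa> "f K e" i0 j0])
           (use Suc.prems(1-4) Suc.prems(5)[OF K] i0 j0 in auto)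
      ultimately show ?thesis
        by (simp only:)
    qed
    show "laurent_count (\<lambda>K e. \<Sum>Z\<in>?S K i0. f K e Z)"
      by (rule laurent_count_cong[OF *]) (rule eq)
  qed
  ultimately have "laurent_count (\<lambda>K e. (\<Sum>Z\<in>supported K (R \<times> (C - {j0})). f K e Z) +
      (\<Sum>i0\<in>R. \<Sum>Z\<in>?S K i0. f K e Z))"
    by (rule laurent_count_add)
  then show ?case
    by (rule laurent_count_cong) (rule split)
qed

section \<open>Commuting pairs with two adjacent blocks\<close>

text \<open>
  Pairing the \<open>I3 \<times> I5\<close> block of the commutator of \<open>x\<close> and \<open>y\<close> with \<open>Z\<close> gives a bilinear form in \<open>x\<close> and \<open>y\<close>;
  its radical in \<open>x\<close> is the following set.
\<close>

definition form_radical ::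
    "'a::comm_ring set \<Rightarrow> ('i \<times> 'i) set \<Rightarrow> 'i set \<Rightarrow> 'i set \<Rightarrow> 'i set \<Rightarrow> ('i \<times> 'i \<Rightarrow> 'a) \<Rightarrow> ('i \<times> 'i \<Rightarrow> 'a) set" where
  "form_radical K Q I3 I4 I5 Z = {x \<in> supported K Q.
     (\<forall>j\<in>I4. \<forall>k\<in>I5. (j, k) \<in> Q \<longrightarrow> (\<Sum>i\<in>I3. Z (k, i) * x (i, j)) = 0) \<and>
     (\<forall>i\<in>I3. \<forall>j\<in>I4. (i, j) \<in> Q \<longrightarrow> (\<Sum>k\<in>I5. x (j, k) * Z (k, i)) = 0)}"

text \<open>
  The assumptions \<open>cols\<close> and \<open>rows\<close> make the columns and rows of the pattern \<open>Q\<close> nested, so that the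
  elimination steps on \<open>Z\<close> can be compensated by a change of \<open>x\<close> that stays within \<open>Q\<close>.
\<close>

locale two_block_pattern =
  fixes Q :: "(nat \<times> nat) set" and I3 I4 I5 :: "nat set" and \<kappa> \<rho> :: "nat \<Rightarrow> nat"
  assumes fin: "finite Q" "finite I3" "finite I4" "finite I5"
    and disj: "I3 \<inter> I4 = {}" "I3 \<inter> I5 = {}" "I4 \<inter> I5 = {}"
    and inj: "inj_on \<kappa> I3" "inj_on \<rho> I5"
    and cols: "\<And>i0 i j. i0 \<in> I3 \<Longrightarrow> i \<in> I3 \<Longrightarrow> j \<in> I4 \<Longrightarrow> (i, j) \<in> Q \<Longrightarrow> \<kappa> i0 < \<kappa> i \<Longrightarrow> (i0, j) \<in> Q"
    and rows: "\<And>j k k0. j \<in> I4 \<Longrightarrow> k \<in> I5 \<Longrightarrow> k0 \<in> I5 \<Longrightarrow> (j, k) \<in> Q \<Longrightarrow> \<rho> k < \<rho> k0 \<Longrightarrow> (j, k0) \<in> Q"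
begin

text \<open>The row operation on \<open>Z\<close> is compensated by the inverse column operation on
  the \<open>I4 \<times> I5\<close> part of \<open>x\<close>, which leaves the products
  \<open>x Z\<close> unchanged. Nestedness \<open>rows\<close> enters twice: the new entries in
  column \<open>k0\<close> stay inside \<open>Q\<close>, and each equation of the old radical that
  the new equation at \<open>(j, k)\<close> needs, namely the one at \<open>(j, k0)\<close>, is
  available.\<close>

lemma card_form_radical_row_op:
  assumes "finite_subfield K e" and Z: "Z \<in> supported K (I5 \<times> I3)"
    and k0: "k0 \<in> I5" and c: "c \<in> K - {0}" and u: "u \<in> supported K {k\<in>I5. \<rho> k < \<rho> k0}"
  shows "card (form_radical K Q I3 I4 I5 Z) \<le> card (form_radical K Q I3 I4 I5 (row_op k0 c u Z))"
proof -
  interpret finite_subfield K e by fact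
  obtain d where d: "d \<in> K" "c * d = e"
    using inverse_ex c by blast
  have cd: "d * (c * x) = x" if "x \<in> K" for x
    using d that by (metis mult.assoc mult.commute unit_mult)
  have uK: "u k \<in> K" and ZK: "Z p \<in> K" for k p
    using supported_K[OF u] supported_K[OF Z] by auto
  have u0: "u k0 = 0"
    using u by (simp add: supported_def)
  define h where "h x = (\<lambda>(j, k). if j \<in> I4 \<and> k = k0
    then d * (x (j, k0) - (\<Sum>k\<in>I5. x (j, k) * u k)) else x (j, k))" for x :: "nat \<times> nat \<Rightarrow> 'a"
  have sum_u: "(\<Sum>k\<in>I5. x (j, k) * u k) = (\<Sum>k\<in>I5 - {k0}. x (j, k) * u k)" for x :: "nat \<times> nat \<Rightarrow> 'a" and j
    using fin k0 u0 by (simp add: sum.remove[of I5 k0])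
  show ?thesis
  proof (rule card_inj_on_le)
    show "finite (form_radical K Q I3 I4 I5 (row_op k0 c u Z))"
      using finite_supported[OF fin(1)] by (auto simp: form_radical_def)
    show "inj_on h (form_radical K Q I3 I4 I5 Z)"
    proof (rule inj_onI)
      fix x y assume xy: "x \<in> form_radical K Q I3 I4 I5 Z" "y \<in> form_radical K Q I3 I4 I5 Z" "h x = h y"
      have K: "x p \<in> K" "y p \<in> K" for p
        using xy(1,2) supported_K[of x Q] supported_K[of y Q] by (simp_all add: form_radical_def)
      have off: "x (j, k) = y (j, k)" if "\<not> (j \<in> I4 \<and> k = k0)" for j k
        using fun_cong[OF xy(3), of "(j, k)"] that by (auto simp: h_def)
      have on: "x (j, k0) = y (j, k0)" if j: "j \<in> I4" for j
      proof -
        let ?s = "\<lambda>x. (\<Sum>k\<in>I5 - {k0}. x (j, k) * u k)"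
        have "d * (x (j, k0) - ?s x) = d * (y (j, k0) - ?s y)"
          using fun_cong[OF xy(3), of "(j, k0)"] j by (simp add: h_def sum_u)
        then have "c * d * (x (j, k0) - ?s x) = c * d * (y (j, k0) - ?s y)"
          by (simp only: mult.assoc)
        then have "x (j, k0) - ?s x = y (j, k0) - ?s y"
          using K uK by (simp add: d(2) closed_K)
        moreover have "?s x = ?s y"
          using off by (intro sum.cong) auto
        ultimately show ?thesis
          by simp
      qed
      show "x = y"
      proof
        fix p show "x p = y p"
          using off[of "fst p" "snd p"] on[of "fst p"] by (cases p) auto
      qed
    qed
    show "h ` form_radical K Q I3 I4 I5 Z \<subseteq> form_radical K Q I3 I4 I5 (row_op k0 c u Z)"
    proof (rule image_subsetI)
      fix x assume x: "x \<in> form_radical K Q I3 I4 I5 Z"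
      then have xQ: "x \<in> supported K Q"
        and x1: "\<And>j k. j \<in> I4 \<Longrightarrow> k \<in> I5 \<Longrightarrow> (j, k) \<in> Q \<Longrightarrow> (\<Sum>i\<in>I3. Z (k, i) * x (i, j)) = 0"
        and x2: "\<And>i j. i \<in> I3 \<Longrightarrow> j \<in> I4 \<Longrightarrow> (i, j) \<in> Q \<Longrightarrow> (\<Sum>k\<in>I5. x (j, k) * Z (k, i)) = 0"
        by (auto simp: form_radical_def)
      have xK: "x p \<in> K" for p
        using supported_K[OF xQ] by simp
      have hQ: "h x (j, k) = 0" if jk: "(j, k) \<notin> Q" for j k
      proof (cases "j \<in> I4 \<and> k = k0")
        case True
        have "x (j, k') * u k' = 0" if k': "k' \<in> I5" for k'
        proof (cases "(j, k') \<in> Q \<and> \<rho> k' < \<rho> k0")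
          case True
          then show ?thesis
            using rows[of j k' k0] k' k0 jk \<open>j \<in> I4 \<and> k = k0\<close> by auto
        next
          case False
          then show ?thesis
            using supported_zero[OF xQ] supported_zero[OF u] by auto
        qed
        then show ?thesis
          using True jk supported_zero[OF xQ] by (simp add: h_def)
      next
        case False
        then show ?thesis
          using jk supported_zero[OF xQ] by (auto simp: h_def)
      qed
      have hK: "h x p \<in> K" for p
        using xK uK d(1) by (cases p) (auto simp: h_def intro!: closed_K)
      have hQ': "h x \<in> supported K Q"
        using hQ hK by (auto simp: supported_def)
      have h3: "h x (i, j) = x (i, j)" if "i \<in> I3" for i j
        using that disj by (auto simp: h_def)
      show "h x \<in> form_radical K Q I3 I4 I5 (row_op k0 c u Z)"
        unfolding form_radical_def
      proof (intro CollectI conjI ballI impI)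
        show "h x \<in> supported K Q" by fact
      next
        fix j k assume jk: "j \<in> I4" "k \<in> I5" "(j, k) \<in> Q"
        have "(\<Sum>i\<in>I3. row_op k0 c u Z (k, i) * h x (i, j)) =
          (if k = k0 then c * (\<Sum>i\<in>I3. Z (k0, i) * x (i, j))
           else (\<Sum>i\<in>I3. Z (k, i) * x (i, j)) + u k * (\<Sum>i\<in>I3. Z (k0, i) * x (i, j)))"
          by (simp add: h3 row_op_def sum_distrib_left sum.distrib algebra_simps)
        also have "\<dots> = 0"
        proof (cases "u k = 0 \<or> k = k0")
          case True
          then show ?thesis
            using x1[of j k] x1[of j k0] jk by auto
        next
          case False
          then have "\<rho> k < \<rho> k0"
            using supported_zero[OF u, of k] by auto
          then show ?thesis
            using x1[of j k] x1[of j k0] jk rows[of j k k0] k0 by auto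
        qed
        finally show "(\<Sum>i\<in>I3. row_op k0 c u Z (k, i) * h x (i, j)) = 0" .
      next
        fix i j assume ij: "i \<in> I3" "j \<in> I4" "(i, j) \<in> Q"
        let ?s = "\<Sum>k\<in>I5 - {k0}. x (j, k) * u k"
        have "(\<Sum>k\<in>I5. h x (j, k) * row_op k0 c u Z (k, i)) =
            h x (j, k0) * (c * Z (k0, i)) + (\<Sum>k\<in>I5 - {k0}. h x (j, k) * row_op k0 c u Z (k, i))"
          using fin k0 by (simp add: sum.remove[of I5 k0] row_op_def)
        also have "h x (j, k0) * (c * Z (k0, i)) = (x (j, k0) - ?s) * Z (k0, i)"
        proof -
          have hx: "h x (j, k0) = d * (x (j, k0) - ?s)"
            using ij unfolding h_def sum_u by simp
          have "h x (j, k0) * (c * Z (k0, i)) = d * (c * ((x (j, k0) - ?s) * Z (k0, i)))"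
            unfolding hx by (simp only: ac_simps)
          then show ?thesis
            using xK uK ZK by (simp add: cd closed_K)
        qed
        also have "(\<Sum>k\<in>I5 - {k0}. h x (j, k) * row_op k0 c u Z (k, i)) =
            (\<Sum>k\<in>I5 - {k0}. x (j, k) * Z (k, i) + x (j, k) * u k * Z (k0, i))"
          by (rule sum.cong) (auto simp: h_def row_op_def algebra_simps)
        also have "\<dots> = (\<Sum>k\<in>I5 - {k0}. x (j, k) * Z (k, i)) + ?s * Z (k0, i)"
          by (simp add: sum.distrib sum_distrib_right)
        finally have "(\<Sum>k\<in>I5. h x (j, k) * row_op k0 c u Z (k, i)) =
            x (j, k0) * Z (k0, i) + (\<Sum>k\<in>I5 - {k0}. x (j, k) * Z (k, i))"
          by (simp add: algebra_simps)
        also have "\<dots> = (\<Sum>k\<in>I5. x (j, k) * Z (k, i))"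
          using fin k0 by (simp add: sum.remove[of I5 k0])
        finally show "(\<Sum>k\<in>I5. h x (j, k) * row_op k0 c u Z (k, i)) = 0"
          using x2[OF ij] by simp
      qed
    qed
  qed
qed

text \<open>The mirror image: the inverse row operation is applied to the
  \<open>I3 \<times> I4\<close> part of \<open>x\<close>, keeping \<open>Z x\<close> fixed, and
  \<open>cols\<close> takes the role of \<open>rows\<close>.\<close>

lemma card_form_radical_col_op:
  assumes "finite_subfield K e" and Z: "Z \<in> supported K (I5 \<times> I3)"
    and i0: "i0 \<in> I3" and v: "v \<in> supported K {i\<in>I3. \<kappa> i0 < \<kappa> i}"
  shows "card (form_radical K Q I3 I4 I5 Z) \<le> card (form_radical K Q I3 I4 I5 (col_op i0 v Z))"
proof -
  interpret finite_subfield K e by fact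
  have vK: "v k \<in> K" and ZK: "Z p \<in> K" for k p
    using supported_K[OF v] supported_K[OF Z] by auto
  have v0: "v i0 = 0"
    using v by (simp add: supported_def)
  define h where "h x = (\<lambda>(i, j). if j \<in> I4 \<and> i = i0
    then x (i0, j) - (\<Sum>i\<in>I3. v i * x (i, j)) else x (i, j))" for x :: "nat \<times> nat \<Rightarrow> 'a"
  have sum_v: "(\<Sum>i\<in>I3. v i * x (i, j)) = (\<Sum>i\<in>I3 - {i0}. v i * x (i, j))" for x :: "nat \<times> nat \<Rightarrow> 'a" and j
    using fin i0 v0 by (simp add: sum.remove[of I3 i0])
  show ?thesis
  proof (rule card_inj_on_le)
    show "finite (form_radical K Q I3 I4 I5 (col_op i0 v Z))"
      using finite_supported[OF fin(1)] by (auto simp: form_radical_def)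
    show "inj_on h (form_radical K Q I3 I4 I5 Z)"
    proof (rule inj_onI)
      fix x y assume xy: "h x = h y"
      have off: "x (i, j) = y (i, j)" if "\<not> (j \<in> I4 \<and> i = i0)" for i j
        using fun_cong[OF xy, of "(i, j)"] that by (auto simp: h_def)
      have on: "x (i0, j) = y (i0, j)" if j: "j \<in> I4" for j
      proof -
        have "x (i0, j) - (\<Sum>i\<in>I3 - {i0}. v i * x (i, j)) = y (i0, j) - (\<Sum>i\<in>I3 - {i0}. v i * y (i, j))"
          using fun_cong[OF xy, of "(i0, j)"] j by (simp add: h_def sum_v)
        moreover have "(\<Sum>i\<in>I3 - {i0}. v i * x (i, j)) = (\<Sum>i\<in>I3 - {i0}. v i * y (i, j))"
          using off by (intro sum.cong) auto
        ultimately show ?thesis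
          by simp
      qed
      show "x = y"
      proof
        fix p show "x p = y p"
          using off[where i = "fst p" and j = "snd p"] on[of "snd p"] by (cases p) auto
      qed
    qed
    show "h ` form_radical K Q I3 I4 I5 Z \<subseteq> form_radical K Q I3 I4 I5 (col_op i0 v Z)"
    proof (rule image_subsetI)
      fix x assume x: "x \<in> form_radical K Q I3 I4 I5 Z"
      then have xQ: "x \<in> supported K Q"
        and x1: "\<And>j k. j \<in> I4 \<Longrightarrow> k \<in> I5 \<Longrightarrow> (j, k) \<in> Q \<Longrightarrow> (\<Sum>i\<in>I3. Z (k, i) * x (i, j)) = 0"
        and x2: "\<And>i j. i \<in> I3 \<Longrightarrow> j \<in> I4 \<Longrightarrow> (i, j) \<in> Q \<Longrightarrow> (\<Sum>k\<in>I5. x (j, k) * Z (k, i)) = 0"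
        by (auto simp: form_radical_def)
      have xK: "x p \<in> K" for p
        using supported_K[OF xQ] by simp
      have hQ: "h x (i, j) = 0" if ij: "(i, j) \<notin> Q" for i j
      proof (cases "j \<in> I4 \<and> i = i0")
        case True
        have "v i' * x (i', j) = 0" if i': "i' \<in> I3" for i'
        proof (cases "(i', j) \<in> Q \<and> \<kappa> i0 < \<kappa> i'")
          case True
          then show ?thesis
            using cols[of i0 i' j] i' i0 ij \<open>j \<in> I4 \<and> i = i0\<close> by auto
        next
          case False
          then show ?thesis
            using supported_zero[OF xQ] supported_zero[OF v] by auto
        qed
        then show ?thesis
          using True ij supported_zero[OF xQ] by (simp add: h_def)
      next
        case False
        then show ?thesis
          using ij supported_zero[OF xQ] by (auto simp: h_def)
      qed
      have hK: "h x p \<in> K" for p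
        using xK vK by (cases p) (auto simp: h_def intro!: closed_K)
      have hQ': "h x \<in> supported K Q"
        using hQ hK by (auto simp: supported_def)
      have h5: "h x (j, k) = x (j, k)" if "k \<in> I5" for j k
        using that disj by (auto simp: h_def)
      show "h x \<in> form_radical K Q I3 I4 I5 (col_op i0 v Z)"
        unfolding form_radical_def
      proof (intro CollectI conjI ballI impI)
        show "h x \<in> supported K Q" by fact
      next
        fix i j assume ij: "i \<in> I3" "j \<in> I4" "(i, j) \<in> Q"
        have "(\<Sum>k\<in>I5. h x (j, k) * col_op i0 v Z (k, i)) =
          (\<Sum>k\<in>I5. x (j, k) * Z (k, i)) + (\<Sum>k\<in>I5. x (j, k) * Z (k, i0)) * v i"
          by (simp add: h5 col_op_def sum_distrib_left sum_distrib_right sum.distrib algebra_simps)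
        also have "\<dots> = 0"
        proof (cases "v i = 0")
          case True
          then show ?thesis
            using x2[OF ij] by simp
        next
          case False
          then have "\<kappa> i0 < \<kappa> i"
            using supported_zero[OF v, of i] by auto
          then show ?thesis
            using x2[OF ij] x2[of i0 j] ij cols[of i0 i j] i0 by auto
        qed
        finally show "(\<Sum>k\<in>I5. h x (j, k) * col_op i0 v Z (k, i)) = 0" .
      next
        fix j k assume jk: "j \<in> I4" "k \<in> I5" "(j, k) \<in> Q"
        let ?s = "\<Sum>i\<in>I3 - {i0}. v i * x (i, j)"
        have "(\<Sum>i\<in>I3. col_op i0 v Z (k, i) * h x (i, j)) =
            Z (k, i0) * h x (i0, j) + (\<Sum>i\<in>I3 - {i0}. col_op i0 v Z (k, i) * h x (i, j))"
          using fin i0 v0 by (simp add: sum.remove[of I3 i0] col_op_def)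
        also have "(\<Sum>i\<in>I3 - {i0}. col_op i0 v Z (k, i) * h x (i, j)) =
            (\<Sum>i\<in>I3 - {i0}. Z (k, i) * x (i, j) + Z (k, i0) * (v i * x (i, j)))"
          by (rule sum.cong) (auto simp: h_def col_op_def algebra_simps)
        also have "\<dots> = (\<Sum>i\<in>I3 - {i0}. Z (k, i) * x (i, j)) + Z (k, i0) * ?s"
          by (simp add: sum.distrib sum_distrib_left)
        also have "h x (i0, j) = x (i0, j) - ?s"
          using jk by (simp add: h_def sum_v)
        finally have "(\<Sum>i\<in>I3. col_op i0 v Z (k, i) * h x (i, j)) =
            Z (k, i0) * x (i0, j) + (\<Sum>i\<in>I3 - {i0}. Z (k, i) * x (i, j))"
          by (simp add: algebra_simps)
        also have "\<dots> = (\<Sum>i\<in>I3. Z (k, i) * x (i, j))"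
          using fin i0 by (simp add: sum.remove[of I3 i0])
        finally show "(\<Sum>i\<in>I3. col_op i0 v Z (k, i) * h x (i, j)) = 0"
          using x1[OF jk] by simp
      qed
    qed
  qed
qed

lemma elim_invariant_form_radical:
  assumes "finite_subfield K e"
  shows "elim_invariant K \<rho> \<kappa> I5 I3 (\<lambda>Z. int (card (form_radical K Q I3 I4 I5 Z)))"
  using card_form_radical_row_op[OF assms] card_form_radical_col_op[OF assms]
  by (intro finite_subfield.elim_invariantI[OF assms]) simp_all

text \<open>With a matching for \<open>Z\<close> each defining sum has at most one nonzero term, so
  every equation kills a single coordinate. The set of killed coordinates depends on
  \<open>w\<close> and \<open>Q\<close> but not on \<open>K\<close>, so the cardinality is a fixed
  power of \<open>card K\<close>.\<close>

lemma form_radical_matching: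
  assumes "finite_subfield K e" and w: "w \<in> partial_matchings I5 I3"
  shows "form_radical K Q I3 I4 I5 (matching_matrix e w) = supported K (Q -
    ({(i, j). \<exists>k\<in>I5. (k, i) \<in> w \<and> (j, k) \<in> Q \<and> j \<in> I4} \<union>
     {(j, k). \<exists>i\<in>I3. (k, i) \<in> w \<and> (i, j) \<in> Q \<and> j \<in> I4}))" (is "?L = supported K (Q - ?B)")
proof -
  interpret finite_subfield K e by fact
  have w1: "w \<subseteq> I5 \<times> I3"
    using w by (simp add: partial_matchings_def)
  note w2 = partial_matchings_row[OF w] and w3 = partial_matchings_col[OF w]
  have s1: "(\<Sum>i\<in>I3. matching_matrix e w (k, i) * x (i, j)) = 0 \<longleftrightarrow> (\<forall>i. (k, i) \<in> w \<longrightarrow> x (i, j) = 0)"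
    if x: "x \<in> supported K Q" for x k j
  proof (cases "\<exists>i. (k, i) \<in> w")
    case True
    then obtain i where i: "(k, i) \<in> w" "i \<in> I3"
      using w1 by auto
    have wi: "(k, i') \<in> w \<longleftrightarrow> i' = i" for i'
      using i(1) w2[of k i' i] by auto
    have "(\<Sum>i'\<in>I3. matching_matrix e w (k, i') * x (i', j)) = (\<Sum>i'\<in>I3. if i' = i then x (i, j) else 0)"
      using supported_K[OF x] by (intro sum.cong) (auto simp: matching_matrix_def wi)
    then show ?thesis
      using i(2) fin by (simp add: wi)
  qed (simp add: matching_matrix_def)
  have s2: "(\<Sum>k\<in>I5. x (j, k) * matching_matrix e w (k, i)) = 0 \<longleftrightarrow> (\<forall>k. (k, i) \<in> w \<longrightarrow> x (j, k) = 0)"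
    if x: "x \<in> supported K Q" for x i j
  proof (cases "\<exists>k. (k, i) \<in> w")
    case True
    then obtain k where k: "(k, i) \<in> w" "k \<in> I5"
      using w1 by auto
    have wk: "(k', i) \<in> w \<longleftrightarrow> k' = k" for k'
      using k(1) w3[of k' i k] by auto
    have "(\<Sum>k'\<in>I5. x (j, k') * matching_matrix e w (k', i)) = (\<Sum>k'\<in>I5. if k' = k then x (j, k) else 0)"
      using supported_K[OF x] by (intro sum.cong) (auto simp: matching_matrix_def wk)
    then show ?thesis
      using k(2) fin by (simp add: wk)
  qed (simp add: matching_matrix_def)
  have "(\<forall>p\<in>?B. x p = 0) \<longleftrightarrow> (\<forall>j\<in>I4. \<forall>k\<in>I5. (j, k) \<in> Q \<longrightarrow> (\<forall>i. (k, i) \<in> w \<longrightarrow> x (i, j) = 0)) \<and>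
      (\<forall>i\<in>I3. \<forall>j\<in>I4. (i, j) \<in> Q \<longrightarrow> (\<forall>k. (k, i) \<in> w \<longrightarrow> x (j, k) = 0))" for x :: "nat \<times> nat \<Rightarrow> 'a"
    by (simp add: Ball_def) blast
  then have "?L = {x \<in> supported K Q. \<forall>p\<in>?B. x p = 0}"
    unfolding form_radical_def by (intro Collect_cong conj_cong refl) (simp only: s1 s2)
  also have "\<dots> = supported K (Q - ?B)"
  proof (intro equalityI subsetI)
    fix x assume "x \<in> supported K (Q - ?B)"
    then show "x \<in> {x \<in> supported K Q. \<forall>p\<in>?B. x p = 0}"
      using supported_mono[of x "Q - ?B" Q] supported_zero[of x K "Q - ?B"] by blast
  qed (auto simp: supported_def)
  finally show ?thesis .
qed

text \<open>The trilinear form \<open>b x y Z\<close> is read in two ways. For fixed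
  \<open>x\<close>, the \<open>y\<close> commuting with \<open>x\<close> are those orthogonal to all
  \<open>Z\<close>; by \<open>card_radicals\<close> their number equals, up to powers of
  \<open>card K\<close>, the number of \<open>Z\<close> orthogonal to all \<open>y\<close>. Summing
  over \<open>x\<close> and regrouping by \<open>Z\<close> gives the sizes of the radicals, to which
  elimination applies.\<close>

lemma laurent_count_commuting_pairs:
  "laurent_count (\<lambda>(K :: 'a::comm_ring set) e. int (card {(x, y). x \<in> supported K Q \<and> y \<in> supported K Q \<and>
     (\<forall>i\<in>I3. \<forall>k\<in>I5. (\<Sum>j\<in>I4. x (i, j) * y (j, k)) = (\<Sum>j\<in>I4. y (i, j) * x (j, k)))}))"
proof -
  let ?C = "\<lambda>x y. \<forall>i\<in>I3. \<forall>k\<in>I5. (\<Sum>j\<in>I4. x (i, j) * y (j, k)) = (\<Sum>j\<in>I4. y (i, j) * x (j, k) :: 'a)"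
  have "laurent_count (\<lambda>(K :: 'a set) e. \<Sum>Z\<in>supported K (I5 \<times> I3). int (card (form_radical K Q I3 I4 I5 Z)))"
  proof (rule laurent_count_matrix_sum[where \<rho> = \<rho> and \<kappa> = \<kappa>])
    fix w assume w: "w \<in> partial_matchings I5 I3"
    show "laurent_count (\<lambda>(K :: 'a set) e. int (card (form_radical K Q I3 I4 I5 (matching_matrix e w))))"
      by (rule laurent_count_cong[OF laurent_count_power])
         (simp only: form_radical_matching[OF _ w] card_supported_power[OF finite_Diff[OF fin(1)]] of_nat_power)
  qed (use fin inj elim_invariant_form_radical in auto)
  then have *: "laurent_count (\<lambda>(K :: 'a set) e. int (card K) ^ card Q *
      (\<Sum>Z\<in>supported K (I5 \<times> I3). int (card (form_radical K Q I3 I4 I5 Z))))"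
    by (intro laurent_count_mult laurent_count_power)
  show ?thesis
  proof (rule laurent_count_cancel[OF *, where m = "card (I5 \<times> I3)"])
    fix K :: "'a set" and e assume "finite_subfield K e"
    then interpret finite_subfield K e .
    let ?V = "supported K Q" and ?W = "supported K (I5 \<times> I3)"
    have finV: "finite ?V" and finW: "finite ?W"
      using fin by (auto intro: finite_supported)
    define b where "b x y Z = (\<Sum>k\<in>I5. \<Sum>i\<in>I3. Z (k, i) *
      ((\<Sum>j\<in>I4. x (i, j) * y (j, k)) - (\<Sum>j\<in>I4. y (i, j) * x (j, k))))" for x y Z :: "nat \<times> nat \<Rightarrow> 'a"
    have b_K: "b x y Z \<in> K" if "x \<in> ?V" "y \<in> ?V" "Z \<in> ?W" for x y Z
      using supported_K[OF that(1)] supported_K[OF that(2)] supported_K[OF that(3)]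
      by (auto simp: b_def intro!: closed_K)
    have b_scale: "b x (\<lambda>p. a * y p) Z = a * b x y Z" "b x y (\<lambda>p. a * Z p) = a * b x y Z" for a x y Z
      by (simp_all add: b_def sum_distrib_left right_diff_distrib ac_simps)
    have left_rad: "{y \<in> ?V. \<forall>Z\<in>?W. b x y Z = 0} = {y \<in> ?V. ?C x y}" if x: "x \<in> ?V" for x
    proof (intro equalityI subsetI; clarify)
      fix y i k assume y: "y \<in> ?V" "\<forall>Z\<in>?W. b x y Z = 0" and ik: "i \<in> I3" "k \<in> I5"
      let ?r = "\<lambda>k i. (\<Sum>j\<in>I4. x (i, j) * y (j, k)) - (\<Sum>j\<in>I4. y (i, j) * x (j, k))"
      have r: "?r k i \<in> K" for k i
        using supported_K[OF x] supported_K[OF y(1)] by (intro closed_K)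
      have "b x y (\<lambda>p. if p = (k, i) then e else 0) = (\<Sum>k'\<in>I5. \<Sum>i'\<in>I3. if k' = k \<and> i' = i then ?r k i else 0)"
        unfolding b_def using r by (intro sum.cong refl) auto
      also have "\<dots> = (\<Sum>k'\<in>I5. if k' = k then ?r k i else 0)"
        using ik fin by (intro sum.cong refl) auto
      also have "\<dots> = ?r k i"
        using ik fin by simp
      finally have "?r k i = 0"
        using bspec[OF y(2) supported_delta[of "(k, i)" "I5 \<times> I3"]] ik by simp
      then show "(\<Sum>j\<in>I4. x (i, j) * y (j, k)) = (\<Sum>j\<in>I4. y (i, j) * x (j, k))"
        by simp
    qed (auto simp: b_def)
    \<comment> \<open>Collecting the coefficient of each entry of \<open>y\<close> exhibits the two
      families of equations in \<open>form_radical\<close>; because the three index sets are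
      disjoint, the families involve different entries of \<open>y\<close>.\<close>
    have b_eq: "b x y Z = (\<Sum>j\<in>I4. \<Sum>k\<in>I5. (\<Sum>i\<in>I3. Z (k, i) * x (i, j)) * y (j, k)) -
        (\<Sum>i\<in>I3. \<Sum>j\<in>I4. y (i, j) * (\<Sum>k\<in>I5. x (j, k) * Z (k, i)))" for x y Z
    proof -
      have "(\<Sum>k\<in>I5. \<Sum>i\<in>I3. \<Sum>j\<in>I4. Z (k, i) * (x (i, j) * y (j, k))) =
          (\<Sum>k\<in>I5. \<Sum>j\<in>I4. \<Sum>i\<in>I3. Z (k, i) * (x (i, j) * y (j, k)))"
        by (rule sum.cong[OF refl], rule sum.swap)
      also have "\<dots> = (\<Sum>j\<in>I4. \<Sum>k\<in>I5. \<Sum>i\<in>I3. Z (k, i) * (x (i, j) * y (j, k)))"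
        by (rule sum.swap)
      finally have "(\<Sum>k\<in>I5. \<Sum>i\<in>I3. \<Sum>j\<in>I4. Z (k, i) * (x (i, j) * y (j, k))) =
          (\<Sum>j\<in>I4. \<Sum>k\<in>I5. \<Sum>i\<in>I3. Z (k, i) * (x (i, j) * y (j, k)))" .
      moreover have "(\<Sum>k\<in>I5. \<Sum>i\<in>I3. \<Sum>j\<in>I4. Z (k, i) * (y (i, j) * x (j, k))) =
          (\<Sum>i\<in>I3. \<Sum>j\<in>I4. \<Sum>k\<in>I5. Z (k, i) * (y (i, j) * x (j, k)))"
        by (subst sum.swap) (rule sum.cong[OF refl], rule sum.swap)
      moreover have "b x y Z = (\<Sum>k\<in>I5. \<Sum>i\<in>I3. \<Sum>j\<in>I4. Z (k, i) * (x (i, j) * y (j, k))) -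
          (\<Sum>k\<in>I5. \<Sum>i\<in>I3. \<Sum>j\<in>I4. Z (k, i) * (y (i, j) * x (j, k)))"
        by (simp add: b_def right_diff_distrib sum_subtractf sum_distrib_left)
      moreover have "(\<Sum>j\<in>I4. \<Sum>k\<in>I5. (\<Sum>i\<in>I3. Z (k, i) * x (i, j)) * y (j, k)) =
          (\<Sum>j\<in>I4. \<Sum>k\<in>I5. \<Sum>i\<in>I3. Z (k, i) * (x (i, j) * y (j, k)))"
        by (simp add: sum_distrib_right mult.assoc)
      moreover have "(\<Sum>i\<in>I3. \<Sum>j\<in>I4. y (i, j) * (\<Sum>k\<in>I5. x (j, k) * Z (k, i))) =
          (\<Sum>i\<in>I3. \<Sum>j\<in>I4. \<Sum>k\<in>I5. Z (k, i) * (y (i, j) * x (j, k)))"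
        by (simp add: sum_distrib_left ac_simps)
      ultimately show ?thesis
        by (simp only:)
    qed
    have right_rad: "(\<forall>y\<in>?V. b x y Z = 0) \<longleftrightarrow> x \<in> form_radical K Q I3 I4 I5 Z" if x: "x \<in> ?V" and Z: "Z \<in> ?W" for x Z
    proof
      have K: "x p \<in> K" "Z p \<in> K" for p
        using supported_K[OF x] supported_K[OF Z] by auto
      assume *: "\<forall>y\<in>?V. b x y Z = 0"
      have "(\<Sum>i\<in>I3. Z (k, i) * x (i, j)) = 0" if jk: "j \<in> I4" "k \<in> I5" "(j, k) \<in> Q" for j k
      proof -
        let ?y = "\<lambda>p. if p = (j, k) then e else 0"
        have r: "(\<Sum>i\<in>I3. Z (k, i) * x (i, j)) \<in> K" for k j
          using K by (intro closed_K)
        have "?y (i, j') = 0" if "i \<in> I3" for i j'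
          using that jk disj by auto
        then have "b x ?y Z = (\<Sum>j'\<in>I4. \<Sum>k'\<in>I5. (\<Sum>i\<in>I3. Z (k', i) * x (i, j')) * ?y (j', k'))"
          unfolding b_eq by simp
        also have "\<dots> = (\<Sum>j'\<in>I4. \<Sum>k'\<in>I5. if j' = j \<and> k' = k then (\<Sum>i\<in>I3. Z (k, i) * x (i, j)) else 0)"
          using r by (intro sum.cong refl) auto
        also have "\<dots> = (\<Sum>j'\<in>I4. if j' = j then (\<Sum>i\<in>I3. Z (k, i) * x (i, j)) else 0)"
          using jk fin by (intro sum.cong refl) auto
        also have "\<dots> = (\<Sum>i\<in>I3. Z (k, i) * x (i, j))"
          using jk fin by simp
        finally show ?thesis
          using bspec[OF * supported_delta[of "(j, k)" Q]] jk by simp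
      qed
      moreover have "(\<Sum>k\<in>I5. x (j, k) * Z (k, i)) = 0" if ij: "i \<in> I3" "j \<in> I4" "(i, j) \<in> Q" for i j
      proof -
        let ?y = "\<lambda>p. if p = (i, j) then e else 0"
        have r: "(\<Sum>k\<in>I5. x (j, k) * Z (k, i)) \<in> K" for i j
          using K by (intro closed_K)
        have "?y (j', k) = 0" if "j' \<in> I4" for j' k
          using that ij disj by auto
        then have "b x ?y Z = - (\<Sum>i'\<in>I3. \<Sum>j'\<in>I4. ?y (i', j') * (\<Sum>k\<in>I5. x (j', k) * Z (k, i')))"
          unfolding b_eq by simp
        also have "(\<Sum>i'\<in>I3. \<Sum>j'\<in>I4. ?y (i', j') * (\<Sum>k\<in>I5. x (j', k) * Z (k, i'))) =
            (\<Sum>i'\<in>I3. \<Sum>j'\<in>I4. if i' = i \<and> j' = j then (\<Sum>k\<in>I5. x (j, k) * Z (k, i)) else 0)"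
          using r by (intro sum.cong refl) auto
        also have "\<dots> = (\<Sum>i'\<in>I3. if i' = i then (\<Sum>k\<in>I5. x (j, k) * Z (k, i)) else 0)"
          using ij fin by (intro sum.cong refl) auto
        also have "\<dots> = (\<Sum>k\<in>I5. x (j, k) * Z (k, i))"
          using ij fin by simp
        finally show ?thesis
          using bspec[OF * supported_delta[of "(i, j)" Q]] ij by simp
      qed
      ultimately show "x \<in> form_radical K Q I3 I4 I5 Z"
        using x by (auto simp: form_radical_def)
    next
      assume *: "x \<in> form_radical K Q I3 I4 I5 Z"
      show "\<forall>y\<in>?V. b x y Z = 0"
      proof
        fix y assume y: "y \<in> ?V"
        have "(\<Sum>j\<in>I4. \<Sum>k\<in>I5. (\<Sum>i\<in>I3. Z (k, i) * x (i, j)) * y (j, k)) = 0"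
        proof (intro sum.neutral ballI)
          fix j k assume "j \<in> I4" "k \<in> I5"
          then show "(\<Sum>i\<in>I3. Z (k, i) * x (i, j)) * y (j, k) = 0"
            using * supported_zero[OF y, of "(j, k)"] by (cases "(j, k) \<in> Q") (auto simp: form_radical_def)
        qed
        moreover have "(\<Sum>i\<in>I3. \<Sum>j\<in>I4. y (i, j) * (\<Sum>k\<in>I5. x (j, k) * Z (k, i))) = 0"
        proof (intro sum.neutral ballI)
          fix i j assume "i \<in> I3" "j \<in> I4"
          then show "y (i, j) * (\<Sum>k\<in>I5. x (j, k) * Z (k, i)) = 0"
            using * supported_zero[OF y, of "(i, j)"] by (cases "(i, j) \<in> Q") (auto simp: form_radical_def)
        qed
        ultimately show "b x y Z = 0"
          unfolding b_eq by simp
      qed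
    qed
    have rad: "card {y \<in> ?V. ?C x y} * card ?W = card {Z \<in> ?W. x \<in> form_radical K Q I3 I4 I5 Z} * card ?V" if x: "x \<in> ?V" for x
    proof -
      have "card {y \<in> ?V. \<forall>Z\<in>?W. b x y Z = 0} * card ?W = card {Z \<in> ?W. \<forall>y\<in>?V. b x y Z = 0} * card ?V"
      proof (rule card_radicals[OF finV finW supported_diff supported_diff])
        fix y y' Z Z' :: "nat \<times> nat \<Rightarrow> 'a"
        show "b x (y + y') Z = b x y Z + b x y' Z"
          by (simp add: b_def sum.distrib sum_subtractf algebra_simps)
        show "b x y (Z + Z') = b x y Z + b x y Z'"
          by (simp add: b_def sum.distrib sum_subtractf algebra_simps)
        assume y: "y \<in> ?V" and Z: "Z \<in> ?W" and nz: "b x y Z \<noteq> 0"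
        obtain a where a: "a \<in> K" "a * b x y Z = e"
          using inverse_ex[OF b_K[OF x y Z] nz] by (auto simp: mult.commute)
        show "\<exists>Z'\<in>?W. b x y Z' = e"
          using a Z by (intro bexI[of _ "\<lambda>p. a * Z p"]) (auto simp: b_scale supported_def mult_K)
        show "\<exists>y'\<in>?V. b x y' Z = e"
          using a y by (intro bexI[of _ "\<lambda>p. a * y p"]) (auto simp: b_scale supported_def mult_K)
      qed
      moreover have "{Z \<in> ?W. \<forall>y\<in>?V. b x y Z = 0} = {Z \<in> ?W. x \<in> form_radical K Q I3 I4 I5 Z}"
        using right_rad[OF x] by auto
      ultimately show ?thesis
        by (simp only: left_rad[OF x])
    qed
    have "{(x, y). x \<in> ?V \<and> y \<in> ?V \<and> ?C x y} = Sigma ?V (\<lambda>x. {y \<in> ?V. ?C x y})"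
      by auto
    then have "card {(x, y). x \<in> ?V \<and> y \<in> ?V \<and> ?C x y} = (\<Sum>x\<in>?V. card {y \<in> ?V. ?C x y})"
      using finV by simp
    then have "card {(x, y). x \<in> ?V \<and> y \<in> ?V \<and> ?C x y} * card ?W =
        (\<Sum>x\<in>?V. card {Z \<in> ?W. x \<in> form_radical K Q I3 I4 I5 Z}) * card ?V"
      by (simp add: sum_distrib_right rad)
    also have "(\<Sum>x\<in>?V. card {Z \<in> ?W. x \<in> form_radical K Q I3 I4 I5 Z}) =
        (\<Sum>Z\<in>?W. card {x \<in> ?V. x \<in> form_radical K Q I3 I4 I5 Z})"
      using finV finW by (intro sum_multicount_gen) auto
    also have "\<dots> = (\<Sum>Z\<in>?W. card (form_radical K Q I3 I4 I5 Z))"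
      by (intro sum.cong refl arg_cong[of _ _ card]) (auto simp: form_radical_def)
    finally have "int (card {(x, y). x \<in> ?V \<and> y \<in> ?V \<and> ?C x y} * card ?W) =
        int ((\<Sum>Z\<in>?W. card (form_radical K Q I3 I4 I5 Z)) * card ?V)"
      by (rule arg_cong)
    then show "int (card {(x, y). x \<in> ?V \<and> y \<in> ?V \<and> ?C x y}) * int (card K) ^ card (I5 \<times> I3) =
        int (card K) ^ card Q * (\<Sum>Z\<in>?W. int (card (form_radical K Q I3 I4 I5 Z)))"
      using fin by (simp add: card_supported_power mult.commute)
  qed
qed

end

section \<open>Strictly block triangular matrices with at most five blocks\<close>

definition mm :: "nat \<Rightarrow> (nat \<times> nat \<Rightarrow> 'a::comm_ring) \<Rightarrow> (nat \<times> nat \<Rightarrow> 'a) \<Rightarrow> nat \<times> nat \<Rightarrow> 'a" where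
  "mm n x y = (\<lambda>(i, j). \<Sum>k<n. x (i, k) * y (k, j))"

lemma mm_assoc: "mm n (mm n x y) z = mm n x (mm n y z)"
proof
  fix p :: "nat \<times> nat"
  obtain i j where p: "p = (i, j)"
    by fastforce
  have "(\<Sum>k<n. (\<Sum>m<n. x (i, m) * y (m, k)) * z (k, j)) = (\<Sum>k<n. \<Sum>m<n. x (i, m) * (y (m, k) * z (k, j)))"
    by (simp add: sum_distrib_right mult.assoc)
  also have "\<dots> = (\<Sum>m<n. \<Sum>k<n. x (i, m) * (y (m, k) * z (k, j)))"
    by (rule sum.swap)
  finally show "mm n (mm n x y) z p = mm n x (mm n y z) p"
    by (simp add: mm_def p sum_distrib_left)
qed

lemma mm_add_left: "mm n (x + y) z = mm n x z + mm n y z"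
  and mm_add_right: "mm n z (x + y) = mm n z x + mm n z y"
  by (auto simp: mm_def fun_eq_iff sum.distrib algebra_simps)

text \<open>The trace of \<open>x y\<close>. It identifies matrices on \<open>B \<times> A\<close>
  with the dual of those on \<open>A \<times> B\<close>, and its cyclicity moves a factor from the
  unknown to the dual variable.\<close>

definition trace_pairing :: "nat \<Rightarrow> (nat \<times> nat \<Rightarrow> 'a::comm_ring) \<Rightarrow> (nat \<times> nat \<Rightarrow> 'a) \<Rightarrow> 'a" where
  "trace_pairing n x y = (\<Sum>i<n. \<Sum>j<n. x (i, j) * y (j, i))"

lemma trace_pairing_commute: "trace_pairing n x y = trace_pairing n y x"
  unfolding trace_pairing_def by (subst sum.swap) (simp add: mult.commute)

lemma trace_pairing_mm: "trace_pairing n z (mm n x y) = trace_pairing n (mm n z x) y"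
proof -
  have "trace_pairing n z (mm n x y) = (\<Sum>i<n. \<Sum>j<n. \<Sum>k<n. z (i, j) * (x (j, k) * y (k, i)))"
    by (simp add: trace_pairing_def mm_def sum_distrib_left)
  also have "\<dots> = (\<Sum>i<n. \<Sum>k<n. \<Sum>j<n. z (i, j) * (x (j, k) * y (k, i)))"
    by (rule sum.cong[OF refl], rule sum.swap)
  also have "\<dots> = trace_pairing n (mm n z x) y"
    by (simp add: trace_pairing_def mm_def sum_distrib_right mult.assoc)
  finally show ?thesis .
qed

lemma trace_pairing_mm': "trace_pairing n z (mm n y x) = trace_pairing n (mm n x z) y"
proof -
  have "trace_pairing n z (mm n y x) = trace_pairing n (mm n y x) z"
    by (rule trace_pairing_commute)
  also have "\<dots> = trace_pairing n y (mm n x z)"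
    by (rule trace_pairing_mm[symmetric])
  also have "\<dots> = trace_pairing n (mm n x z) y"
    by (rule trace_pairing_commute)
  finally show ?thesis .
qed

lemma trace_pairing_linear:
  "trace_pairing n z (x + y) = trace_pairing n z x + trace_pairing n z y"
  "trace_pairing n z (x - y) = trace_pairing n z x - trace_pairing n z y"
  "trace_pairing n (x + y) z = trace_pairing n x z + trace_pairing n y z"
  "trace_pairing n (x - y) z = trace_pairing n x z - trace_pairing n y z"
  by (simp_all add: trace_pairing_def sum.distrib sum_subtractf algebra_simps)

context finite_subfield
begin

lemma mm_K: "x \<in> supported K P \<Longrightarrow> y \<in> supported K Q \<Longrightarrow> mm n x y p \<in> K"
  using supported_K[of x P] supported_K[of y Q] by (cases p) (auto simp: mm_def intro!: closed_K)

lemma mm_supported: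
  assumes "x \<in> supported K P" "y \<in> supported K Q"
    and "\<And>i j k. (i, k) \<in> P \<Longrightarrow> (k, j) \<in> Q \<Longrightarrow> (i, j) \<in> R"
  shows "mm n x y \<in> supported K R"
proof -
  have "mm n x y (i, j) = 0" if "(i, j) \<notin> R" for i j
  proof -
    have "x (i, k) * y (k, j) = 0" for k
      using assms(3)[of i k j] that supported_zero[OF assms(1), of "(i, k)"]
        supported_zero[OF assms(2), of "(k, j)"] by (cases "(i, k) \<in> P"; cases "(k, j) \<in> Q") auto
    then show ?thesis
      by (simp add: mm_def)
  qed
  then show ?thesis
    using mm_K[OF assms(1,2)] by (auto simp: supported_def)
qed

lemma trace_pairing_K: "x \<in> supported K P \<Longrightarrow> y \<in> supported K Q \<Longrightarrow> trace_pairing n x y \<in> K"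
  using supported_K[of x P] supported_K[of y Q] by (auto simp: trace_pairing_def intro!: closed_K)

lemma trace_pairing_nondegenerate:
  assumes x: "x \<in> supported K (R \<times> C)" and "R \<subseteq> {..<n}" "C \<subseteq> {..<n}"
    and *: "\<And>y. y \<in> supported K (C \<times> R) \<Longrightarrow> trace_pairing n x y = 0"
  shows "x = 0"
proof
  fix p :: "nat \<times> nat"
  obtain i j where p: "p = (i, j)"
    by fastforce
  show "x p = 0 p"
  proof (cases "(i, j) \<in> R \<times> C")
    case True
    then have ij: "i < n" "j < n"
      using assms by auto
    have "trace_pairing n x (\<lambda>p. if p = (j, i) then e else 0) =
        (\<Sum>i'<n. \<Sum>j'<n. if j' = j then if i' = i then x (i, j) else 0 else 0)"
      unfolding trace_pairing_def using supported_K[OF x] by (intro sum.cong refl) auto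
    also have "\<dots> = x (i, j)"
      using ij by simp
    finally show ?thesis
      using *[OF supported_delta[of "(j, i)"]] True p by simp
  next
    case False
    then show ?thesis
      using supported_zero[OF x] p by simp
  qed
qed

text \<open>Built from \<open>e\<close> because the ambient ring type provides no unit; accordingly
  it is neutral only for matrices with entries in \<open>K\<close> and indices below
  \<open>n\<close>.\<close>

definition idm :: "nat \<Rightarrow> nat \<times> nat \<Rightarrow> 'a" where
  "idm n = (\<lambda>(i, j). if i = j \<and> i < n then e else 0)"

lemma mm_idm:
  assumes x: "x \<in> supported K P" and P: "P \<subseteq> {..<n} \<times> {..<n}"
  shows "mm n (idm n) x = x" "mm n x (idm n) = x"
proof -
  have out: "x (i, j) = 0" if "\<not> (i < n \<and> j < n)" for i j
    using that P supported_zero[OF x, of "(i, j)"] by auto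
  have "(\<Sum>k<n. idm n (i, k) * x (k, j)) = (\<Sum>k<n. if k = i then x (i, j) else 0)" for i j
    using supported_K[OF x] out by (intro sum.cong refl) (auto simp: idm_def)
  then show "mm n (idm n) x = x"
    using out by (auto simp: mm_def fun_eq_iff)
  have "(\<Sum>k<n. x (i, k) * idm n (k, j)) = (\<Sum>k<n. if k = j then x (i, j) else 0)" for i j
    using supported_K[OF x] out by (intro sum.cong refl) (auto simp: idm_def)
  then show "mm n x (idm n) = x"
    using out by (auto simp: mm_def fun_eq_iff)
qed

section \<open>Elementary matrices realizing the row and column operations\<close>

definition row_elem :: "nat \<Rightarrow> nat \<Rightarrow> 'a \<Rightarrow> (nat \<Rightarrow> 'a) \<Rightarrow> nat \<times> nat \<Rightarrow> 'a" where
  "row_elem n i0 c u = (\<lambda>(i, j). if i = j then (if i < n then if i = i0 then c else e else 0)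
     else if j = i0 then u i else 0)"

definition col_elem :: "nat \<Rightarrow> nat \<Rightarrow> (nat \<Rightarrow> 'a) \<Rightarrow> nat \<times> nat \<Rightarrow> 'a" where
  "col_elem n j0 v = (\<lambda>(i, j). if i = j then (if i < n then e else 0) else if i = j0 then v j else 0)"

lemma mm_row_elem:
  assumes x: "x \<in> supported K ({..<n} \<times> {..<n})" and i0: "i0 < n"
    and u: "u \<in> supported K {..<n}"
  shows "mm n (row_elem n i0 c u) x = row_op i0 c u x"
proof
  fix p :: "nat \<times> nat"
  obtain i j where p: "p = (i, j)"
    by fastforce
  have "(\<Sum>k<n. row_elem n i0 c u (i, k) * x (k, j)) =
      (\<Sum>k<n. (if k = i then (if i = i0 then c * x (i0, j) else x (i, j)) else 0) +
        (if k = i0 then (if i = i0 then 0 else u i * x (i0, j)) else 0))"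
    using supported_K[OF x] by (intro sum.cong refl) (auto simp: row_elem_def)
  also have "\<dots> = row_op i0 c u x (i, j)"
    using i0 supported_zero[OF x, of "(i, j)"] supported_zero[OF u, of i]
    by (auto simp: sum.distrib row_op_def)
  finally show "mm n (row_elem n i0 c u) x p = row_op i0 c u x p"
    by (simp add: mm_def p)
qed

lemma mm_col_elem:
  assumes x: "x \<in> supported K ({..<n} \<times> {..<n})" and j0: "j0 < n"
    and v: "v \<in> supported K {..<n}" and "v j0 = 0"
  shows "mm n x (col_elem n j0 v) = col_op j0 v x"
proof
  fix p :: "nat \<times> nat"
  obtain i j where p: "p = (i, j)"
    by fastforce
  have "(\<Sum>k<n. x (i, k) * col_elem n j0 v (k, j)) =
      (\<Sum>k<n. (if k = j then x (i, j) else 0) + (if k = j0 then x (i, j0) * v j else 0))"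
    using supported_K[OF x] \<open>v j0 = 0\<close> by (intro sum.cong refl) (auto simp: col_elem_def)
  also have "\<dots> = col_op j0 v x (i, j)"
    using j0 supported_zero[OF x, of "(i, j)"] supported_zero[OF v, of j]
    by (auto simp: sum.distrib col_op_def)
  finally show "mm n x (col_elem n j0 v) p = col_op j0 v x p"
    by (simp add: mm_def p)
qed

lemma row_elem_inverse:
  assumes i0: "i0 < n" and c: "c \<in> K" "d \<in> K" "c * d = e"
    and u: "u \<in> supported K {..<n}" "u i0 = 0"
  shows "mm n (row_elem n i0 c u) (row_elem n i0 d (\<lambda>k. - (d * u k))) = idm n"
proof -
  have uK: "u k \<in> K" for k
    using supported_K[OF u(1)] by simp
  have un: "u k = 0" if "\<not> k < n" for k
    using supported_zero[OF u(1), of k] that by simp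
  have "row_elem n i0 d (\<lambda>k. - (d * u k)) \<in> supported K ({..<n} \<times> {..<n})"
    using i0 c uK un by (auto simp: supported_def row_elem_def intro!: closed_K)
  moreover have "row_op i0 c u (row_elem n i0 d (\<lambda>k. - (d * u k))) = idm n"
    using i0 c u(2) uK un by (auto simp: row_op_def row_elem_def idm_def fun_eq_iff mult.commute)
  ultimately show ?thesis
    using mm_row_elem[OF _ i0 u(1)] by simp
qed

lemma col_elem_inverse:
  assumes j0: "j0 < n" and v: "v \<in> supported K {..<n}" "v j0 = 0"
  shows "mm n (col_elem n j0 v) (col_elem n j0 (- v)) = idm n"
proof -
  have vK: "v k \<in> K" for k
    using supported_K[OF v(1)] by simp
  have vn: "v k = 0" if "\<not> k < n" for k
    using supported_zero[OF v(1), of k] that by simp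
  have v': "- v \<in> supported K {..<n}"
    using v(1) by (auto simp: supported_def intro: closed_K)
  have "col_elem n j0 v \<in> supported K ({..<n} \<times> {..<n})"
    using j0 vK vn by (auto simp: supported_def col_elem_def intro!: closed_K)
  moreover have "col_op j0 (- v) (col_elem n j0 v) = idm n"
    using j0 v(2) vK vn by (auto simp: col_op_def col_elem_def idm_def fun_eq_iff closed_K)
  ultimately show ?thesis
    using mm_col_elem[OF _ j0 v'] v(2) by simp
qed

end

text \<open>
  The level \<open>l i\<close> is the number of the block containing the index \<open>i\<close>, counted from \<open>0\<close>; blocks may be
  empty, which covers shorter flags. The subset \<open>A\<close> consists of the first two blocks and \<open>B\<close> of the last
  three. Products of two elements supported on \<open>D\<close> then live in the blocks \<open>2 \<times> 4\<close> only.
\<close>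

locale flag_levels =
  fixes n :: nat and l :: "nat \<Rightarrow> nat"
  assumes l_mono: "i \<le> j \<Longrightarrow> l i \<le> l j" and l_bound: "i < n \<Longrightarrow> l i \<le> 4"
begin

definition A :: "nat set" where "A = {i. i < n \<and> l i \<le> 1}"
definition B :: "nat set" where "B = {i. i < n \<and> 2 \<le> l i}"
definition U :: "(nat \<times> nat) set" where "U = {(i, j). i < n \<and> j < n \<and> l i < l j}"
definition D :: "(nat \<times> nat) set" where "D = U \<inter> (A \<times> A \<union> B \<times> B)"
text \<open>The conditions left after dualizing: \<open>Z\<close> lives in the corner
  \<open>B \<times> A\<close> opposite to the one that has been eliminated, and \<open>x\<close>,
  \<open>y\<close> are the diagonal parts of a commuting pair.\<close>

definition centralizing_pairs ::
    "'a::comm_ring set \<Rightarrow> (nat \<times> nat \<Rightarrow> 'a) \<Rightarrow> ((nat \<times> nat \<Rightarrow> 'a) \<times> (nat \<times> nat \<Rightarrow> 'a)) set" where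
  "centralizing_pairs K Z = {(x, y). x \<in> supported K D \<and> y \<in> supported K D \<and>
     mm n Z x = mm n x Z \<and> mm n Z y = mm n y Z \<and> mm n x y = mm n y x}"

lemma centralizing_pairs_iff:
  "(x, y) \<in> centralizing_pairs K Z \<longleftrightarrow> x \<in> supported K D \<and> y \<in> supported K D \<and>
     mm n Z x = mm n x Z \<and> mm n Z y = mm n y Z \<and> mm n x y = mm n y x"
  unfolding centralizing_pairs_def mem_Collect_eq prod.case ..

lemma centralizing_pairs_subset: "centralizing_pairs K Z \<subseteq> supported K D \<times> supported K D"
  unfolding centralizing_pairs_def by fast

lemma fin_sets: "finite A" "finite B" "finite U" "finite D"
proof -
  show "finite A" "finite B"
    by (auto simp: A_def B_def)
  have "U \<subseteq> {..<n} \<times> {..<n}"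
    by (auto simp: U_def)
  then show "finite U" "finite D"
    using finite_subset[of U "{..<n} \<times> {..<n}"] by (auto simp: D_def)
qed

lemma D_subset: "D \<subseteq> {..<n} \<times> {..<n}"
  by (auto simp: D_def U_def)

lemma AB: "A \<inter> B = {}" "A \<subseteq> {..<n}" "B \<subseteq> {..<n}" "A \<union> B = {..<n}"
  by (auto simp: A_def B_def)

lemma U_eq: "U = D \<union> A \<times> B" "D \<inter> A \<times> B = {}"
  by (auto simp: D_def U_def A_def B_def)

text \<open>Simultaneous conjugation of \<open>x\<close>, \<open>y\<close> and \<open>Z\<close>.
  Factors supported at \<open>l i \<le> l j\<close> inside the two diagonal parts keep
  \<open>D\<close> stable; this is the restriction that limits the elimination on \<open>Z\<close>
  to triangular operations.\<close>

lemma card_centralizing_pairs_conj: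
  fixes K :: "'a::comm_ring set"
  assumes fs: "finite_subfield K e"
    and P: "P \<in> supported K {(i, j). (i, j) \<in> A \<times> A \<union> B \<times> B \<and> l i \<le> l j}"
    and P': "P' \<in> supported K {(i, j). (i, j) \<in> A \<times> A \<union> B \<times> B \<and> l i \<le> l j}"
    and inv: "mm n P P' = finite_subfield.idm e n" "mm n P' P = finite_subfield.idm e n"
    and Z: "Z \<in> supported K (B \<times> A)"
  shows "card (centralizing_pairs K Z) \<le> card (centralizing_pairs K (mm n P (mm n Z P')))"
proof -
  interpret finite_subfield K e by fact
  let ?L = "{(i, j). (i, j) \<in> A \<times> A \<union> B \<times> B \<and> l i \<le> l j}"
  let ?c = "\<lambda>x. mm n P (mm n x P')"
  have c_mult: "?c (mm n x y) = mm n (?c x) (?c y)" if x: "x \<in> supported K X" "X \<subseteq> {..<n} \<times> {..<n}"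
    and y: "y \<in> supported K Y" "Y \<subseteq> {..<n} \<times> {..<n}" for x y X Y
  proof -
    have "mm n (?c x) (?c y) = mm n P (mm n x (mm n (mm n P' P) (mm n y P')))"
      by (simp only: mm_assoc)
    also have "mm n (mm n P' P) (mm n y P') = mm n y P'"
      unfolding inv(2) mm_assoc[symmetric] mm_idm(1)[OF y] ..
    finally show ?thesis
      by (simp only: mm_assoc)
  qed
  have c_inv: "mm n P' (mm n (?c x) P) = x" if x: "x \<in> supported K X" "X \<subseteq> {..<n} \<times> {..<n}" for x X
  proof -
    have "mm n P' (mm n (?c x) P) = mm n (mm n P' P) (mm n x (mm n P' P))"
      by (simp only: mm_assoc)
    then show ?thesis
      unfolding inv(2) by (simp only: mm_idm[OF x])
  qed
  have c_D: "?c x \<in> supported K D" if x: "x \<in> supported K D" for x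
    by (rule mm_supported[OF P mm_supported[OF x P', of D]]) (auto simp: D_def U_def A_def B_def)
  have BA: "B \<times> A \<subseteq> {..<n} \<times> {..<n}"
    using AB by auto
  show ?thesis
  proof (rule card_inj_on_le[where f = "\<lambda>(x, y). (?c x, ?c y)"])
    show "inj_on (\<lambda>(x, y). (?c x, ?c y)) (centralizing_pairs K Z)"
    proof (rule inj_onI)
      fix p q assume pq: "p \<in> centralizing_pairs K Z" "q \<in> centralizing_pairs K Z"
        "(\<lambda>(x, y). (?c x, ?c y)) p = (\<lambda>(x, y). (?c x, ?c y)) q"
      obtain x y x' y' where eq: "p = (x, y)" "q = (x', y')"
        by (cases p, cases q)
      have D: "x \<in> supported K D" "y \<in> supported K D" "x' \<in> supported K D" "y' \<in> supported K D"
        using pq(1,2) centralizing_pairs_subset unfolding eq by blast+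
      have c: "?c x = ?c x'" "?c y = ?c y'"
        using pq(3) unfolding eq by (simp_all only: prod.case prod.inject)
      have "x = x'"
        using c_inv[OF D(1) D_subset, unfolded c(1)] c_inv[OF D(3) D_subset] by (rule trans[OF sym])
      moreover have "y = y'"
        using c_inv[OF D(2) D_subset, unfolded c(2)] c_inv[OF D(4) D_subset] by (rule trans[OF sym])
      ultimately have "x = x'" "y = y'" .
      then show "p = q"
        using eq by simp
    qed
    show "(\<lambda>(x, y). (?c x, ?c y)) ` centralizing_pairs K Z \<subseteq> centralizing_pairs K (?c Z)"
    proof (rule image_subsetI)
      fix p assume p': "p \<in> centralizing_pairs K Z"
      obtain x y where p: "p = (x, y)"
        by (cases p)
      note xy = p'[unfolded p centralizing_pairs_iff]
      have x: "x \<in> supported K D" and y: "y \<in> supported K D"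
        and c: "mm n Z x = mm n x Z" "mm n Z y = mm n y Z" "mm n x y = mm n y x"
        by (rule xy[THEN conjunct1] xy[THEN conjunct2, THEN conjunct1]
            xy[THEN conjunct2, THEN conjunct2, THEN conjunct1]
            xy[THEN conjunct2, THEN conjunct2, THEN conjunct2, THEN conjunct1]
            xy[THEN conjunct2, THEN conjunct2, THEN conjunct2, THEN conjunct2])+
      have "mm n (?c Z) (?c x) = mm n (?c x) (?c Z)" "mm n (?c Z) (?c y) = mm n (?c y) (?c Z)"
        "mm n (?c x) (?c y) = mm n (?c y) (?c x)"
        unfolding c_mult[OF Z BA x D_subset, symmetric] c_mult[OF x D_subset Z BA, symmetric]
          c_mult[OF Z BA y D_subset, symmetric] c_mult[OF y D_subset Z BA, symmetric]
          c_mult[OF x D_subset y D_subset, symmetric] c_mult[OF y D_subset x D_subset, symmetric]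
        by (simp_all only: c)
      then show "(\<lambda>(x, y). (?c x, ?c y)) p \<in> centralizing_pairs K (?c Z)"
        unfolding p prod.case centralizing_pairs_iff using c_D[OF x] c_D[OF y] by (intro conjI)
    qed
    show "finite (centralizing_pairs K (?c Z))"
      by (rule finite_subset[OF centralizing_pairs_subset]) (simp add: finite_supported fin_sets)
  qed
qed

text \<open>A row of \<open>Z\<close> has its index in \<open>B\<close>, and the conjugating matrix
  differs from the identity only in \<open>B \<times> B\<close>, so its inverse acts trivially on
  the columns of \<open>Z\<close>, which lie in \<open>A\<close>; columns are treated in the same
  way. Since the level is monotone in the index, the natural order of indices serves for both
  keys.\<close>

lemma elim_invariant_centralizing_pairs:
  fixes K :: "'a::comm_ring set"
  assumes fs: "finite_subfield K e"
  shows "elim_invariant K (\<lambda>i. i) (\<lambda>i. i) B A (\<lambda>Z. int (card (centralizing_pairs K Z)))"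
proof -
  interpret finite_subfield K e by fact
  let ?L = "{(i, j). (i, j) \<in> A \<times> A \<union> B \<times> B \<and> l i \<le> l j}"
  show ?thesis
  proof (rule elim_invariantI)
    fix Z i0 c u assume Z: "Z \<in> supported K (B \<times> A)" and i0: "i0 \<in> B" and c: "c \<in> K - {0}"
      and u: "u \<in> supported K {k \<in> B. k < i0}"
    obtain d where d: "d \<in> K" "c * d = e"
      using inverse_ex c by blast
    have dc: "d * c = e"
      using d by (simp add: mult.commute)
    let ?u = "\<lambda>k. - (d * u k)"
    have uK: "u k \<in> K" and uz: "\<not> (k \<in> B \<and> k < i0) \<Longrightarrow> u k = 0" for k
      using supported_K[OF u] supported_zero[OF u, of k] by auto
    have u': "?u \<in> supported K {k \<in> B. k < i0}"
      using uK uz d(1) by (auto simp: supported_def intro!: closed_K)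
    have un: "u \<in> supported K {..<n}" "?u \<in> supported K {..<n}"
      using supported_mono[OF u, of "{..<n}"] supported_mono[OF u', of "{..<n}"] by (auto simp: B_def)
    have i0n: "i0 < n"
      using i0 by (simp add: B_def)
    have L: "row_elem n i0 a v \<in> supported K ?L" if "a \<in> K" "v \<in> supported K {k \<in> B. k < i0}" for a v
    proof -
      have "v k = 0" if "\<not> (k \<in> B \<and> l k \<le> l i0)" for k
        using l_mono[of k i0] that \<open>v \<in> _\<close> by (cases "k < i0") (auto simp: supported_def)
      then show ?thesis
        using that(1) i0 supported_K[OF that(2)] AB(4) by (auto simp: supported_def row_elem_def)
    qed
    have ZN: "Z \<in> supported K ({..<n} \<times> {..<n})"
      using AB by (intro supported_mono[OF Z]) auto
    have 1: "mm n Z (row_elem n i0 d ?u) = Z"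
    proof
      fix p :: "nat \<times> nat"
      obtain i j where p: "p = (i, j)"
        by fastforce
      have "Z (i, k) * row_elem n i0 d ?u (k, j) = (if k = j then Z (i, j) else 0)" if "k < n" for k
      proof (cases "(i, k) \<in> B \<times> A")
        case True
        then have "u k = 0"
          using AB(1) by (intro uz) auto
        then show ?thesis
          using True i0 AB(1) supported_K[OF Z] that by (auto simp: row_elem_def)
      next
        case False
        then show ?thesis
          using supported_zero[OF Z] by auto
      qed
      then show "mm n Z (row_elem n i0 d ?u) p = Z p"
        using supported_zero[OF ZN, of "(i, j)"] by (auto simp: mm_def p)
    qed
    have 2: "mm n (row_elem n i0 c u) (row_elem n i0 d ?u) = idm n"
      using c d by (intro row_elem_inverse i0n un uz) auto
    have "(\<lambda>k. - (c * ?u k)) = u"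
    proof
      fix k
      have "c * (d * u k) = u k"
        using d uK by (metis mult.assoc unit_mult)
      then show "- (c * ?u k) = u k"
        by simp
    qed
    then have 3: "mm n (row_elem n i0 d ?u) (row_elem n i0 c u) = idm n"
      using row_elem_inverse[OF i0n d(1) _ dc un(2)] c uz by simp
    have "int (card (centralizing_pairs K Z)) \<le>
        int (card (centralizing_pairs K (mm n (row_elem n i0 c u) (mm n Z (row_elem n i0 d ?u)))))"
      using card_centralizing_pairs_conj[OF fs L[OF _ u] L[OF d(1) u'] 2 3 Z] c by simp
    then show "int (card (centralizing_pairs K Z)) \<le> int (card (centralizing_pairs K (row_op i0 c u Z)))"
      unfolding 1 mm_row_elem[OF ZN i0n un(1)] .
  next
    fix Z j0 v assume Z: "Z \<in> supported K (B \<times> A)" and j0: "j0 \<in> A"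
      and v: "v \<in> supported K {k \<in> A. j0 < k}"
    have vK: "v k \<in> K" and vz: "\<not> (k \<in> A \<and> j0 < k) \<Longrightarrow> v k = 0" for k
      using supported_K[OF v] supported_zero[OF v, of k] by auto
    have v': "- v \<in> supported K {k \<in> A. j0 < k}"
      using vK vz by (auto simp: supported_def intro!: closed_K)
    have vn: "v \<in> supported K {..<n}" "- v \<in> supported K {..<n}"
      using supported_mono[OF v, of "{..<n}"] supported_mono[OF v', of "{..<n}"] by (auto simp: A_def)
    have j0n: "j0 < n"
      using j0 by (simp add: A_def)
    have L: "col_elem n j0 v \<in> supported K ?L" if "v \<in> supported K {k \<in> A. j0 < k}" for v
    proof -
      have "v k = 0" if "\<not> (k \<in> A \<and> l j0 \<le> l k)" for k
        using l_mono[of j0 k] that \<open>v \<in> _\<close> by (cases "j0 < k") (auto simp: supported_def)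
      then show ?thesis
        using j0 supported_K[OF that] AB(4) by (auto simp: supported_def col_elem_def)
    qed
    have ZN: "Z \<in> supported K ({..<n} \<times> {..<n})"
      using AB by (intro supported_mono[OF Z]) auto
    have 1: "mm n (col_elem n j0 (- v)) X = X" if X: "X \<in> supported K (B \<times> A)" for X
    proof
      fix p :: "nat \<times> nat"
      obtain i j where p: "p = (i, j)"
        by fastforce
      have "col_elem n j0 (- v) (i, k) * X (k, j) = (if k = i then X (i, j) else 0)" if "k < n" for k
      proof (cases "(k, j) \<in> B \<times> A")
        case True
        then have "v k = 0"
          using AB(1) by (intro vz) auto
        then show ?thesis
          using True j0 AB(1) supported_K[OF X] that by (auto simp: col_elem_def)
      next
        case False
        then show ?thesis
          using supported_zero[OF X] by auto
      qed
      then show "mm n (col_elem n j0 (- v)) X p = X p"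
        using supported_zero[OF X, of "(i, j)"] AB by (auto simp: mm_def p)
    qed
    have 2: "mm n (col_elem n j0 (- v)) (col_elem n j0 v) = idm n"
      using col_elem_inverse[OF j0n vn(2)] vz by simp
    have 3: "mm n (col_elem n j0 v) (col_elem n j0 (- v)) = idm n"
      using col_elem_inverse[OF j0n vn(1)] vz by simp
    have "int (card (centralizing_pairs K Z)) \<le>
        int (card (centralizing_pairs K (mm n (col_elem n j0 (- v)) (mm n Z (col_elem n j0 v)))))"
      using card_centralizing_pairs_conj[OF fs L[OF v'] L[OF v] 2 3 Z] by simp
    also have "mm n Z (col_elem n j0 v) = col_op j0 v Z"
      using mm_col_elem[OF ZN j0n vn(1)] vz by simp
    also have "mm n (col_elem n j0 (- v)) (col_op j0 v Z) = col_op j0 v Z"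
      using supported_K[OF Z] supported_zero[OF Z] vK vz j0
      by (intro 1) (auto simp: supported_def col_op_def intro!: closed_K)
    finally show "int (card (centralizing_pairs K Z)) \<le> int (card (centralizing_pairs K (col_op j0 v Z)))" .
  qed
qed

text \<open>A nonzero term needs three strictly increasing levels inside one diagonal part.
  \<open>A\<close> has only the levels 0 and 1, and \<open>B\<close> allows nothing but 2, 3,
  4.\<close>

lemma mm_D_eq:
  assumes "finite_subfield K e" and x: "x \<in> supported K D" and y: "y \<in> supported K D"
  shows "mm n x y = (\<lambda>(i, k). if (i < n \<and> l i = 2) \<and> (k < n \<and> l k = 4)
    then \<Sum>j\<in>{j. j < n \<and> l j = 3}. x (i, j) * y (j, k) else 0)"
proof
  interpret finite_subfield K e by fact
  fix p :: "nat \<times> nat"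
  obtain i k where p: "p = (i, k)"
    by fastforce
  have zero: "x (i, j) * y (j, k) = 0"
    if "\<not> (i < n \<and> l i = 2 \<and> j < n \<and> l j = 3 \<and> k < n \<and> l k = 4)" for j
  proof (rule ccontr)
    assume "x (i, j) * y (j, k) \<noteq> 0"
    then have nz: "x (i, j) \<noteq> 0" "y (j, k) \<noteq> 0"
      by auto
    have "(i, j) \<in> D"
      using nz(1) supported_zero[OF x, of "(i, j)"] by blast
    moreover have "(j, k) \<in> D"
      using nz(2) supported_zero[OF y, of "(j, k)"] by blast
    ultimately show False
      using that l_bound[of k] by (auto simp: D_def U_def A_def B_def)
  qed
  show "mm n x y p = (case p of (i, k) \<Rightarrow> if (i < n \<and> l i = 2) \<and> (k < n \<and> l k = 4)
    then \<Sum>j\<in>{j. j < n \<and> l j = 3}. x (i, j) * y (j, k) else 0)"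
  proof (cases "(i < n \<and> l i = 2) \<and> (k < n \<and> l k = 4)")
    case True
    have "(\<Sum>j<n. x (i, j) * y (j, k)) = (\<Sum>j\<in>{j. j < n \<and> l j = 3}. x (i, j) * y (j, k))"
      by (rule sum.mono_neutral_right) (use zero in auto)
    then show ?thesis
      using True by (simp add: p mm_def)
  next
    case False
    then have "x (i, j) * y (j, k) = 0" for j
      using zero by blast
    then show ?thesis
      using False by (simp add: p mm_def)
  qed
qed

text \<open>Split the pair into diagonal parts \<open>x\<close>, \<open>y\<close> and corner parts
  \<open>s\<close>, \<open>t\<close> on \<open>A \<times> B\<close>. Corner parts multiply to zero,
  so for commuting \<open>x\<close> and \<open>y\<close> the remaining condition is linear in
  \<open>(s, t)\<close>, and duality turns its solutions into the \<open>Z\<close> commuting with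
  \<open>x\<close> and \<open>y\<close>. The domain \<open>?S \<times> ?S\<close> has twice the
  dimension of the target, which leaves one factor
  \<open>card K ^ card (A \<times> B)\<close>.\<close>

lemma card_commuting_pairs:
  fixes K :: "'a::comm_ring set"
  assumes fs: "finite_subfield K e"
  shows "int (card {(x, y). x \<in> supported K U \<and> y \<in> supported K U \<and> mm n x y = mm n y x}) =
    int (card K) ^ card (A \<times> B) * (\<Sum>Z\<in>supported K (B \<times> A). int (card (centralizing_pairs K Z)))"
proof -
  interpret finite_subfield K e by fact
  let ?D = "supported K D" and ?S = "supported K (A \<times> B)" and ?W = "supported K (B \<times> A)"
  have fin: "finite ?D" "finite ?S" "finite ?W"
    using fin_sets by (auto intro: finite_supported)
  let ?F = "\<lambda>x y s t. mm n x t - mm n t x - (mm n y s - mm n s y)"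
  define X where "X = {(x, y). x \<in> ?D \<and> y \<in> ?D \<and> mm n x y = mm n y x}"
  have finX: "finite X"
    using fin by (intro finite_subset[of X "?D \<times> ?D"]) (auto simp: X_def)
  have xt_S: "mm n x t \<in> ?S" "mm n t x \<in> ?S" if "x \<in> ?D" "t \<in> ?S" for x t
    by (rule mm_supported[OF that] mm_supported[OF that(2,1)]; auto simp: D_def U_def A_def B_def)+
  have xZ_W: "mm n x Z \<in> ?W" "mm n Z x \<in> ?W" if "x \<in> ?D" "Z \<in> ?W" for x Z
    by (rule mm_supported[OF that] mm_supported[OF that(2,1)]; auto simp: D_def U_def A_def B_def)+
  have xy_D: "mm n x y \<in> ?D" if "x \<in> ?D" "y \<in> ?D" for x y
    by (rule mm_supported[OF that]) (auto simp: D_def U_def A_def B_def)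
  have st: "mm n s t = 0" if "s \<in> ?S" "t \<in> ?S" for s t
    using mm_supported[OF that, of "{}" n] AB(1) by (auto simp: supported_def fun_eq_iff)
  have F_S: "?F x y s t \<in> ?S" if "x \<in> ?D" "y \<in> ?D" "s \<in> ?S" "t \<in> ?S" for x y s t
    using that by (intro supported_diff xt_S)
  have disj: "p \<notin> A \<times> B" if "p \<in> D" for p
    using U_eq(2) that by blast
  have sum_zero: "a + b = 0 \<longleftrightarrow> a = 0 \<and> b = 0" if a: "a \<in> ?D" and b: "b \<in> ?S" for a b
  proof
    assume ab: "a + b = 0"
    have "a p = 0 \<and> b p = 0" for p
      using fun_cong[OF ab, of p] supported_zero[OF a, of p] supported_zero[OF b, of p] disj[of p]
      by (cases "p \<in> D") auto
    then show "a = 0 \<and> b = 0"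
      by (auto simp: fun_eq_iff)
  qed auto
  have comm: "mm n (x + s) (y + t) = mm n (y + t) (x + s) \<longleftrightarrow> mm n x y = mm n y x \<and> ?F x y s t = 0"
    if "x \<in> ?D" "y \<in> ?D" "s \<in> ?S" "t \<in> ?S" for x y s t
  proof -
    have "mm n (x + s) (y + t) - mm n (y + t) (x + s) = (mm n x y - mm n y x) + ?F x y s t"
      using st that by (simp add: mm_add_left mm_add_right algebra_simps)
    moreover have "mm n x y - mm n y x \<in> ?D"
      using that by (intro supported_diff xy_D)
    ultimately have "mm n (x + s) (y + t) - mm n (y + t) (x + s) = 0 \<longleftrightarrow>
        mm n x y - mm n y x = 0 \<and> ?F x y s t = 0"
      using sum_zero[OF _ F_S[OF that], of "mm n x y - mm n y x"] by (simp only:)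
    then show ?thesis
      by (simp only: right_minus_eq)
  qed
  have bij: "bij_betw (\<lambda>((x, y), (s, t)). (x + s, y + t))
      (Sigma X (\<lambda>(x, y). {st \<in> ?S \<times> ?S. ?F x y (fst st) (snd st) = 0}))
      {(x, y). x \<in> supported K U \<and> y \<in> supported K U \<and> mm n x y = mm n y x}"
  proof -
    let ?r = "\<lambda>P x p. if p \<in> P then x p else (0 :: 'a)"
    have r1: "?r D x \<in> ?D" "?r (A \<times> B) x \<in> ?S" "?r D x + ?r (A \<times> B) x = x" if "x \<in> supported K U" for x
      using that supported_K[OF that] U_eq by (auto simp: supported_def fun_eq_iff)
    have r2: "?r D (x + s) = x" "?r (A \<times> B) (x + s) = s" "x + s \<in> supported K U" if "x \<in> ?D" "s \<in> ?S" for x s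
    proof -
      have "x p = 0" if "p \<in> A \<times> B \<or> p \<notin> D" for p
        using supported_zero[OF \<open>x \<in> ?D\<close>, of p] disj[of p] that by auto
      moreover have "s p = 0" if "p \<in> D \<or> p \<notin> A \<times> B" for p
        using supported_zero[OF \<open>s \<in> ?S\<close>, of p] disj[of p] that by auto
      ultimately show "?r D (x + s) = x" "?r (A \<times> B) (x + s) = s"
        by (auto simp: fun_eq_iff)
      show "x + s \<in> supported K U"
        using supported_mono[OF that(1)] supported_mono[OF that(2)] U_eq(1) by (intro supported_add) auto
    qed
    show ?thesis
    proof (rule bij_betw_byWitness[where f' = "\<lambda>(x, y). ((?r D x, ?r D y), (?r (A \<times> B) x, ?r (A \<times> B) y))"])
      show "(\<lambda>((x, y), (s, t)). (x + s, y + t)) ` Sigma X (\<lambda>(x, y). {st \<in> ?S \<times> ?S. ?F x y (fst st) (snd st) = 0})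
          \<subseteq> {(x, y). x \<in> supported K U \<and> y \<in> supported K U \<and> mm n x y = mm n y x}"
        using r2(3) comm by (auto simp: X_def)
      show "(\<lambda>(x, y). ((?r D x, ?r D y), (?r (A \<times> B) x, ?r (A \<times> B) y))) `
          {(x, y). x \<in> supported K U \<and> y \<in> supported K U \<and> mm n x y = mm n y x}
          \<subseteq> Sigma X (\<lambda>(x, y). {st \<in> ?S \<times> ?S. ?F x y (fst st) (snd st) = 0})"
      proof (rule image_subsetI)
        fix p assume "p \<in> {(x, y). x \<in> supported K U \<and> y \<in> supported K U \<and> mm n x y = mm n y x}"
        then obtain x y where p: "p = (x, y)" and x: "x \<in> supported K U" and y: "y \<in> supported K U"
          and c: "mm n x y = mm n y x"
          by auto
        show "(case p of (x, y) \<Rightarrow> ((?r D x, ?r D y), (?r (A \<times> B) x, ?r (A \<times> B) y)))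
            \<in> Sigma X (\<lambda>(x, y). {st \<in> ?S \<times> ?S. ?F x y (fst st) (snd st) = 0})"
          using comm[OF r1(1)[OF x] r1(1)[OF y] r1(2)[OF x] r1(2)[OF y]] c
            r1(1)[OF x] r1(1)[OF y] r1(2)[OF x] r1(2)[OF y]
          unfolding r1(3)[OF x] r1(3)[OF y] p X_def by simp
      qed
      show "\<forall>a\<in>Sigma X (\<lambda>(x, y). {st \<in> ?S \<times> ?S. ?F x y (fst st) (snd st) = 0}).
          (\<lambda>(x, y). ((?r D x, ?r D y), (?r (A \<times> B) x, ?r (A \<times> B) y))) ((\<lambda>((x, y), (s, t)). (x + s, y + t)) a) = a"
        using r2(1,2) by (clarsimp simp: X_def)
      show "\<forall>a'\<in>{(x, y). x \<in> supported K U \<and> y \<in> supported K U \<and> mm n x y = mm n y x}.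
          (\<lambda>((x, y), (s, t)). (x + s, y + t)) ((\<lambda>(x, y). ((?r D x, ?r D y), (?r (A \<times> B) x, ?r (A \<times> B) y))) a') = a'"
        using r1(3) by clarsimp
    qed
  qed
  have rad: "card {st \<in> ?S \<times> ?S. ?F x y (fst st) (snd st) = 0} =
      card K ^ card (A \<times> B) * card {Z \<in> ?W. mm n Z x = mm n x Z \<and> mm n Z y = mm n y Z}"
    if x: "x \<in> ?D" and y: "y \<in> ?D" for x y
  proof -
    define b where "b v Z = trace_pairing n Z (?F x y (fst v) (snd v))" for v and Z :: "nat \<times> nat \<Rightarrow> 'a"
    \<comment> \<open>Cyclicity of the trace trades the commutators of \<open>x\<close> and
      \<open>y\<close> with the unknowns for commutators with \<open>Z\<close>.\<close>
    have b_eq: "b v Z = trace_pairing n (mm n Z x - mm n x Z) (snd v) - trace_pairing n (mm n Z y - mm n y Z) (fst v)" for v Z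
      by (simp add: b_def trace_pairing_linear trace_pairing_mm[of n Z x] trace_pairing_mm[of n Z y]
          trace_pairing_mm'[of n Z _ x] trace_pairing_mm'[of n Z _ y])
    have b_scale: "b (\<lambda>p. a * s p, \<lambda>p. a * t p) Z = a * b (s, t) Z" "b v (\<lambda>p. a * Z p) = a * b v Z" for a s t v Z
      by (simp_all add: b_def trace_pairing_def mm_def sum_distrib_left right_diff_distrib ac_simps)
    have b_K: "b v Z \<in> K" if "v \<in> ?S \<times> ?S" "Z \<in> ?W" for v Z
      unfolding b_def using that F_S[OF x y] by (intro trace_pairing_K[OF that(2)]) auto
    have "card {v \<in> ?S \<times> ?S. \<forall>Z\<in>?W. b v Z = 0} * card ?W = card {Z \<in> ?W. \<forall>v\<in>?S \<times> ?S. b v Z = 0} * card (?S \<times> ?S)"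
    proof (rule card_radicals)
      show "finite (?S \<times> ?S)" "finite ?W"
        using fin by simp_all
    next
      fix v v' :: "(nat \<times> nat \<Rightarrow> 'a) \<times> (nat \<times> nat \<Rightarrow> 'a)" and Z Z' :: "nat \<times> nat \<Rightarrow> 'a"
      show "Z \<in> ?W \<Longrightarrow> Z' \<in> ?W \<Longrightarrow> Z - Z' \<in> ?W"
        by (rule supported_diff)
      show "v \<in> ?S \<times> ?S \<Longrightarrow> v' \<in> ?S \<times> ?S \<Longrightarrow> v - v' \<in> ?S \<times> ?S"
        by (auto simp: fst_diff snd_diff mem_Times_iff intro: supported_diff)
      show "b (v + v') Z = b v Z + b v' Z"
        by (simp add: b_eq trace_pairing_linear)
      show "b v (Z + Z') = b v Z + b v Z'"
        by (simp add: b_def trace_pairing_linear)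
      assume v: "v \<in> ?S \<times> ?S" and Z: "Z \<in> ?W" and nz: "b v Z \<noteq> 0"
      obtain a where a: "a \<in> K" "a * b v Z = e"
        using inverse_ex[OF b_K[OF v Z] nz] by (auto simp: mult.commute)
      show "\<exists>Z'\<in>?W. b v Z' = e"
        using a Z by (intro bexI[of _ "\<lambda>p. a * Z p"]) (auto simp: b_scale supported_def mult_K)
      show "\<exists>v'\<in>?S \<times> ?S. b v' Z = e"
        using a v by (intro bexI[of _ "(\<lambda>p. a * fst v p, \<lambda>p. a * snd v p)"])
          (auto simp: b_scale supported_def mult_K)
    qed
    moreover have "{v \<in> ?S \<times> ?S. \<forall>Z\<in>?W. b v Z = 0} = {st \<in> ?S \<times> ?S. ?F x y (fst st) (snd st) = 0}"
    proof -
      have "(\<forall>Z\<in>?W. b v Z = 0) \<longleftrightarrow> ?F x y (fst v) (snd v) = 0" if v: "v \<in> ?S \<times> ?S" for v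
      proof
        assume *: "\<forall>Z\<in>?W. b v Z = 0"
        show "?F x y (fst v) (snd v) = 0"
        proof (rule trace_pairing_nondegenerate[OF F_S[OF x y] AB(2,3)])
          fix Z assume "Z \<in> ?W"
          then show "trace_pairing n (?F x y (fst v) (snd v)) Z = 0"
            using * unfolding b_def by (subst trace_pairing_commute) simp
        qed (use v in auto)
      next
        assume "?F x y (fst v) (snd v) = 0"
        then show "\<forall>Z\<in>?W. b v Z = 0"
          unfolding b_def by (simp add: trace_pairing_def)
      qed
      then show ?thesis
        by (intro Collect_cong conj_cong refl)
    qed
    moreover have "{Z \<in> ?W. \<forall>v\<in>?S \<times> ?S. b v Z = 0} = {Z \<in> ?W. mm n Z x = mm n x Z \<and> mm n Z y = mm n y Z}"
    proof -
      have "(\<forall>v\<in>?S \<times> ?S. b v Z = 0) \<longleftrightarrow> mm n Z x = mm n x Z \<and> mm n Z y = mm n y Z" if Z: "Z \<in> ?W" for Z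
      proof
        assume *: "\<forall>v\<in>?S \<times> ?S. b v Z = 0"
        have "mm n Z x - mm n x Z = 0"
        proof (rule trace_pairing_nondegenerate[OF _ AB(3,2)])
          show "mm n Z x - mm n x Z \<in> ?W"
            using x Z by (intro supported_diff xZ_W)
          fix t assume "t \<in> ?S"
          then show "trace_pairing n (mm n Z x - mm n x Z) t = 0"
            using bspec[OF *, of "(0, t)"] by (simp add: b_eq trace_pairing_def)
        qed
        moreover have "mm n Z y - mm n y Z = 0"
        proof (rule trace_pairing_nondegenerate[OF _ AB(3,2)])
          show "mm n Z y - mm n y Z \<in> ?W"
            using y Z by (intro supported_diff xZ_W)
          fix s assume "s \<in> ?S"
          then show "trace_pairing n (mm n Z y - mm n y Z) s = 0"
            using bspec[OF *, of "(s, 0)"] by (simp add: b_eq trace_pairing_def)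
        qed
        ultimately show "mm n Z x = mm n x Z \<and> mm n Z y = mm n y Z"
          by simp
      next
        assume "mm n Z x = mm n x Z \<and> mm n Z y = mm n y Z"
        then show "\<forall>v\<in>?S \<times> ?S. b v Z = 0"
          unfolding b_eq by (simp add: trace_pairing_def)
      qed
      then show ?thesis
        by (intro Collect_cong conj_cong refl)
    qed
    ultimately have *: "card {st \<in> ?S \<times> ?S. ?F x y (fst st) (snd st) = 0} * card ?W =
        card {Z \<in> ?W. mm n Z x = mm n x Z \<and> mm n Z y = mm n y Z} * card (?S \<times> ?S)"
      by (simp only:)
    have W: "card ?W = card K ^ card (A \<times> B)" and S: "card ?S = card K ^ card (A \<times> B)"
      using fin_sets by (simp_all add: card_supported_power card_cartesian_product mult.commute)
    have q: "0 < card K ^ card (A \<times> B)"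
      using card_K_pos by simp
    have cancel: "L = q * R" if "L * q = R * (q * q)" "0 < q" for L R q :: nat
    proof -
      have "L * q = (q * R) * q"
        using that(1) by (simp only: ac_simps)
      then show ?thesis
        using that(2) by (simp only: mult_cancel2) simp
    qed
    show ?thesis
      by (rule cancel[OF *[unfolded W card_cartesian_product[of ?S ?S] S] q])
  qed
  have "card {(x, y). x \<in> supported K U \<and> y \<in> supported K U \<and> mm n x y = mm n y x} =
      card (Sigma X (\<lambda>(x, y). {st \<in> ?S \<times> ?S. ?F x y (fst st) (snd st) = 0}))"
    by (rule bij_betw_same_card[OF bij, symmetric])
  also have "\<dots> = (\<Sum>p\<in>X. card (case p of (x, y) \<Rightarrow> {st \<in> ?S \<times> ?S. ?F x y (fst st) (snd st) = 0}))"
    using finX fin by (intro card_SigmaI) auto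
  also have "\<dots> = (\<Sum>p\<in>X. card K ^ card (A \<times> B) * card {Z \<in> ?W. p \<in> centralizing_pairs K Z})"
  proof (rule sum.cong[OF refl])
    fix p assume "p \<in> X"
    then obtain x y where p: "p = (x, y)" "x \<in> ?D" "y \<in> ?D" "mm n x y = mm n y x"
      by (auto simp: X_def)
    have "{Z \<in> ?W. p \<in> centralizing_pairs K Z} = {Z \<in> ?W. mm n Z x = mm n x Z \<and> mm n Z y = mm n y Z}"
      unfolding p(1) centralizing_pairs_iff using p(2-4) by blast
    then show "card (case p of (x, y) \<Rightarrow> {st \<in> ?S \<times> ?S. ?F x y (fst st) (snd st) = 0}) =
        card K ^ card (A \<times> B) * card {Z \<in> ?W. p \<in> centralizing_pairs K Z}"
      using rad[OF p(2,3)] p(1) by simp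
  qed
  also have "\<dots> = card K ^ card (A \<times> B) * (\<Sum>p\<in>X. card {Z \<in> ?W. p \<in> centralizing_pairs K Z})"
    by (simp add: sum_distrib_left)
  also have "(\<Sum>p\<in>X. card {Z \<in> ?W. p \<in> centralizing_pairs K Z}) = (\<Sum>Z\<in>?W. card {p \<in> X. p \<in> centralizing_pairs K Z})"
    using finX fin by (intro sum_multicount_gen) auto
  also have "\<dots> = (\<Sum>Z\<in>?W. card (centralizing_pairs K Z))"
  proof (intro sum.cong refl arg_cong[of _ _ card])
    fix Z :: "nat \<times> nat \<Rightarrow> 'a"
    have "centralizing_pairs K Z \<subseteq> X"
      unfolding centralizing_pairs_def X_def by fast
    then show "{p \<in> X. p \<in> centralizing_pairs K Z} = centralizing_pairs K Z"
      by blast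
  qed
  finally show ?thesis
    by simp
qed

text \<open>
  A matrix supported on \<open>D\<close> that commutes with a matching matrix is determined by its entries in the
  pattern \<open>Q\<close> of the proof, which are arbitrary. The keys put the rows matched to level \<open>0\<close> first (and, in
  the last block, the unmatched rows last); this makes \<open>Q\<close> nested.
\<close>

lemma laurent_count_centralizing_pairs_matching:
  assumes w: "w \<in> partial_matchings B A"
  shows "laurent_count (\<lambda>(K :: 'a::comm_ring set) e. int (card (centralizing_pairs K (matching_matrix e w))))"
proof -
  note row = partial_matchings_row[OF w] and col = partial_matchings_col[OF w]
  have wBA: "b \<in> B" "a \<in> A" if "(b, a) \<in> w" for a b
    using w that by (auto simp: partial_matchings_def)
  define ran where "ran = fst ` w"
  define dom where "dom = snd ` w"
  define \<sigma> where "\<sigma> a = (THE b. (b, a) \<in> w)" for a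
  have \<sigma>: "\<sigma> a = b" if "(b, a) \<in> w" for a b
    unfolding \<sigma>_def using that col by (intro the_equality) auto
  have ran: "b \<in> ran \<longleftrightarrow> (\<exists>a. (b, a) \<in> w)" and dom: "a \<in> dom \<longleftrightarrow> (\<exists>b. (b, a) \<in> w)" for a b
    by (force simp: ran_def dom_def)+
  have \<sigma>_w: "(\<sigma> a, a) \<in> w" if "a \<in> dom" for a
    using that \<sigma> dom by auto
  have sub: "ran \<subseteq> B" "dom \<subseteq> A"
    using wBA ran dom by auto
  have AB': "i \<notin> B" if "i \<in> A" for i
    using AB(1) that by auto
  \<comment> \<open>Compare the entries at \<open>(i, j)\<close> of the two products with the
    matching matrix. If \<open>i\<close> is matched to \<open>a\<close> and \<open>j\<close> to
    \<open>b\<close>, then \<open>x (a, j) = x (i, b)\<close>; if only one partner exists, the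
    single remaining entry vanishes; otherwise there is no condition. Hence unmatched columns on the
    \<open>B\<close> side and unmatched rows on the \<open>A\<close> side are free, and two coupled
    entries are represented by the one in \<open>B \<times> B\<close>, which is free only if both
    positions lie in \<open>D\<close>.\<close>
  define Q where "Q = {(i, j). (i, j) \<in> D \<and> (i \<in> B \<and> j \<notin> ran \<or> i \<in> A \<and> i \<notin> dom \<or>
    (\<exists>a a'. (i, a) \<in> w \<and> (j, a') \<in> w \<and> (a, a') \<in> D))}"
  have QD: "Q \<subseteq> D"
    by (auto simp: Q_def)
  have D_sides: "i \<in> A \<and> j \<in> A \<or> i \<in> B \<and> j \<in> B" if "(i, j) \<in> D" for i j
    using that by (auto simp: D_def)
  define I3 where "I3 = {i. i < n \<and> l i = 2}"
  define I4 where "I4 = {i. i < n \<and> l i = 3}"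
  define I5 where "I5 = {i. i < n \<and> l i = 4}"
  have I_B: "I3 \<subseteq> B" "I4 \<subseteq> B" "I5 \<subseteq> B"
    by (auto simp: I3_def I4_def I5_def B_def)
  \<comment> \<open>A matched column of the \<open>2 \<times> 3\<close> block meets \<open>Q\<close>
    in no row or in exactly the rows matched to level 0. A row of the \<open>3 \<times> 4\<close>
    block meets \<open>Q\<close> in the unmatched columns and possibly all those matched to level 1.
    The keys make these sets initial segments for \<open>\<kappa>\<close> and final segments for
    \<open>\<rho>\<close>; the offsets \<open>n\<close> and \<open>2 * n\<close> separate the
    classes, as indices are below \<open>n\<close>.\<close>
  define \<kappa> where "\<kappa> i = (if \<exists>a. (i, a) \<in> w \<and> l a = 0 then i else i + n)" for i
  define \<rho> where "\<rho> k = (if \<exists>a. (k, a) \<in> w \<and> l a = 0 then k else if k \<in> ran then k + n else k + 2 * n)" for k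
  interpret two_block_pattern Q I3 I4 I5 \<kappa> \<rho>
  proof
    show "finite Q"
      using fin_sets(4) QD by (rule rev_finite_subset)
    show "finite I3" "finite I4" "finite I5" "I3 \<inter> I4 = {}" "I3 \<inter> I5 = {}" "I4 \<inter> I5 = {}"
      by (auto simp: I3_def I4_def I5_def)
    show "inj_on \<kappa> I3"
      by (auto simp: inj_on_def I3_def \<kappa>_def split: if_splits)
    show "inj_on \<rho> I5"
      by (auto simp: inj_on_def I5_def \<rho>_def split: if_splits)
  next
    fix i0 i j assume i: "i0 \<in> I3" "i \<in> I3" "j \<in> I4" and Q: "(i, j) \<in> Q" and lt: "\<kappa> i0 < \<kappa> i"
    have D0: "(i0, j) \<in> D"
      using i by (auto simp: D_def U_def I3_def I4_def B_def)
    show "(i0, j) \<in> Q"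
    proof (cases "j \<in> ran")
      case False
      then show ?thesis
        using D0 i(1) I_B by (auto simp: Q_def)
    next
      case True
      moreover have "i \<notin> A"
        using subsetD[OF I_B(1) i(2)] AB'[of i] by blast
      ultimately have "\<exists>a a'. (i, a) \<in> w \<and> (j, a') \<in> w \<and> (a, a') \<in> D"
        using Q unfolding Q_def by simp
      then obtain a a' where a: "(i, a) \<in> w" "(j, a') \<in> w" "(a, a') \<in> D"
        by blast
      have "l a < l a'" "l a' \<le> 1"
        using a(3) wBA(2)[OF a(2)] by (simp_all add: D_def U_def A_def)
      \<comment> \<open>Since \<open>A\<close> has only two levels, a strict inequality between
        partners fixes both. Membership in \<open>Q\<close> thereby splits into one condition on the
        row and one on the column.\<close>
      then have "l a = 0" "l a' = 1"
        by linarith+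
      then have "\<kappa> i = i"
        using a(1) by (auto simp: \<kappa>_def)
      then have "\<kappa> i0 < n"
        using lt i(2) by (simp add: I3_def)
      then obtain a0 where a0: "(i0, a0) \<in> w" "l a0 = 0"
        by (auto simp: \<kappa>_def split: if_splits)
      have "a' \<in> A" "a0 \<in> A" "a' < n" "a0 < n"
        using wBA(2)[OF a(2)] wBA(2)[OF a0(1)] by (simp_all add: A_def)
      then have "(a0, a') \<in> D"
        using \<open>l a' = 1\<close> a0(2) by (simp add: D_def U_def)
      then show ?thesis
        unfolding Q_def using D0 a0(1) a(2) by blast
    qed
  next
    fix j k k0 assume i: "j \<in> I4" "k \<in> I5" "k0 \<in> I5" and Q: "(j, k) \<in> Q" and lt: "\<rho> k < \<rho> k0"
    have D0: "(j, k0) \<in> D"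
      using i by (auto simp: D_def U_def I5_def I4_def B_def)
    have kn: "k < n" "k0 < n"
      using i by (auto simp: I5_def)
    show "(j, k0) \<in> Q"
    proof (cases "k0 \<in> ran")
      case False
      then show ?thesis
        using D0 i(1) I_B by (auto simp: Q_def)
    next
      case k0: True
      then have "\<rho> k0 < 2 * n"
        using kn by (simp add: \<rho>_def)
      have "k \<in> ran"
      proof (rule ccontr)
        assume "k \<notin> ran"
        moreover from this have "\<not> (\<exists>a. (k, a) \<in> w \<and> l a = 0)"
          using ran by blast
        ultimately have "\<rho> k = k + 2 * n"
          unfolding \<rho>_def by (simp only: if_False)
        then show False
          using lt \<open>\<rho> k0 < 2 * n\<close> by simp
      qed
      moreover have "j \<notin> A"
        using subsetD[OF I_B(2) i(1)] AB'[of j] by blast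
      ultimately have "\<exists>a a'. (j, a) \<in> w \<and> (k, a') \<in> w \<and> (a, a') \<in> D"
        using Q unfolding Q_def by simp
      then obtain a a' where a: "(j, a) \<in> w" "(k, a') \<in> w" "(a, a') \<in> D"
        by blast
      have "l a < l a'" "l a' \<le> 1"
        using a(3) wBA(2)[OF a(2)] by (simp_all add: D_def U_def A_def)
      then have la: "l a = 0" "l a' = 1"
        by linarith+
      have "\<not> (\<exists>a. (k, a) \<in> w \<and> l a = 0)"
      proof
        assume "\<exists>a. (k, a) \<in> w \<and> l a = 0"
        then obtain b where b: "(k, b) \<in> w" "l b = 0"
          by blast
        then show False
          using row[OF a(2) b(1)] la(2) by simp
      qed
      have \<rho>k: "\<rho> k = k + n"
        unfolding \<rho>_def if_not_P[OF \<open>\<not> (\<exists>a. (k, a) \<in> w \<and> l a = 0)\<close>] if_P[OF \<open>k \<in> ran\<close>] ..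
      have not0: "\<not> (\<exists>a. (k0, a) \<in> w \<and> l a = 0)"
      proof
        assume "\<exists>a. (k0, a) \<in> w \<and> l a = 0"
        then have "\<rho> k0 = k0"
          unfolding \<rho>_def by (rule if_P)
        then show False
          using lt kn(2) \<rho>k by linarith
      qed
      obtain a0 where a0: "(k0, a0) \<in> w"
        using k0 unfolding ran ..
      have "l a0 \<noteq> 0"
      proof
        assume "l a0 = 0"
        with a0 have "\<exists>a. (k0, a) \<in> w \<and> l a = 0"
          by (intro exI[of _ a0] conjI)
        with not0 show False ..
      qed
      moreover have "l a0 \<le> 1"
        using wBA(2)[OF a0] by (simp add: A_def)
      ultimately have "l a0 = 1"
        by simp
      moreover have "a \<in> A" "a0 \<in> A" "a < n" "a0 < n"
        using wBA(2)[OF a(1)] wBA(2)[OF a0] by (simp_all add: A_def)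
      ultimately have "(a, a0) \<in> D"
        using la(1) by (simp add: D_def U_def)
      then show ?thesis
        unfolding Q_def using D0 a(1) a0 by blast
    qed
  qed
  show ?thesis
  proof (rule laurent_count_cong[OF laurent_count_commuting_pairs])
    fix K :: "'a set" and e assume fs: "finite_subfield K e"
    then interpret finite_subfield K e .
    let ?E = "matching_matrix e w"
    have E_left: "mm n ?E x (i, j) = x (a, j)" if x: "x \<in> supported K D" and a: "(i, a) \<in> w" for x i j a
    proof -
      have wk: "(i, k) \<in> w \<longleftrightarrow> k = a" for k
        using a row[of i k a] by auto
      have "(\<Sum>k<n. ?E (i, k) * x (k, j)) = (\<Sum>k<n. if k = a then x (a, j) else 0)"
        using supported_K[OF x] by (intro sum.cong refl) (auto simp: matching_matrix_def wk)
      then show ?thesis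
        using wBA[OF a] AB by (auto simp: mm_def)
    qed
    have E_left0: "mm n ?E x (i, j) = 0" if "i \<notin> ran" for x i j
      using that ran by (simp add: mm_def matching_matrix_def)
    have E_right: "mm n x ?E (i, j) = x (i, b)" if x: "x \<in> supported K D" and b: "(b, j) \<in> w" for x i j b
    proof -
      have wk: "(k, j) \<in> w \<longleftrightarrow> k = b" for k
        using b col[of k j b] by auto
      have "(\<Sum>k<n. x (i, k) * ?E (k, j)) = (\<Sum>k<n. if k = b then x (i, b) else 0)"
        using supported_K[OF x] by (intro sum.cong refl) (auto simp: matching_matrix_def wk)
      then show ?thesis
        using wBA[OF b] AB by (auto simp: mm_def)
    qed
    have E_right0: "mm n x ?E (i, j) = 0" if "j \<notin> dom" for x i j
      using that dom by (simp add: mm_def matching_matrix_def)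
    let ?S = "{x \<in> supported K D. mm n ?E x = mm n x ?E}"
    \<comment> \<open>\<open>h\<close> drops the entries that vanish or are copies, and
      \<open>g\<close> restores the copies between matched indices of \<open>A\<close> from their
      partners in \<open>B\<close>.\<close>
    define h where "h x p = (if p \<in> Q then x p else 0)" for x :: "nat \<times> nat \<Rightarrow> 'a" and p
    define g where "g x = (\<lambda>(i, j). if i \<in> dom \<and> j \<in> dom then x (\<sigma> i, \<sigma> j) else x (i, j))" for x :: "nat \<times> nat \<Rightarrow> 'a"
    have rel: "x (a, j) = mm n x ?E (i, j)" if "x \<in> ?S" "(i, a) \<in> w" for x i j a
      using that E_left[of x i a j] fun_cong[of "mm n ?E x" "mm n x ?E" "(i, j)"] by simp
    have rel': "mm n ?E x (i, j) = x (i, b)" if "x \<in> ?S" "(b, j) \<in> w" for x i j b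
      using that E_right[of x b j i] fun_cong[of "mm n ?E x" "mm n x ?E" "(i, j)"] by simp
    have offQ: "x (i, j) = 0" if x: "x \<in> ?S" and ij: "(i, j) \<notin> Q" "\<not> (i \<in> dom \<and> j \<in> dom)" for x i j
    proof (cases "(i, j) \<in> D")
      case False
      then show ?thesis
        using x supported_zero[of x K D] by auto
    next
      case D: True
      show ?thesis
      proof (cases "i \<in> A")
        case True
        then have "i \<in> dom"
          using D ij(1) by (auto simp: Q_def)
        then have "j \<notin> dom" "(\<sigma> i, i) \<in> w"
          using ij(2) \<sigma>_w by auto
        then show ?thesis
          using rel[OF x, of "\<sigma> i" i j] E_right0 by simp
      next
        case False
        then have B: "i \<in> B" "j \<in> ran"
          using D D_sides ij(1) by (auto simp: Q_def)
        then obtain a' where a': "(j, a') \<in> w"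
          using ran by auto
        have eq: "x (i, j) = mm n ?E x (i, a')"
          using rel'[OF x a'] by simp
        show ?thesis
        proof (cases "i \<in> ran")
          case True
          then obtain a where a: "(i, a) \<in> w"
            using ran by auto
          then have "(a, a') \<notin> D"
            using D ij(1) a' by (auto simp: Q_def)
          then have "x (a, a') = 0"
            using x supported_zero[of x K D] by auto
          then show ?thesis
            using eq E_left[OF _ a, of x a'] x by simp
        next
          case False
          then show ?thesis
            using eq E_left0 by simp
        qed
      qed
    qed
    \<comment> \<open>Rows in \<open>B\<close> lose nothing under \<open>h\<close>, because the
      copies that are dropped were chosen on the \<open>A\<close> side. So the condition that
      \<open>x\<close> and \<open>y\<close> commute, which sees only such rows, can be read off from
      \<open>h x\<close> and \<open>h y\<close>.\<close>
    have h_B: "h x (i, j) = x (i, j)" if "x \<in> ?S" "i \<in> B" for x i j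
      using offQ[OF that(1), of i j] that(2) sub AB(1) by (auto simp: h_def)
    have h_Q: "h x \<in> supported K Q" if "x \<in> ?S" for x
      using that supported_K[of x D] by (auto simp: supported_def h_def)
    have gh: "g (h x) = x" if x: "x \<in> ?S" for x
    proof
      fix p :: "nat \<times> nat"
      obtain i j where p: "p = (i, j)"
        by fastforce
      show "g (h x) p = x p"
      proof (cases "i \<in> dom \<and> j \<in> dom")
        case True
        then have w': "(\<sigma> i, i) \<in> w" "(\<sigma> j, j) \<in> w"
          using \<sigma>_w by auto
        have "x (i, j) = mm n x ?E (\<sigma> i, j)"
          by (rule rel[OF x w'(1)])
        also have "\<dots> = x (\<sigma> i, \<sigma> j)"
          using x by (intro E_right[OF _ w'(2)]) simp
        also have "\<dots> = h x (\<sigma> i, \<sigma> j)"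
          using h_B[OF x, of "\<sigma> i" "\<sigma> j"] wBA[OF w'(1)] by simp
        finally show ?thesis
          using True by (simp add: g_def p)
      next
        case False
        then show ?thesis
          using offQ[OF x, of i j] by (auto simp: g_def h_def p)
      qed
    qed
    have Q_dom: "\<not> (i \<in> dom \<and> j \<in> dom)" if "(i, j) \<in> Q" for i j
    proof
      assume "i \<in> dom \<and> j \<in> dom"
      then have "i \<in> dom" "i \<notin> B"
        using sub AB' by auto
      then show False
        using that wBA(1)[of i] unfolding Q_def by blast
    qed
    have hg: "h (g x) = x" if x: "x \<in> supported K Q" for x
    proof
      fix p :: "nat \<times> nat"
      obtain i j where p: "p = (i, j)"
        by fastforce
      show "h (g x) p = x p"
        using Q_dom[of i j] supported_zero[OF x, of "(i, j)"] by (auto simp: h_def g_def p)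
    qed
    have g_S: "g x \<in> ?S" if x: "x \<in> supported K Q" for x
    proof -
      have gD: "g x (i, j) = 0" if ij: "(i, j) \<notin> D" for i j
      proof (cases "i \<in> dom \<and> j \<in> dom")
        case True
        then have w': "(\<sigma> i, i) \<in> w" "(\<sigma> j, j) \<in> w"
          using \<sigma>_w by auto
        have "(\<sigma> i, \<sigma> j) \<notin> Q"
        proof
          assume "(\<sigma> i, \<sigma> j) \<in> Q"
          moreover have "\<sigma> j \<in> ran"
            using w'(2) ran by blast
          moreover have "\<sigma> i \<notin> A"
            using wBA(1)[OF w'(1)] AB' by blast
          ultimately obtain a a' where "(\<sigma> i, a) \<in> w" "(\<sigma> j, a') \<in> w" "(a, a') \<in> D"
            unfolding Q_def by blast
          then show False
            using ij row[OF w'(1), of a] row[OF w'(2), of a'] by simp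
        qed
        then show ?thesis
          using True supported_zero[OF x] by (simp add: g_def)
      next
        case False
        then show ?thesis
          using supported_zero[OF x, of "(i, j)"] ij QD by (auto simp: g_def)
      qed
      have "g x p \<in> K" for p
        using supported_K[OF x] by (cases p) (simp add: g_def)
      then have gsD: "g x \<in> supported K D"
        using gD by (auto simp: supported_def)
      have "mm n ?E (g x) (i, j) = mm n (g x) ?E (i, j)" for i j
      proof (cases "i \<in> ran")
        case True
        then obtain a where a: "(i, a) \<in> w"
          using ran by auto
        have i: "i \<in> B" "i \<notin> dom" "a \<in> dom" "\<sigma> a = i"
          using a wBA[OF a] dom sub AB' \<sigma>[OF a] by auto
        show ?thesis
        proof (cases "j \<in> dom")
          case True
          then have b: "(\<sigma> j, j) \<in> w"
            by (rule \<sigma>_w)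
          show ?thesis
            unfolding E_left[OF gsD a] E_right[OF gsD b] using i True by (simp add: g_def)
        next
          case False
          have "(a, j) \<notin> Q"
            using i(3) wBA[OF a] AB' wBA(1)[of a] by (auto simp: Q_def)
          then show ?thesis
            unfolding E_left[OF gsD a] E_right0[OF False] using False supported_zero[OF x] by (simp add: g_def)
        qed
      next
        case False
        show ?thesis
        proof (cases "j \<in> dom")
          case True
          then have b: "(\<sigma> j, j) \<in> w"
            by (rule \<sigma>_w)
          have "\<sigma> j \<in> B" "\<sigma> j \<in> ran"
            using wBA[OF b] b ran by auto
          then have "(i, \<sigma> j) \<notin> Q" "\<sigma> j \<notin> dom"
            using False ran D_sides[of i "\<sigma> j"] sub AB' by (auto simp: Q_def)
          then show ?thesis
            unfolding E_left0[OF False] E_right[OF gsD b] using supported_zero[OF x] by (simp add: g_def)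
        next
          case j: False
          show ?thesis
            unfolding E_left0[OF False] E_right0[OF j] ..
        qed
      qed
      then have "mm n ?E (g x) = mm n (g x) ?E"
        by (auto simp: fun_eq_iff)
      then show ?thesis
        using gsD by simp
    qed
    have comm: "mm n x y = mm n y x \<longleftrightarrow>
        (\<forall>i\<in>I3. \<forall>k\<in>I5. (\<Sum>j\<in>I4. h x (i, j) * h y (j, k)) = (\<Sum>j\<in>I4. h y (i, j) * h x (j, k)))"
      if x: "x \<in> ?S" and y: "y \<in> ?S" for x y
    proof -
      have *: "mm n x y = (\<lambda>(i, k). if i \<in> I3 \<and> k \<in> I5 then \<Sum>j\<in>I4. h x (i, j) * h y (j, k) else 0)"
        if "x \<in> ?S" "y \<in> ?S" for x y
      proof -
        have "(\<Sum>j\<in>I4. h x (i, j) * h y (j, k)) = (\<Sum>j\<in>I4. x (i, j) * y (j, k))" if "i \<in> I3" for i k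
        proof (intro sum.cong refl)
          fix j assume "j \<in> I4"
          then have "i \<in> B" "j \<in> B"
            using that I_B by auto
          then show "h x (i, j) * h y (j, k) = x (i, j) * y (j, k)"
            by (simp only: h_B[OF \<open>x \<in> ?S\<close>] h_B[OF \<open>y \<in> ?S\<close>])
        qed
        then show ?thesis
          using mm_D_eq[OF fs, of x y] that unfolding I3_def I4_def I5_def by (auto simp: fun_eq_iff)
      qed
      show ?thesis
        unfolding *[OF x y] *[OF y x] by (auto simp: fun_eq_iff)
    qed
    have "bij_betw (\<lambda>(x, y). (h x, h y)) (centralizing_pairs K ?E)
        {(x, y). x \<in> supported K Q \<and> y \<in> supported K Q \<and>
          (\<forall>i\<in>I3. \<forall>k\<in>I5. (\<Sum>j\<in>I4. x (i, j) * y (j, k)) = (\<Sum>j\<in>I4. y (i, j) * x (j, k)))}"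
      (is "bij_betw ?hh ?X ?Y")
    proof -
      have X: "(x, y) \<in> ?X \<longleftrightarrow> x \<in> ?S \<and> y \<in> ?S \<and> mm n x y = mm n y x" for x y
        unfolding centralizing_pairs_iff mem_Collect_eq by fast
      show ?thesis
      proof (rule bij_betw_byWitness[where f' = "\<lambda>(x, y). (g x, g y)"])
        show "\<forall>p\<in>?X. (\<lambda>(x, y). (g x, g y)) (?hh p) = p"
        proof
          fix p assume "p \<in> ?X"
          then show "(\<lambda>(x, y). (g x, g y)) (?hh p) = p"
            using X gh by (cases p) simp
        qed
        show "\<forall>p\<in>?Y. ?hh ((\<lambda>(x, y). (g x, g y)) p) = p"
        proof
          fix p assume "p \<in> ?Y"
          then show "?hh ((\<lambda>(x, y). (g x, g y)) p) = p"
            using hg by (cases p) simp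
        qed
        show "?hh ` ?X \<subseteq> ?Y"
        proof (rule image_subsetI)
          fix p assume p: "p \<in> ?X"
          obtain x y where xy: "p = (x, y)"
            by (cases p)
          then have *: "x \<in> ?S" "y \<in> ?S" "mm n x y = mm n y x"
            using p X by auto
          show "?hh p \<in> ?Y"
            using iffD1[OF comm[OF *(1,2)] *(3)] h_Q[OF *(1)] h_Q[OF *(2)]
            unfolding xy prod.case mem_Collect_eq by (intro conjI)
        qed
        show "(\<lambda>(x, y). (g x, g y)) ` ?Y \<subseteq> ?X"
        proof (rule image_subsetI)
          fix p assume p: "p \<in> ?Y"
          obtain x y where xy: "p = (x, y)"
            by (cases p)
          have *: "x \<in> supported K Q" "y \<in> supported K Q"
            "\<forall>i\<in>I3. \<forall>k\<in>I5. (\<Sum>j\<in>I4. x (i, j) * y (j, k)) = (\<Sum>j\<in>I4. y (i, j) * x (j, k))"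
            using p xy by auto
          show "(\<lambda>(x, y). (g x, g y)) p \<in> ?X"
            using X[of "g x" "g y"] comm[OF g_S[OF *(1)] g_S[OF *(2)]] * g_S[OF *(1)] g_S[OF *(2)]
            by (simp add: xy hg)
        qed
      qed
    qed
    then have "card (centralizing_pairs K ?E) = card {(x, y). x \<in> supported K Q \<and> y \<in> supported K Q \<and>
          (\<forall>i\<in>I3. \<forall>k\<in>I5. (\<Sum>j\<in>I4. x (i, j) * y (j, k)) = (\<Sum>j\<in>I4. y (i, j) * x (j, k)))}"
      by (rule bij_betw_same_card)
    then show "int (card (centralizing_pairs K ?E)) = int (card {(x, y). x \<in> supported K Q \<and> y \<in> supported K Q \<and>
          (\<forall>i\<in>I3. \<forall>k\<in>I5. (\<Sum>j\<in>I4. x (i, j) * y (j, k)) = (\<Sum>j\<in>I4. y (i, j) * x (j, k)))})"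
      by (rule arg_cong)
  qed
qed

lemma laurent_count_commuting_U:
  "laurent_count (\<lambda>(K :: 'a::comm_ring set) e.
     int (card {(x, y). x \<in> supported K U \<and> y \<in> supported K U \<and> mm n x y = mm n y x}))"
proof (rule laurent_count_cong[OF laurent_count_mult[OF laurent_count_power]])
  show "laurent_count (\<lambda>(K :: 'a set) e. \<Sum>Z\<in>supported K (B \<times> A). int (card (centralizing_pairs K Z)))"
  proof (rule laurent_count_matrix_sum[where \<rho> = "\<lambda>i. i" and \<kappa> = "\<lambda>i. i"])
    fix K :: "'a set" and e assume "finite_subfield K e"
    then show "elim_invariant K (\<lambda>i. i) (\<lambda>i. i) B A (\<lambda>Z. int (card (centralizing_pairs K Z)))"
      by (rule elim_invariant_centralizing_pairs)
  next
    fix w assume "w \<in> partial_matchings B A"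
    then show "laurent_count (\<lambda>(K :: 'a set) e. int (card (centralizing_pairs K (matching_matrix e w))))"
      by (rule laurent_count_centralizing_pairs_matching)
  qed (simp_all add: fin_sets)
qed (rule card_commuting_pairs, assumption)

end

section \<open>The unipotent radical\<close>

text \<open>A \<open>group_action\<close> takes values in \<open>BijGroup E\<close>, whose elements
  are extensional; this is the reason for restricting the maps to \<open>E\<close>.\<close>

lemma group_action_restrict:
  fixes G (structure)
  assumes "group G"
    and closed: "\<And>g x. g \<in> carrier G \<Longrightarrow> x \<in> E \<Longrightarrow> act g x \<in> E"
    and one: "\<And>x. x \<in> E \<Longrightarrow> act \<one>\<^bsub>G\<^esub> x = x"
    and mult: "\<And>g h x. g \<in> carrier G \<Longrightarrow> h \<in> carrier G \<Longrightarrow> x \<in> E \<Longrightarrow> act (g \<otimes>\<^bsub>G\<^esub> h) x = act g (act h x)"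
  shows "group_action G E (\<lambda>g. \<lambda>x\<in>E. act g x)"
proof -
  interpret group G by fact
  have bij: "(\<lambda>x\<in>E. act g x) \<in> Bij E" if g: "g \<in> carrier G" for g
  proof -
    have "bij_betw (\<lambda>x\<in>E. act g x) E E"
    proof (rule bij_betw_byWitness[where f' = "act (inv g)"])
      show "\<forall>x\<in>E. act (inv g) ((\<lambda>x\<in>E. act g x) x) = x"
      proof
        fix x assume "x \<in> E"
        then show "act (inv g) ((\<lambda>x\<in>E. act g x) x) = x"
          using mult[of "inv g" g x] one[of x] g by simp
      qed
      show "\<forall>x\<in>E. (\<lambda>x\<in>E. act g x) (act (inv g) x) = x"
      proof
        fix x assume "x \<in> E"
        then show "(\<lambda>x\<in>E. act g x) (act (inv g) x) = x"
          using mult[of g "inv g" x] one[of x] closed[of "inv g" x] g by simp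
      qed
    qed (use closed g in auto)
    then show ?thesis
      by (simp add: Bij_def)
  qed
  have "(\<lambda>x\<in>E. act (g \<otimes> h) x) = compose E (\<lambda>x\<in>E. act g x) (\<lambda>x\<in>E. act h x)"
    if "g \<in> carrier G" "h \<in> carrier G" for g h
    using mult closed that by (auto simp: compose_def restrict_def fun_eq_iff)
  then have "(\<lambda>g. \<lambda>x\<in>E. act g x) \<in> hom G (BijGroup E)"
    using bij by (auto simp: hom_def BijGroup_def)
  then show ?thesis
    unfolding group_action_def group_hom_def group_hom_axioms_def
    using group_BijGroup is_group by blast
qed

text \<open>The points that are not fixed are a disjoint union of orbits, and the size of each
  divides \<open>p ^ k\<close> without being 1.\<close>

lemma (in group_action) dvd_card_nonfixed:
  assumes p: "prime p" and G: "Coset.order G = p ^ k" and E: "finite E"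
  shows "p dvd card (E - {x \<in> E. \<forall>g\<in>carrier G. \<phi> g x = x})"
proof -
  interpret G: group G
    using group_hom by (rule group_hom.axioms(1))
  let ?F = "{x \<in> E. \<forall>g\<in>carrier G. \<phi> g x = x}"
  let ?C = "orbit G \<phi> ` (E - ?F)"
  have orb: "orbit G \<phi> x \<subseteq> E" if "x \<in> E" for x
    using element_image[OF _ that] by (auto simp: orbit_def)
  have refl: "x \<in> orbit G \<phi> x" if "x \<in> E" for x
    using orbit_refl[OF that] .
  have un: "\<Union>?C = E - ?F"
  proof (intro equalityI subsetI)
    fix y assume "y \<in> \<Union>?C"
    then obtain x where x: "x \<in> E" "x \<notin> ?F" "y \<in> orbit G \<phi> x"
      by blast
    then have y: "y \<in> E"
      using orb by blast
    have "y \<notin> ?F"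
    proof
      assume "y \<in> ?F"
      then have "orbit G \<phi> y = {y}"
        using refl[OF y] by (auto simp: orbit_def)
      moreover have "x \<in> orbit G \<phi> y"
        using orbit_sym[OF x(1) y x(3)] .
      ultimately show False
        using x(2) \<open>y \<in> ?F\<close> by simp
    qed
    then show "y \<in> E - ?F"
      using y by blast
  next
    fix y assume "y \<in> E - ?F"
    then show "y \<in> \<Union>?C"
      using refl[of y] by blast
  qed
  have "p dvd card (\<Union>?C)"
  proof (rule dvd_partition)
    show "finite (\<Union>?C)"
      unfolding un using E by simp
    show "\<forall>c1\<in>?C. \<forall>c2\<in>?C. c1 \<noteq> c2 \<longrightarrow> c1 \<inter> c2 = {}"
    proof (intro ballI impI)
      fix c1 c2 assume "c1 \<in> ?C" "c2 \<in> ?C" "c1 \<noteq> c2"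
      moreover from this have "c1 \<in> orbits G E \<phi>" "c2 \<in> orbits G E \<phi>"
        by (auto simp: orbits_def)
      ultimately show "c1 \<inter> c2 = {}"
        using disjoint_union by blast
    qed
    show "\<forall>c\<in>?C. p dvd card c"
    proof
      fix c assume "c \<in> ?C"
      then obtain x where x: "x \<in> E" "x \<notin> ?F" and c: "c = orbit G \<phi> x"
        by blast
      have "card c dvd p ^ k"
        using orbit_stabilizer_theorem[OF x(1)] unfolding G c by (metis dvd_triv_left)
      then obtain j where j: "card c = p ^ j"
        using divides_primepow_nat[OF p] by blast
      have "j \<noteq> 0"
      proof
        assume "j = 0"
        then have "card c = 1"
          using j by simp
        then have "c = {x}"
          using refl[OF x(1)] unfolding c by (metis card_1_singletonE singletonD)
        then have "\<forall>g\<in>carrier G. \<phi> g x = x"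
          unfolding c orbit_def by blast
        then show False
          using x by blast
      qed
      then show "p dvd card c"
        using j by simp
    qed
  qed
  then show ?thesis
    unfolding un .
qed

text \<open>The bridge between the two encodings of a field: the record \<open>F\<close> of the
  theorem and the subset \<open>K\<close> of a type with class arithmetic, in which all counting
  takes place.\<close>

locale matrix_embedding = field F + finite_subfield K e
  for F (structure) and K :: "'a::comm_ring set" and e +
  fixes \<phi> :: "'b \<Rightarrow> 'a" and n :: nat
  assumes \<phi>_bij: "bij_betw \<phi> (carrier F) K"
    and \<phi>_add: "a \<in> carrier F \<Longrightarrow> b \<in> carrier F \<Longrightarrow> \<phi> (a \<oplus>\<^bsub>F\<^esub> b) = \<phi> a + \<phi> b"
    and \<phi>_mult: "a \<in> carrier F \<Longrightarrow> b \<in> carrier F \<Longrightarrow> \<phi> (a \<otimes>\<^bsub>F\<^esub> b) = \<phi> a * \<phi> b"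
    and \<phi>_one: "\<phi> \<one>\<^bsub>F\<^esub> = e"
begin

abbreviation "N2 \<equiv> {..<n} \<times> {..<n}"
abbreviation "M \<equiv> matrix_monoid F n"

lemma \<phi>_K: "a \<in> carrier F \<Longrightarrow> \<phi> a \<in> K"
  using \<phi>_bij by (auto simp: bij_betw_def)

lemma \<phi>_inj: "a \<in> carrier F \<Longrightarrow> b \<in> carrier F \<Longrightarrow> \<phi> a = \<phi> b \<longleftrightarrow> a = b"
  using \<phi>_bij by (auto simp: bij_betw_def inj_on_def)

lemma \<phi>_zero: "\<phi> \<zero>\<^bsub>F\<^esub> = 0"
  using \<phi>_add[of "\<zero>" "\<zero>"] by simp

lemma \<phi>_finsum: "finite I \<Longrightarrow> f \<in> I \<rightarrow> carrier F \<Longrightarrow> \<phi> (finsum F f I) = (\<Sum>i\<in>I. \<phi> (f i))"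
proof (induction I rule: finite_induct)
  case empty
  then show ?case
    by (simp add: \<phi>_zero)
next
  case (insert x I)
  then have "finsum F f (insert x I) = f x \<oplus> finsum F f I"
    by (intro finsum_insert) auto
  moreover have "finsum F f I \<in> carrier F"
    using insert by (intro finsum_closed) auto
  ultimately show ?case
    using insert by (simp add: \<phi>_add)
qed

definition emb :: "'b mat \<Rightarrow> nat \<times> nat \<Rightarrow> 'a" where
  "emb X = (\<lambda>(i, j). if i < n \<and> j < n then \<phi> (X $$ (i, j)) else 0)"

definition pull :: "(nat \<times> nat \<Rightarrow> 'a) \<Rightarrow> 'b mat" where
  "pull x = mat n n (\<lambda>p. inv_into (carrier F) \<phi> (x p))"

lemma carrier_M: "X \<in> carrier M \<longleftrightarrow> X \<in> carrier_mat n n \<and> (\<forall>i<n. \<forall>j<n. X $$ (i, j) \<in> carrier F)"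
  by (simp add: matrix_monoid_def)

lemma emb_supported: "X \<in> carrier M \<Longrightarrow> emb X \<in> supported K N2"
  by (auto simp: supported_def emb_def carrier_M \<phi>_K)

lemma emb_inj: "X \<in> carrier M \<Longrightarrow> Y \<in> carrier M \<Longrightarrow> emb X = emb Y \<longleftrightarrow> X = Y"
proof
  assume X: "X \<in> carrier M" and Y: "Y \<in> carrier M" and eq: "emb X = emb Y"
  have "X $$ (i, j) = Y $$ (i, j)" if "i < n" "j < n" for i j
    using fun_cong[OF eq, of "(i, j)"] that X Y \<phi>_inj by (simp add: emb_def carrier_M)
  then show "X = Y"
    using X Y by (intro eq_matI) (auto simp: carrier_M)
qed auto

lemma pull: "x \<in> supported K N2 \<Longrightarrow> pull x \<in> carrier M \<and> emb (pull x) = x"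
proof -
  assume x: "x \<in> supported K N2"
  have i: "inv_into (carrier F) \<phi> (x p) \<in> carrier F" "\<phi> (inv_into (carrier F) \<phi> (x p)) = x p" for p
    using supported_K[OF x, of p] \<phi>_bij by (auto simp: bij_betw_def inv_into_into f_inv_into_f)
  then show ?thesis
    using supported_zero[OF x] by (auto simp: carrier_M pull_def emb_def fun_eq_iff)
qed

lemma emb_mult:
  assumes X: "X \<in> carrier M" and Y: "Y \<in> carrier M"
  shows "X \<otimes>\<^bsub>M\<^esub> Y \<in> carrier M" "emb (X \<otimes>\<^bsub>M\<^esub> Y) = mm n (emb X) (emb Y)"
proof -
  have c: "(\<Oplus>\<^bsub>F\<^esub>k\<in>{..<n}. X $$ (i, k) \<otimes>\<^bsub>F\<^esub> Y $$ (k, j)) \<in> carrier F" if "i < n" "j < n" for i j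
    using X Y that by (intro finsum_closed) (auto simp: carrier_M)
  then show "X \<otimes>\<^bsub>M\<^esub> Y \<in> carrier M"
    by (auto simp: matrix_monoid_def)
  show "emb (X \<otimes>\<^bsub>M\<^esub> Y) = mm n (emb X) (emb Y)"
  proof
    fix p :: "nat \<times> nat"
    obtain i j where p: "p = (i, j)"
      by fastforce
    show "emb (X \<otimes>\<^bsub>M\<^esub> Y) p = mm n (emb X) (emb Y) p"
    proof (cases "i < n \<and> j < n")
      case True
      then have "emb (X \<otimes>\<^bsub>M\<^esub> Y) (i, j) = \<phi> (\<Oplus>\<^bsub>F\<^esub>k\<in>{..<n}. X $$ (i, k) \<otimes>\<^bsub>F\<^esub> Y $$ (k, j))"
        by (simp add: emb_def matrix_monoid_def)
      also have "\<dots> = (\<Sum>k<n. \<phi> (X $$ (i, k) \<otimes>\<^bsub>F\<^esub> Y $$ (k, j)))"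
        using X Y True by (intro \<phi>_finsum) (auto simp: carrier_M)
      also have "\<dots> = (\<Sum>k<n. \<phi> (X $$ (i, k)) * \<phi> (Y $$ (k, j)))"
        using X Y True by (intro sum.cong refl \<phi>_mult) (auto simp: carrier_M)
      also have "\<dots> = mm n (emb X) (emb Y) (i, j)"
        using True by (simp add: mm_def emb_def)
      finally show ?thesis
        by (simp add: p)
    next
      case False
      then show ?thesis
        by (auto simp: p emb_def mm_def)
    qed
  qed
qed

lemma emb_one: "\<one>\<^bsub>M\<^esub> \<in> carrier M" "emb \<one>\<^bsub>M\<^esub> = idm n"
  by (auto simp: matrix_monoid_def emb_def idm_def fun_eq_iff \<phi>_one \<phi>_zero)

lemma mm_idm': "x \<in> supported K N2 \<Longrightarrow> mm n (idm n) x = x" "x \<in> supported K N2 \<Longrightarrow> mm n x (idm n) = x"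
  using mm_idm by auto

lemma monoid_M: "monoid M"
proof (rule monoidI)
  fix X Y Z assume X: "X \<in> carrier M" and Y: "Y \<in> carrier M" and Z: "Z \<in> carrier M"
  show "X \<otimes>\<^bsub>M\<^esub> Y \<in> carrier M"
    using X Y by (rule emb_mult)
  have "emb (X \<otimes>\<^bsub>M\<^esub> Y \<otimes>\<^bsub>M\<^esub> Z) = emb (X \<otimes>\<^bsub>M\<^esub> (Y \<otimes>\<^bsub>M\<^esub> Z))"
    using X Y Z by (simp add: emb_mult mm_assoc)
  then show "X \<otimes>\<^bsub>M\<^esub> Y \<otimes>\<^bsub>M\<^esub> Z = X \<otimes>\<^bsub>M\<^esub> (Y \<otimes>\<^bsub>M\<^esub> Z)"
    using X Y Z by (subst (asm) emb_inj) (auto intro: emb_mult)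
next
  show "\<one>\<^bsub>M\<^esub> \<in> carrier M"
    by (rule emb_one)
next
  fix X assume X: "X \<in> carrier M"
  have "emb (\<one>\<^bsub>M\<^esub> \<otimes>\<^bsub>M\<^esub> X) = emb X" "emb (X \<otimes>\<^bsub>M\<^esub> \<one>\<^bsub>M\<^esub>) = emb X"
    using emb_supported[OF X] by (simp_all add: emb_mult emb_one X mm_idm')
  then show "\<one>\<^bsub>M\<^esub> \<otimes>\<^bsub>M\<^esub> X = X" "X \<otimes>\<^bsub>M\<^esub> \<one>\<^bsub>M\<^esub> = X"
    by (simp_all only: emb_inj[OF emb_mult(1)[OF emb_one(1) X] X] emb_inj[OF emb_mult(1)[OF X emb_one(1)] X])
qed

lemma group_GL: "group (GL n F)"
  unfolding GL_def by (rule monoid.units_group[OF monoid_M])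

lemma GL_simps:
  "carrier (GL n F) = Units M" "monoid.mult (GL n F) = monoid.mult M" "one (GL n F) = one M"
  by (simp_all add: GL_def units_of_carrier units_of_mult units_of_one)

lemma Units_iff: "X \<in> Units M \<longleftrightarrow> X \<in> carrier M \<and>
    (\<exists>Y\<in>carrier M. mm n (emb X) (emb Y) = idm n \<and> mm n (emb Y) (emb X) = idm n)"
proof -
  have "Y \<otimes>\<^bsub>M\<^esub> X = \<one>\<^bsub>M\<^esub> \<longleftrightarrow> mm n (emb Y) (emb X) = idm n" if "X \<in> carrier M" "Y \<in> carrier M" for X Y
    using emb_inj[OF emb_mult(1)[OF that(2,1)] emb_one(1)] by (simp add: emb_mult that emb_one)
  then show ?thesis
    unfolding Units_def by blast
qed

definition embv :: "'b vec \<Rightarrow> nat \<Rightarrow> 'a" where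
  "embv v = (\<lambda>i. if i < n then \<phi> (v $ i) else 0)"

abbreviation "V \<equiv> coord_space F n"

lemma carrier_V: "v \<in> carrier V \<longleftrightarrow> v \<in> carrier_vec n \<and> (\<forall>i<n. v $ i \<in> carrier F)"
  by (simp add: coord_space_def)

lemma module_V: "Module.module F V"
proof (rule moduleI)
  show "cring F"
    by (rule is_cring)
  show "abelian_group V"
  proof (rule abelian_groupI)
    fix v w x assume "v \<in> carrier V" "w \<in> carrier V" "x \<in> carrier V"
    then show "v \<oplus>\<^bsub>V\<^esub> w \<oplus>\<^bsub>V\<^esub> x = v \<oplus>\<^bsub>V\<^esub> (w \<oplus>\<^bsub>V\<^esub> x)"
      by (auto simp: coord_space_def a_assoc intro!: eq_vecI)
  next
    fix v w assume "v \<in> carrier V" "w \<in> carrier V"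
    then show "v \<oplus>\<^bsub>V\<^esub> w = w \<oplus>\<^bsub>V\<^esub> v"
      by (auto simp: coord_space_def intro!: eq_vecI a_comm)
  next
    fix v assume "v \<in> carrier V"
    then show "\<exists>w\<in>carrier V. w \<oplus>\<^bsub>V\<^esub> v = \<zero>\<^bsub>V\<^esub>"
      by (intro bexI[of _ "vec n (\<lambda>i. \<ominus> (v $ i))"]) (auto simp: coord_space_def l_neg)
  qed (auto simp: coord_space_def intro!: eq_vecI)
qed (auto simp: coord_space_def l_distr r_distr m_assoc intro!: eq_vecI)

lemma std_basis_vec_V: "std_basis_vec F n j \<in> carrier V"
  by (auto simp: carrier_V std_basis_vec_def)

text \<open>One inclusion holds because the right-hand side is a submodule containing the spanning
  vectors; the other splits off the last coordinate allowed to be nonzero, by induction on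
  \<open>d\<close>.\<close>

lemma std_subspace_eq:
  assumes "d \<le> n"
  shows "std_subspace F n d = {v \<in> carrier V. \<forall>i<n. d \<le> i \<longrightarrow> v $ i = \<zero>}"
proof -
  interpret V: Module.module F V
    by (rule module_V)
  have S: "std_basis_vec F n ` {..<d} \<subseteq> carrier V"
    using std_basis_vec_V by auto
  have sub: "LinearCombinations.submodule F (LinearCombinations.module.span F V S) V" if "S \<subseteq> carrier V" for S
    using that by (rule V.span_is_submodule)
  show ?thesis
  proof (intro equalityI)
    have "LinearCombinations.submodule F {v \<in> carrier V. \<forall>i<n. d \<le> i \<longrightarrow> v $ i = \<zero>} V"
      using module_V by (auto simp: LinearCombinations.submodule_def coord_space_def)
    then show "std_subspace F n d \<subseteq> {v \<in> carrier V. \<forall>i<n. d \<le> i \<longrightarrow> v $ i = \<zero>}"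
      unfolding std_subspace_def
      by (intro V.span_is_subset) (use std_basis_vec_V in \<open>auto simp: std_basis_vec_def\<close>)
    show "{v \<in> carrier V. \<forall>i<n. d \<le> i \<longrightarrow> v $ i = \<zero>} \<subseteq> std_subspace F n d"
      using assms
    proof (induction d)
      case 0
      interpret s: LinearCombinations.submodule F "LinearCombinations.module.span F V {}" V
        by (rule sub) simp
      show ?case
      proof
        fix v assume "v \<in> {v \<in> carrier V. \<forall>i<n. 0 \<le> i \<longrightarrow> v $ i = \<zero>}"
        then have "v = \<zero>\<^bsub>V\<^esub>"
          by (intro eq_vecI) (auto simp: coord_space_def)
        then show "v \<in> std_subspace F n 0"
          using s.zero_closed by (simp add: std_subspace_def)
      qed
    next
      case (Suc d)
      interpret s: LinearCombinations.submodule F "std_subspace F n (Suc d)" V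
        unfolding std_subspace_def by (rule sub) (use std_basis_vec_V in auto)
      have mono: "std_subspace F n d \<subseteq> std_subspace F n (Suc d)"
        unfolding std_subspace_def by (intro V.span_is_monotone) auto
      have "std_basis_vec F n ` {..<Suc d} \<subseteq> std_subspace F n (Suc d)"
        unfolding std_subspace_def by (intro V.in_own_span) (use std_basis_vec_V in auto)
      then have b: "std_basis_vec F n d \<in> std_subspace F n (Suc d)"
        by auto
      show ?case
      proof
        fix v assume v: "v \<in> {v \<in> carrier V. \<forall>i<n. Suc d \<le> i \<longrightarrow> v $ i = \<zero>}"
        let ?w = "vec n (\<lambda>i. if i = d then \<zero> else v $ i)"
        have "?w \<in> {v \<in> carrier V. \<forall>i<n. d \<le> i \<longrightarrow> v $ i = \<zero>}"
          using v by (auto simp: carrier_V)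
        then have w: "?w \<in> std_subspace F n (Suc d)"
          using Suc mono by auto
        have "v = ?w \<oplus>\<^bsub>V\<^esub> (v $ d) \<odot>\<^bsub>V\<^esub> std_basis_vec F n d"
          using v Suc.prems by (intro eq_vecI) (auto simp: coord_space_def std_basis_vec_def)
        moreover have "v $ d \<in> carrier F"
          using v Suc.prems by (auto simp: carrier_V)
        ultimately show "v \<in> std_subspace F n (Suc d)"
          using s.m_closed[OF w s.smult_closed[OF _ b]] by metis
      qed
    qed
  qed
qed

lemma mat_apply:
  assumes X: "X \<in> carrier M" and v: "v \<in> carrier V"
  shows "mat_apply F n X v \<in> carrier V"
    "embv (mat_apply F n X v) = (\<lambda>i. \<Sum>j<n. emb X (i, j) * embv v j)"
proof -
  show "mat_apply F n X v \<in> carrier V"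
    using X v by (auto simp: carrier_V carrier_M mat_apply_def intro!: finsum_closed)
  show "embv (mat_apply F n X v) = (\<lambda>i. \<Sum>j<n. emb X (i, j) * embv v j)"
  proof
    fix i
    have "\<phi> (\<Oplus>\<^bsub>F\<^esub>j\<in>{..<n}. X $$ (i, j) \<otimes>\<^bsub>F\<^esub> v $ j) = (\<Sum>j<n. \<phi> (X $$ (i, j)) * \<phi> (v $ j))" if "i < n"
    proof -
      have "\<phi> (\<Oplus>\<^bsub>F\<^esub>j\<in>{..<n}. X $$ (i, j) \<otimes>\<^bsub>F\<^esub> v $ j) = (\<Sum>j<n. \<phi> (X $$ (i, j) \<otimes>\<^bsub>F\<^esub> v $ j))"
        using X v that by (intro \<phi>_finsum) (auto simp: carrier_M carrier_V)
      also have "\<dots> = (\<Sum>j<n. \<phi> (X $$ (i, j)) * \<phi> (v $ j))"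
        using X v that by (intro sum.cong refl \<phi>_mult) (auto simp: carrier_M carrier_V)
      finally show ?thesis .
    qed
    then show "embv (mat_apply F n X v) i = (\<Sum>j<n. emb X (i, j) * embv v j)"
      by (simp add: embv_def emb_def mat_apply_def)
  qed
qed

lemma embv_inj: "v \<in> carrier V \<Longrightarrow> w \<in> carrier V \<Longrightarrow> embv v = embv w \<longleftrightarrow> v = w"
proof
  assume v: "v \<in> carrier V" and w: "w \<in> carrier V" and eq: "embv v = embv w"
  have "v $ i = w $ i" if "i < n" for i
    using fun_cong[OF eq, of i] that v w \<phi>_inj by (simp add: embv_def carrier_V)
  then show "v = w"
    using v w by (intro eq_vecI) (auto simp: carrier_V)
qed auto

lemma mat_apply_mult:
  assumes "X \<in> carrier M" "Y \<in> carrier M" "v \<in> carrier V"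
  shows "mat_apply F n (X \<otimes>\<^bsub>M\<^esub> Y) v = mat_apply F n X (mat_apply F n Y v)"
proof -
  have "embv (mat_apply F n (X \<otimes>\<^bsub>M\<^esub> Y) v) i = embv (mat_apply F n X (mat_apply F n Y v)) i" for i
  proof -
    have "(\<Sum>j<n. (\<Sum>k<n. emb X (i, k) * emb Y (k, j)) * embv v j) =
        (\<Sum>j<n. \<Sum>k<n. emb X (i, k) * (emb Y (k, j) * embv v j))"
      by (simp add: sum_distrib_right mult.assoc)
    also have "\<dots> = (\<Sum>k<n. \<Sum>j<n. emb X (i, k) * (emb Y (k, j) * embv v j))"
      by (rule sum.swap)
    finally show ?thesis
      using assms by (simp add: mat_apply emb_mult mm_def sum_distrib_left)
  qed
  then show ?thesis
    using assms by (subst embv_inj[symmetric]) (auto intro!: mat_apply emb_mult ext)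
qed

lemma mat_apply_one:
  assumes "v \<in> carrier V"
  shows "mat_apply F n \<one>\<^bsub>M\<^esub> v = v"
proof -
  have "(\<Sum>j<n. idm n (i, j) * embv v j) = embv v i" for i
  proof -
    have "embv v j \<in> K" for j
      using assms by (auto simp: embv_def carrier_V \<phi>_K)
    then have "(\<Sum>j<n. idm n (i, j) * embv v j) = (\<Sum>j<n. if j = i then embv v i else 0)"
      by (intro sum.cong refl) (auto simp: idm_def)
    then show ?thesis
      by (simp add: embv_def)
  qed
  then show ?thesis
    using assms by (subst embv_inj[symmetric]) (auto intro!: mat_apply emb_one simp: mat_apply emb_one)
qed

lemma std_basis_vec_emb: "j < n \<Longrightarrow> embv (std_basis_vec F n j) = (\<lambda>i. if i = j then e else 0)"
  by (auto simp: embv_def std_basis_vec_def fun_eq_iff \<phi>_one \<phi>_zero)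

lemma embv_zero: "v \<in> carrier V \<Longrightarrow> i < n \<Longrightarrow> embv v i = 0 \<longleftrightarrow> v $ i = \<zero>"
  using \<phi>_inj[of "v $ i" "\<zero>"] by (simp add: embv_def carrier_V \<phi>_zero)

text \<open>Column \<open>j\<close> of \<open>X\<close> is the image of basis vector
  \<open>j\<close>, so the inclusion constrains exactly the columns below \<open>d\<close>.\<close>

lemma stabilizes_std_subspace:
  assumes X: "X \<in> carrier M" and d: "d \<le> n"
  shows "mat_apply F n X ` std_subspace F n d \<subseteq> std_subspace F n d \<longleftrightarrow>
    (\<forall>i<n. \<forall>j<n. j < d \<and> d \<le> i \<longrightarrow> emb X (i, j) = 0)"
proof (intro iffI allI impI)
  fix i j assume *: "mat_apply F n X ` std_subspace F n d \<subseteq> std_subspace F n d"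
    and ij: "i < n" "j < n" "j < d \<and> d \<le> i"
  let ?v = "std_basis_vec F n j"
  have "?v \<in> std_subspace F n d"
    using ij std_basis_vec_V by (auto simp: std_subspace_eq[OF d] std_basis_vec_def)
  then have "mat_apply F n X ?v \<in> std_subspace F n d"
    using * by blast
  then have "embv (mat_apply F n X ?v) i = 0"
    using ij embv_zero by (simp add: std_subspace_eq[OF d])
  moreover have "embv (mat_apply F n X ?v) i = emb X (i, j)"
  proof -
    have "(\<Sum>k<n. emb X (i, k) * (if k = j then e else 0)) = (\<Sum>k<n. if k = j then emb X (i, j) else 0)"
      using supported_K[OF emb_supported[OF X]] by (intro sum.cong refl) auto
    then show ?thesis
      using ij by (simp add: mat_apply[OF X std_basis_vec_V] std_basis_vec_emb)
  qed
  ultimately show "emb X (i, j) = 0"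
    by simp
next
  assume *: "\<forall>i<n. \<forall>j<n. j < d \<and> d \<le> i \<longrightarrow> emb X (i, j) = 0"
  show "mat_apply F n X ` std_subspace F n d \<subseteq> std_subspace F n d"
  proof (rule image_subsetI)
    fix v assume "v \<in> std_subspace F n d"
    then have v: "v \<in> carrier V" "\<And>i. i < n \<Longrightarrow> d \<le> i \<Longrightarrow> embv v i = 0"
      using embv_zero by (auto simp: std_subspace_eq[OF d])
    have "embv (mat_apply F n X v) i = 0" if i: "i < n" "d \<le> i" for i
    proof -
      have "emb X (i, j) * embv v j = 0" if "j < n" for j
        using * i v(2)[of j] that by (cases "j < d") auto
      then show ?thesis
        by (simp add: mat_apply[OF X v(1)])
    qed
    then show "mat_apply F n X v \<in> std_subspace F n d"
      using mat_apply(1)[OF X v(1)] embv_zero by (simp add: std_subspace_eq[OF d])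
  qed
qed

end

section \<open>The parabolic subgroup as a group of block upper triangular matrices\<close>

locale flag_embedding = matrix_embedding F K e \<phi> n for F (structure) and K :: "'a::comm_ring set" and e and \<phi> :: "'b \<Rightarrow> 'a" and n +
  fixes ds :: "nat list"
  assumes ds: "sorted ds" "ds \<noteq> []" "last ds = n" "length ds \<le> 5"
begin

text \<open>Each flag dimension up to \<open>i\<close> marks the end of a block lying before
  \<open>i\<close>. Repeated dimensions and zeros skip a number and so produce the empty
  blocks.\<close>

definition l :: "nat \<Rightarrow> nat" where
  "l i = length (filter (\<lambda>d. d \<le> i) ds)"

abbreviation "P \<equiv> parabolic F n ds"

lemma ds_le: "d \<in> set ds \<Longrightarrow> d \<le> n"
proof -
  assume d: "d \<in> set ds"
  have eq: "ds = butlast ds @ [n]"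
    using append_butlast_last_id[OF ds(2)] ds(3) by simp
  have "sorted (butlast ds @ [n])"
    using ds(1) eq by simp
  then have "\<forall>x\<in>set (butlast ds). x \<le> n"
    by (simp add: sorted_append)
  moreover have "set ds = insert n (set (butlast ds))"
    using arg_cong[OF eq, of set] by simp
  ultimately show "d \<le> n"
    using d by auto
qed

lemma l_less_iff: "l j < l i \<longleftrightarrow> (\<exists>d\<in>set ds. j < d \<and> d \<le> i)"
proof -
  have *: "l j < l i" if "d \<in> set ds" "j < d" "d \<le> i" for d
  proof -
    have "filter (\<lambda>d. d \<le> j) ds = filter (\<lambda>d. d \<le> j) (filter (\<lambda>d. d \<le> i) ds)"
      using that by (auto simp: filter_filter intro!: filter_cong)
    then show ?thesis
      unfolding l_def
      using length_filter_less[of d "filter (\<lambda>d. d \<le> i) ds" "\<lambda>d. d \<le> j"] that by simp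
  qed
  have "l i \<le> l j" if "\<not> (\<exists>d\<in>set ds. j < d \<and> d \<le> i)"
  proof -
    have "filter (\<lambda>d. d \<le> i) ds = filter (\<lambda>d. d \<le> i) (filter (\<lambda>d. d \<le> j) ds)"
      using that by (auto simp: filter_filter intro!: filter_cong)
    then show ?thesis
      unfolding l_def by (metis length_filter_le)
  qed
  then show ?thesis
    using * by (meson linorder_not_less)
qed

sublocale flag_levels n l
proof
  show "l i \<le> l j" if "i \<le> j" for i j
    using l_less_iff[of j i] that by (meson linorder_not_less order_trans)
  show "l i \<le> 4" if "i < n" for i
  proof -
    have "last ds \<in> set ds" "\<not> last ds \<le> i"
      using ds that by auto
    then have "l i < length ds"
      unfolding l_def by (intro length_filter_less)
    then show ?thesis
      using ds by simp
  qed
qed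

definition block_upper :: "(nat \<times> nat) set" where
  "block_upper = {(i, j). i < n \<and> j < n \<and> l i \<le> l j}"

lemma stabilizes_flag_iff:
  assumes X: "X \<in> carrier M"
  shows "(\<forall>d\<in>set ds. mat_apply F n X ` std_subspace F n d \<subseteq> std_subspace F n d) \<longleftrightarrow>
    emb X \<in> supported K block_upper"
proof -
  have "(\<forall>d\<in>set ds. mat_apply F n X ` std_subspace F n d \<subseteq> std_subspace F n d) \<longleftrightarrow>
      (\<forall>i<n. \<forall>j<n. l j < l i \<longrightarrow> emb X (i, j) = 0)"
    using stabilizes_std_subspace[OF X ds_le] unfolding l_less_iff by blast
  also have "\<dots> \<longleftrightarrow> emb X \<in> supported K block_upper"
  proof
    assume *: "\<forall>i<n. \<forall>j<n. l j < l i \<longrightarrow> emb X (i, j) = 0"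
    have "emb X (i, j) = 0" if "(i, j) \<notin> block_upper" for i j
      using * that supported_zero[OF emb_supported[OF X], of "(i, j)"]
      by (cases "i < n \<and> j < n") (auto simp: block_upper_def)
    then show "emb X \<in> supported K block_upper"
      using supported_K[OF emb_supported[OF X]] by (auto simp: supported_def)
  next
    assume "emb X \<in> supported K block_upper"
    then show "\<forall>i<n. \<forall>j<n. l j < l i \<longrightarrow> emb X (i, j) = 0"
      using supported_zero[of "emb X" K block_upper] by (auto simp: block_upper_def)
  qed
  finally show ?thesis .
qed

definition act :: "'b mat \<Rightarrow> 'b vec set list \<Rightarrow> 'b vec set list" where
  "act g = map ((`) (mat_apply F n g))"

lemma std_flag_V: "W \<in> set (std_flag F n ds) \<Longrightarrow> W \<subseteq> carrier V"
  using ds_le by (auto simp: std_flag_def std_subspace_eq)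

lemma act_mult:
  assumes "X \<in> carrier M" "Y \<in> carrier M" "\<And>W. W \<in> set fl \<Longrightarrow> W \<subseteq> carrier V"
  shows "act (X \<otimes>\<^bsub>M\<^esub> Y) fl = act X (act Y fl)"
proof -
  have "mat_apply F n (X \<otimes>\<^bsub>M\<^esub> Y) ` W = mat_apply F n X ` mat_apply F n Y ` W" if "W \<in> set fl" for W
    using mat_apply_mult[OF assms(1,2)] assms(3)[OF that] by (auto simp: image_image intro!: image_cong)
  then show ?thesis
    by (simp add: act_def)
qed

lemma act_one:
  assumes "\<And>W. W \<in> set fl \<Longrightarrow> W \<subseteq> carrier V"
  shows "act \<one>\<^bsub>M\<^esub> fl = fl"
proof -
  have "mat_apply F n \<one>\<^bsub>M\<^esub> ` W = W" if "W \<in> set fl" for W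
    using mat_apply_one assms[OF that] by (force simp: image_iff subset_iff)
  then show ?thesis
    by (simp add: act_def map_idI)
qed

lemma carrier_P: "carrier P = {g \<in> Units M. act g (std_flag F n ds) = std_flag F n ds}"
  by (simp add: parabolic_def stabilizer_def GL_simps act_def)

lemma P_simps: "monoid.mult P = monoid.mult M" "one P = one M"
  by (simp_all add: parabolic_def GL_simps)

lemma Units_M: "X \<in> Units M \<Longrightarrow> X \<in> carrier M"
  by (simp add: Units_def)

lemma subgroup_P: "subgroup (carrier P) (GL n F)"
proof -
  interpret GL: group "GL n F"
    by (rule group_GL)
  let ?fl = "std_flag F n ds"
  show ?thesis
  proof (rule GL.subgroupI)
    show "carrier P \<subseteq> carrier (GL n F)"
      by (auto simp: carrier_P GL_simps)
    have "\<one>\<^bsub>GL n F\<^esub> \<in> carrier P"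
      using GL.one_closed act_one[OF std_flag_V] by (simp add: carrier_P GL_simps)
    then show "carrier P \<noteq> {}"
      by blast
  next
    fix g assume g: "g \<in> carrier P"
    then have gc: "g \<in> carrier (GL n F)"
      by (simp add: carrier_P GL_simps)
    let ?i = "inv\<^bsub>GL n F\<^esub> g"
    have ic: "?i \<in> Units M"
      using GL.inv_closed[OF gc] by (simp add: GL_simps)
    have "act (?i \<otimes>\<^bsub>M\<^esub> g) ?fl = act ?i (act g ?fl)"
      using ic gc by (intro act_mult std_flag_V) (auto simp: GL_simps Units_M)
    moreover have "?i \<otimes>\<^bsub>M\<^esub> g = \<one>\<^bsub>M\<^esub>"
      using GL.l_inv[OF gc] by (simp add: GL_simps)
    ultimately have "act ?i ?fl = ?fl"
      using g act_one[OF std_flag_V] by (simp add: carrier_P)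
    then show "?i \<in> carrier P"
      using ic by (simp add: carrier_P)
  next
    fix g h assume g: "g \<in> carrier P" and h: "h \<in> carrier P"
    then have "g \<in> carrier (GL n F)" "h \<in> carrier (GL n F)"
      by (auto simp: carrier_P GL_simps)
    then have "g \<otimes>\<^bsub>GL n F\<^esub> h \<in> carrier (GL n F)"
      by (rule GL.m_closed)
    moreover have "act (g \<otimes>\<^bsub>M\<^esub> h) ?fl = ?fl"
      using g h by (subst act_mult[OF _ _ std_flag_V]) (auto simp: carrier_P Units_M)
    ultimately show "g \<otimes>\<^bsub>GL n F\<^esub> h \<in> carrier P"
      by (simp add: carrier_P GL_simps)
  qed
qed

lemma group_P: "group P"
  using subgroup.subgroup_is_group[OF subgroup_P group_GL] by (simp add: parabolic_def)

lemma carrier_P_emb: "g \<in> carrier P \<Longrightarrow> g \<in> carrier M \<and> emb g \<in> supported K block_upper"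
  using stabilizes_flag_iff[of g] Units_M[of g]
  by (auto simp: carrier_P act_def std_flag_def)

text \<open>The stabilizer asks for equality of subspaces, whereas the block pattern of
  \<open>g\<close> yields only one inclusion; the pattern of the inverse supplies the other.\<close>

lemma carrier_P_intro:
  assumes g: "g \<in> carrier M" "h \<in> carrier M"
    and inv: "mm n (emb g) (emb h) = idm n" "mm n (emb h) (emb g) = idm n"
    and up: "emb g \<in> supported K block_upper" "emb h \<in> supported K block_upper"
  shows "g \<in> carrier P"
proof -
  let ?W = "std_subspace F n"
  have gU: "g \<in> Units M"
    using Units_iff g inv by blast
  have gh: "g \<otimes>\<^bsub>M\<^esub> h = \<one>\<^bsub>M\<^esub>"
    using emb_inj[OF emb_mult(1)[OF g] emb_one(1)] inv by (simp add: emb_mult g emb_one)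
  have "mat_apply F n g ` ?W d = ?W d" if d: "d \<in> set ds" for d
  proof
    show "mat_apply F n g ` ?W d \<subseteq> ?W d"
      using stabilizes_flag_iff[OF g(1)] up(1) d by blast
    show "?W d \<subseteq> mat_apply F n g ` ?W d"
    proof
      fix v assume v: "v \<in> ?W d"
      then have vV: "v \<in> carrier V"
        using std_subspace_eq[OF ds_le[OF d]] by simp
      have "mat_apply F n h v \<in> ?W d"
        using stabilizes_flag_iff[OF g(2)] up(2) d v by blast
      moreover have "v = mat_apply F n g (mat_apply F n h v)"
        using mat_apply_mult[OF g vV] mat_apply_one[OF vV] gh by simp
      ultimately show "v \<in> mat_apply F n g ` ?W d"
        by blast
    qed
  qed
  then show ?thesis
    using gU by (simp add: carrier_P act_def std_flag_def)
qed

end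

context flag_embedding
begin

text \<open>The explicit candidate for the unipotent radical; \<open>p_core_eq\<close> identifies it
  with the largest normal \<open>p\<close>-subgroup.\<close>

definition uni :: "'b mat set" where
  "uni = {X \<in> carrier M. emb X - idm n \<in> supported K U}"

lemma U_N2: "U \<subseteq> N2" "U \<subseteq> block_upper" "block_upper \<subseteq> N2"
  by (auto simp: U_def block_upper_def)

lemma idm_block_upper: "idm n \<in> supported K block_upper"
  by (auto simp: supported_def idm_def block_upper_def)

lemma mm_U:
  "x \<in> supported K U \<Longrightarrow> y \<in> supported K U \<Longrightarrow> mm n x y \<in> supported K U"
  "x \<in> supported K U \<Longrightarrow> y \<in> supported K block_upper \<Longrightarrow> mm n x y \<in> supported K U"
  "x \<in> supported K block_upper \<Longrightarrow> y \<in> supported K U \<Longrightarrow> mm n x y \<in> supported K U"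
  by (erule mm_supported, assumption, fastforce simp: U_def block_upper_def)+

lemma uni_emb:
  assumes "X \<in> uni"
  obtains x where "x \<in> supported K U" "emb X = idm n + x" "X \<in> carrier M" "emb X \<in> supported K block_upper"
proof
  show x: "emb X - idm n \<in> supported K U" "X \<in> carrier M"
    using assms by (auto simp: uni_def)
  show eq: "emb X = idm n + (emb X - idm n)"
    by simp
  show "emb X \<in> supported K block_upper"
    using supported_add[OF idm_block_upper supported_mono[OF x(1) U_N2(2)]] by simp
qed

lemma uniI: "X \<in> carrier M \<Longrightarrow> emb X = idm n + x \<Longrightarrow> x \<in> supported K U \<Longrightarrow> X \<in> uni"
  by (simp add: uni_def)

lemma finite_uni: "finite uni" and card_uni: "card uni = card K ^ card U"
  and bij_uni: "bij_betw (\<lambda>X. emb X - idm n) uni (supported K U)"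
proof -
  show bij: "bij_betw (\<lambda>X. emb X - idm n) uni (supported K U)"
  proof (rule bij_betw_byWitness[where f' = "\<lambda>x. pull (idm n + x)"])
    have p: "pull (idm n + x) \<in> carrier M \<and> emb (pull (idm n + x)) = idm n + x" if "x \<in> supported K U" for x
      using supported_mono[OF idm_block_upper U_N2(3)] supported_mono[OF that U_N2(1)]
      by (intro pull supported_add)
    show "\<forall>X\<in>uni. pull (idm n + (emb X - idm n)) = X"
    proof
      fix X assume "X \<in> uni"
      then have X: "X \<in> carrier M"
        by (simp add: uni_def)
      then have "pull (emb X) = X"
        using pull[OF emb_supported[OF X]] emb_inj[of "pull (emb X)" X] by blast
      then show "pull (idm n + (emb X - idm n)) = X"
        by simp
    qed
    show "\<forall>x\<in>supported K U. emb (pull (idm n + x)) - idm n = x"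
      using p by simp
    show "(\<lambda>X. emb X - idm n) ` uni \<subseteq> supported K U"
      by (auto simp: uni_def)
    show "(\<lambda>x. pull (idm n + x)) ` supported K U \<subseteq> uni"
      using p by (auto intro: uniI)
  qed
  show "finite uni" "card uni = card K ^ card U"
    using bij_betw_finite[OF bij] bij_betw_same_card[OF bij] finite_supported[OF fin_sets(3)]
      card_supported_power[OF fin_sets(3)] by simp_all
qed

lemma mm_diff_right: "mm n z (x - y) = mm n z x - mm n z y"
  by (auto simp: mm_def fun_eq_iff sum_subtractf algebra_simps)

lemma mm_idm_add:
  assumes "x \<in> supported K N2" "y \<in> supported K N2"
  shows "mm n (idm n + x) (idm n + y) = idm n + (x + y + mm n x y)"
  using mm_idm'(1)[OF assms(2)] mm_idm'(2)[OF assms(1)]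
    mm_idm'(1)[OF supported_mono[OF idm_block_upper U_N2(3)]]
  by (simp add: mm_add_left mm_add_right add_ac)

lemma uni_mult:
  assumes "X \<in> uni" "Y \<in> uni"
  shows "X \<otimes>\<^bsub>M\<^esub> Y \<in> uni"
proof -
  obtain x y where x: "x \<in> supported K U" "emb X = idm n + x" "X \<in> carrier M"
    and y: "y \<in> supported K U" "emb Y = idm n + y" "Y \<in> carrier M"
    using assms by (metis uni_emb)
  show ?thesis
  proof (rule uniI)
    show "X \<otimes>\<^bsub>M\<^esub> Y \<in> carrier M"
      by (rule emb_mult(1)[OF x(3) y(3)])
    show "emb (X \<otimes>\<^bsub>M\<^esub> Y) = idm n + (x + y + mm n x y)"
      unfolding emb_mult(2)[OF x(3) y(3)] x(2) y(2)
      by (rule mm_idm_add) (use x(1) y(1) U_N2(1) supported_mono in blast)+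
    show "x + y + mm n x y \<in> supported K U"
      using x(1) y(1) by (intro supported_add mm_U(1))
  qed
qed

text \<open>Descending induction on the level: the rows of the last block of \<open>d\<close> vanish first.\<close>

lemma uni_left_cancel:
  assumes x: "x \<in> supported K U" and d: "d \<in> supported K N2" and eq: "mm n (idm n + x) d = 0"
  shows "d = 0"
proof -
  have rec: "d (i, j) = - (\<Sum>k<n. x (i, k) * d (k, j))" for i j
  proof -
    have "d + mm n x d = 0"
      using eq unfolding mm_add_left mm_idm'(1)[OF d] .
    then have "(d + mm n x d) (i, j) = 0 (i, j)"
      by (rule fun_cong)
    then have "d (i, j) + (\<Sum>k<n. x (i, k) * d (k, j)) = 0"
      by (simp add: mm_def)
    then show ?thesis
      by (simp only: eq_neg_iff_add_eq_0)
  qed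
  have "d (i, j) = 0" for i j
  proof (induction "4 - l i" arbitrary: i rule: less_induct)
    case less
    have "x (i, k) * d (k, j) = 0" if "k < n" for k
    proof (cases "(i, k) \<in> U")
      case True
      then have "4 - l k < 4 - l i"
        using l_bound[of k] by (auto simp: U_def)
      then show ?thesis
        using less by simp
    next
      case False
      then show ?thesis
        using supported_zero[OF x] by simp
    qed
    then show ?case
      by (subst rec) simp
  qed
  then show ?thesis
    by (auto simp: fun_eq_iff)
qed

text \<open>Left multiplication by \<open>X\<close> is an injective self-map of the finite set
  \<open>uni\<close>, hence surjective and hits the identity. No formula for the inverse is
  needed.\<close>

lemma uni_right_inverse:
  assumes X: "X \<in> uni"
  shows "\<exists>Y\<in>uni. X \<otimes>\<^bsub>M\<^esub> Y = \<one>\<^bsub>M\<^esub>"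
proof -
  obtain x where x: "x \<in> supported K U" "emb X = idm n + x" "X \<in> carrier M"
    using X by (rule uni_emb)
  have "inj_on (\<lambda>Y. X \<otimes>\<^bsub>M\<^esub> Y) uni"
  proof (rule inj_onI)
    fix Y Z assume "Y \<in> uni" "Z \<in> uni" and eq: "X \<otimes>\<^bsub>M\<^esub> Y = X \<otimes>\<^bsub>M\<^esub> Z"
    then have YZ: "Y \<in> carrier M" "Z \<in> carrier M"
      by (auto simp: uni_def)
    have "mm n (emb X) (emb Y) = mm n (emb X) (emb Z)"
      using arg_cong[OF eq, of emb] by (simp only: emb_mult(2)[OF x(3)] YZ)
    then have "mm n (emb X) (emb Y) - mm n (emb X) (emb Z) = 0"
      by (simp only: right_minus_eq)
    then have z: "mm n (idm n + x) (emb Y - emb Z) = 0"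
      by (simp only: x(2) mm_diff_right)
    have "emb Y - emb Z = 0"
      by (rule uni_left_cancel[OF x(1) supported_diff[OF emb_supported[OF YZ(1)] emb_supported[OF YZ(2)]] z])
    then have "emb Y = emb Z"
      by simp
    then show "Y = Z"
      using emb_inj[OF YZ] by simp
  qed
  moreover have "(\<lambda>Y. X \<otimes>\<^bsub>M\<^esub> Y) ` uni \<subseteq> uni"
    using uni_mult[OF X] by blast
  ultimately have "(\<lambda>Y. X \<otimes>\<^bsub>M\<^esub> Y) ` uni = uni"
    using finite_uni by (intro endo_inj_surj) auto
  moreover have "\<one>\<^bsub>M\<^esub> \<in> uni"
    using emb_one by (simp add: uni_def)
  ultimately show ?thesis
    by (metis (no_types, lifting) imageE)
qed

lemma uni_inverse:
  assumes X: "X \<in> uni"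
  obtains Y where "Y \<in> uni" "X \<otimes>\<^bsub>M\<^esub> Y = \<one>\<^bsub>M\<^esub>" "Y \<otimes>\<^bsub>M\<^esub> X = \<one>\<^bsub>M\<^esub>"
proof -
  interpret M: monoid M
    by (rule monoid_M)
  obtain Y where Y: "Y \<in> uni" "X \<otimes>\<^bsub>M\<^esub> Y = \<one>\<^bsub>M\<^esub>"
    using uni_right_inverse[OF X] by blast
  obtain Z where Z: "Z \<in> uni" "Y \<otimes>\<^bsub>M\<^esub> Z = \<one>\<^bsub>M\<^esub>"
    using uni_right_inverse[OF Y(1)] by blast
  have c: "X \<in> carrier M" "Y \<in> carrier M" "Z \<in> carrier M"
    using X Y Z by (auto simp: uni_def)
  have "X = X \<otimes>\<^bsub>M\<^esub> (Y \<otimes>\<^bsub>M\<^esub> Z)"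
    using c Z by simp
  also have "\<dots> = (X \<otimes>\<^bsub>M\<^esub> Y) \<otimes>\<^bsub>M\<^esub> Z"
    using c by (simp only: M.m_assoc)
  also have "\<dots> = Z"
    unfolding Y(2) using c by simp
  finally have "Y \<otimes>\<^bsub>M\<^esub> X = \<one>\<^bsub>M\<^esub>"
    using Z by simp
  then show ?thesis
    using that Y by blast
qed

lemma mm_of_mult_one:
  assumes "X \<in> carrier M" "Y \<in> carrier M" "X \<otimes>\<^bsub>M\<^esub> Y = \<one>\<^bsub>M\<^esub>"
  shows "mm n (emb X) (emb Y) = idm n"
  using arg_cong[OF assms(3), of emb] unfolding emb_mult(2)[OF assms(1,2)] emb_one(2) .

lemma uni_subset_P: "uni \<subseteq> carrier P"
proof
  fix X assume X: "X \<in> uni"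
  obtain Y where Y: "Y \<in> uni" "X \<otimes>\<^bsub>M\<^esub> Y = \<one>\<^bsub>M\<^esub>" "Y \<otimes>\<^bsub>M\<^esub> X = \<one>\<^bsub>M\<^esub>"
    using X by (rule uni_inverse)
  have c: "X \<in> carrier M" "Y \<in> carrier M"
    using X Y by (auto simp: uni_def)
  have "emb X \<in> supported K block_upper" "emb Y \<in> supported K block_upper"
    using X Y(1) by (blast elim: uni_emb)+
  then show "X \<in> carrier P"
    using carrier_P_intro[OF c] mm_of_mult_one[OF c Y(2)] mm_of_mult_one[OF c(2,1) Y(3)] by blast
qed

lemma subgroup_uni: "subgroup uni P"
proof -
  interpret P: group P
    by (rule group_P)
  show ?thesis
  proof (rule P.subgroupI)
    show "uni \<subseteq> carrier P"
      by (rule uni_subset_P)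
    have "\<one>\<^bsub>M\<^esub> \<in> uni"
      using emb_one by (simp add: uni_def)
    then show "uni \<noteq> {}"
      by blast
  next
    fix X assume X: "X \<in> uni"
    obtain Y where Y: "Y \<in> uni" "X \<otimes>\<^bsub>M\<^esub> Y = \<one>\<^bsub>M\<^esub>" "Y \<otimes>\<^bsub>M\<^esub> X = \<one>\<^bsub>M\<^esub>"
      using X by (rule uni_inverse)
    have "inv\<^bsub>P\<^esub> X = Y"
      using X Y uni_subset_P by (intro P.inv_equality) (auto simp: P_simps)
    then show "inv\<^bsub>P\<^esub> X \<in> uni"
      using Y by simp
  next
    fix X Y assume "X \<in> uni" "Y \<in> uni"
    then show "X \<otimes>\<^bsub>P\<^esub> Y \<in> uni"
      using uni_mult by (simp add: P_simps)
  qed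
qed

text \<open>Conjugating the identity plus \<open>x\<close> gives the identity plus the conjugate of
  \<open>x\<close>, and strictly block upper triangular matrices are stable under multiplication by
  block upper triangular ones.\<close>

lemma normal_uni: "uni \<lhd> P"
proof -
  interpret P: group P
    by (rule group_P)
  have "g \<otimes>\<^bsub>P\<^esub> X \<otimes>\<^bsub>P\<^esub> inv\<^bsub>P\<^esub> g \<in> uni" if g: "g \<in> carrier P" and X: "X \<in> uni" for g X
  proof -
    let ?h = "inv\<^bsub>P\<^esub> g"
    have h: "?h \<in> carrier P"
      using g by (rule P.inv_closed)
    have gM: "g \<in> carrier M" "emb g \<in> supported K block_upper"
      and hM: "?h \<in> carrier M" "emb ?h \<in> supported K block_upper"
      using carrier_P_emb[OF g] carrier_P_emb[OF h] by auto
    obtain x where x: "x \<in> supported K U" "emb X = idm n + x" "X \<in> carrier M"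
      using X by (rule uni_emb)
    have "g \<otimes>\<^bsub>M\<^esub> ?h = \<one>\<^bsub>M\<^esub>"
      using P.r_inv[OF g] by (simp add: P_simps)
    then have gh: "mm n (emb g) (emb ?h) = idm n"
      by (rule mm_of_mult_one[OF gM(1) hM(1)])
    show ?thesis
      unfolding P_simps
    proof (rule uniI)
      show "g \<otimes>\<^bsub>M\<^esub> X \<otimes>\<^bsub>M\<^esub> ?h \<in> carrier M"
        by (intro emb_mult(1) gM hM x)
      show "emb (g \<otimes>\<^bsub>M\<^esub> X \<otimes>\<^bsub>M\<^esub> ?h) = idm n + mm n (mm n (emb g) x) (emb ?h)"
        unfolding emb_mult(2)[OF emb_mult(1)[OF gM(1) x(3)] hM(1)] emb_mult(2)[OF gM(1) x(3)] x(2)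
          mm_add_right mm_add_left mm_idm'(2)[OF emb_supported[OF gM(1)]] gh ..
      show "mm n (mm n (emb g) x) (emb ?h) \<in> supported K U"
        by (intro mm_U(2)[OF mm_U(3)] gM hM x)
    qed
  qed
  then show ?thesis
    unfolding P.normal_inv_iff using subgroup_uni by blast
qed

section \<open>Normal p-subgroups act trivially on the diagonal blocks\<close>

definition block :: "nat \<Rightarrow> nat set" where
  "block c = {i. i < n \<and> l i = c}"

definition block_act :: "nat \<Rightarrow> 'b mat \<Rightarrow> (nat \<Rightarrow> 'a) \<Rightarrow> nat \<Rightarrow> 'a" where
  "block_act c g v = (\<lambda>i. if i \<in> block c then \<Sum>j\<in>block c. emb g (i, j) * v j else 0)"

lemma finite_block: "finite (block c)"
  by (simp add: block_def)

lemma block_act_supported: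
  assumes "g \<in> carrier M" "v \<in> supported K (block c)"
  shows "block_act c g v \<in> supported K (block c)"
  using supported_K[OF assms(2)] supported_K[OF emb_supported[OF assms(1)]]
  by (auto simp: supported_def block_act_def intro!: closed_K)

lemma block_act_one:
  assumes "v \<in> supported K (block c)"
  shows "block_act c \<one>\<^bsub>M\<^esub> v = v"
proof
  fix i
  have "(\<Sum>j\<in>block c. idm n (i, j) * v j) = (\<Sum>j\<in>block c. if j = i then v i else 0)" if "i \<in> block c"
    using supported_K[OF assms] that by (intro sum.cong refl) (auto simp: idm_def block_def)
  then show "block_act c \<one>\<^bsub>M\<^esub> v i = v i"
    using finite_block supported_zero[OF assms, of i] by (simp add: block_act_def emb_one)
qed

text \<open>Passing to a diagonal block is multiplicative for block upper triangular matrices: an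
  intermediate index of another level makes one of the two factors vanish.\<close>

lemma block_act_mult:
  assumes g: "g \<in> carrier P" and h: "h \<in> carrier P"
  shows "block_act c (g \<otimes>\<^bsub>M\<^esub> h) v = block_act c g (block_act c h v)"
proof
  fix i
  have gM: "g \<in> carrier M" "emb g \<in> supported K block_upper"
    and hM: "h \<in> carrier M" "emb h \<in> supported K block_upper"
    using carrier_P_emb[OF g] carrier_P_emb[OF h] by auto
  show "block_act c (g \<otimes>\<^bsub>M\<^esub> h) v i = block_act c g (block_act c h v) i"
  proof (cases "i \<in> block c")
    case i: True
    have in_block: "(\<Sum>k<n. emb g (i, k) * emb h (k, j)) = (\<Sum>k\<in>block c. emb g (i, k) * emb h (k, j))"
      if j: "j \<in> block c" for j
    proof (rule sum.mono_neutral_right)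
      show "\<forall>k\<in>{..<n} - block c. emb g (i, k) * emb h (k, j) = 0"
      proof
        fix k assume k: "k \<in> {..<n} - block c"
        then have "(i, k) \<notin> block_upper \<or> (k, j) \<notin> block_upper"
          using i j by (auto simp: block_upper_def block_def)
        then show "emb g (i, k) * emb h (k, j) = 0"
          using supported_zero[OF gM(2), of "(i, k)"] supported_zero[OF hM(2), of "(k, j)"] by auto
      qed
    qed (auto simp: block_def)
    have "(\<Sum>j\<in>block c. (\<Sum>k\<in>block c. emb g (i, k) * emb h (k, j)) * v j) =
        (\<Sum>j\<in>block c. \<Sum>k\<in>block c. emb g (i, k) * (emb h (k, j) * v j))"
      by (simp add: sum_distrib_right mult.assoc)
    also have "\<dots> = (\<Sum>k\<in>block c. \<Sum>j\<in>block c. emb g (i, k) * (emb h (k, j) * v j))"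
      by (rule sum.swap)
    finally show ?thesis
      using i in_block by (simp add: block_act_def emb_mult(2)[OF gM(1) hM(1)] mm_def sum_distrib_left)
  next
    case False
    then show ?thesis
      by (simp add: block_act_def)
  qed
qed

text \<open>Two indices of one block have the same level, so the elementary matrix and its inverse
  are both block upper triangular.\<close>

lemma transvection:
  assumes ij: "i \<in> block c" "j \<in> block c" "i \<noteq> j" and a: "a \<in> K"
  obtains s where "s \<in> carrier P"
    "\<And>v. v \<in> supported K (block c) \<Longrightarrow> block_act c s v = (\<lambda>k. v k + (if k = i then a * v j else 0))"
proof -
  define u where "u = (\<lambda>k. if k = j then a else 0)"
  let ?S = "col_elem n i u" and ?T = "col_elem n i (- u)"
  have i: "i < n" "j < n" "l i = l j"
    using ij by (auto simp: block_def)
  have u: "u \<in> supported K {..<n}" "u i = 0" "- u \<in> supported K {..<n}" "(- u) i = 0"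
    using i a ij(3) by (auto simp: u_def supported_def intro: closed_K)
  have up: "?S \<in> supported K block_upper" "?T \<in> supported K block_upper"
    using a i by (auto simp: u_def supported_def col_elem_def block_upper_def intro: closed_K)
  have ST: "mm n ?S ?T = idm n"
    by (rule col_elem_inverse[OF i(1) u(1,2)])
  have TS: "mm n ?T ?S = idm n"
    using col_elem_inverse[OF i(1) u(3,4)] by (simp only: group_add_class.minus_minus)
  have pS: "pull ?S \<in> carrier M" "emb (pull ?S) = ?S" and pT: "pull ?T \<in> carrier M" "emb (pull ?T) = ?T"
    using pull[OF supported_mono[OF up(1) U_N2(3)]] pull[OF supported_mono[OF up(2) U_N2(3)]] by blast+
  show thesis
  proof
    show "pull ?S \<in> carrier P"
      by (rule carrier_P_intro[OF pS(1) pT(1)]) (simp_all only: pS pT ST TS up)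
    fix v assume v: "v \<in> supported K (block c)"
    show "block_act c (pull ?S) v = (\<lambda>k. v k + (if k = i then a * v j else 0))"
    proof
      fix k
      have "(\<Sum>m\<in>block c. ?S (k, m) * v m) =
          (\<Sum>m\<in>block c. (if m = k then v k else 0) + (if m = j then (if k = i then a * v j else 0) else 0))"
        if "k \<in> block c"
        using that ij supported_K[OF v] by (intro sum.cong refl) (auto simp: u_def col_elem_def block_def)
      then show "block_act c (pull ?S) v k = v k + (if k = i then a * v j else 0)"
        using finite_block ij supported_zero[OF v, of k] by (auto simp: block_act_def pS sum.distrib)
    qed
  qed
qed

text \<open>
  A normal \<open>p\<close>-subgroup acts on the space of a diagonal block with a nonzero fixed vector. The fixed space
  is stable under the transvections of the block, hence it is the whole space.
\<close>

lemma normal_p_subgroup_block: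
  assumes N: "N \<lhd> P" and card_N: "card N = p ^ k" and p: "prime p" and q: "card K = p ^ r" "1 \<le> r"
    and g: "g \<in> N" and ij: "i \<in> block c" "j \<in> block c"
  shows "emb g (i, j) = (if i = j then e else 0)"
proof -
  interpret P: group P
    by (rule group_P)
  interpret N: normal N P
    by (rule N)
  let ?E = "supported K (block c)"
  have NP: "N \<subseteq> carrier P"
    by (rule N.subset)
  have PM: "h \<in> carrier M" if "h \<in> carrier P" for h
    using carrier_P_emb[OF that] by simp
  have finE: "finite ?E"
    by (rule finite_supported[OF finite_block])
  define W where "W = {v \<in> ?E. \<forall>g\<in>N. block_act c g v = v}"
  interpret A: group_action "P\<lparr>carrier := N\<rparr>" ?E "\<lambda>g. \<lambda>v\<in>?E. block_act c g v"
  proof (rule group_action_restrict)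
    show "group (P\<lparr>carrier := N\<rparr>)"
      by (rule N.subgroup_is_group[OF group_P])
  qed (use NP PM in \<open>auto simp: P_simps block_act_supported block_act_one block_act_mult subset_iff\<close>)
  have "Coset.order (P\<lparr>carrier := N\<rparr>) = p ^ k"
    using card_N by (simp add: Coset.order_def)
  from A.dvd_card_nonfixed[OF p this finE]
  have "p dvd card (?E - W)"
  proof -
    have "{x \<in> ?E. \<forall>g\<in>carrier (P\<lparr>carrier := N\<rparr>). (\<lambda>v\<in>?E. block_act c g v) x = x} = W"
      by (auto simp: W_def)
    with \<open>p dvd _\<close> show ?thesis
      by simp
  qed
  moreover have "p dvd card ?E"
  proof -
    have "card (block c) \<noteq> 0"
      using ij finite_block by auto
    then have "p dvd p ^ (r * card (block c))"
      using q(2) by (intro dvd_power) simp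
    then show ?thesis
      by (simp add: card_supported_power finite_block q(1) power_mult)
  qed
  moreover have WE: "W \<subseteq> ?E"
    by (auto simp: W_def)
  then have "card ?E = card (?E - W) + card W"
    using finE by (metis card_Diff_subset card_mono finite_subset le_add_diff_inverse2)
  ultimately have "p dvd card W"
    by (simp add: dvd_add_right_iff)
  have finW: "finite W"
    using WE finE by (rule finite_subset)
  have "0 \<in> W"
    by (auto simp: W_def block_act_def fun_eq_iff)
  have "W \<noteq> {0}"
  proof
    assume "W = {0}"
    then have "p dvd 1"
      using \<open>p dvd card W\<close> by simp
    then show False
      using p by (simp add: prime_nat_iff)
  qed
  then obtain v where v: "v \<in> W" "v \<noteq> 0"
    using \<open>0 \<in> W\<close> by blast
  \<comment> \<open>Normality of \<open>N\<close> enters here: \<open>h s = s (s^-1 h s)\<close>,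
    and the bracket again lies in \<open>N\<close> and fixes \<open>w\<close>.\<close>
  have W_act: "block_act c s w \<in> W" if s: "s \<in> carrier P" and w: "w \<in> W" for s w
  proof -
    have wE: "w \<in> ?E"
      using w WE by blast
    have "block_act c h (block_act c s w) = block_act c s w" if h: "h \<in> N" for h
    proof -
      have hP: "h \<in> carrier P"
        using h NP by blast
      have c: "inv\<^bsub>P\<^esub> s \<otimes>\<^bsub>P\<^esub> h \<otimes>\<^bsub>P\<^esub> s \<in> N"
        using s h by (rule N.inv_op_closed1)
      have "block_act c h (block_act c s w) = block_act c (h \<otimes>\<^bsub>P\<^esub> s) w"
        using block_act_mult[OF hP s] by (simp add: P_simps)
      also have "h \<otimes>\<^bsub>P\<^esub> s = s \<otimes>\<^bsub>P\<^esub> (inv\<^bsub>P\<^esub> s \<otimes>\<^bsub>P\<^esub> h \<otimes>\<^bsub>P\<^esub> s)"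
        using s hP by (simp add: P.m_assoc[symmetric])
      also have "block_act c \<dots> w = block_act c s (block_act c (inv\<^bsub>P\<^esub> s \<otimes>\<^bsub>P\<^esub> h \<otimes>\<^bsub>P\<^esub> s) w)"
        using block_act_mult[OF s subsetD[OF NP c]] by (simp add: P_simps)
      also have "block_act c (inv\<^bsub>P\<^esub> s \<otimes>\<^bsub>P\<^esub> h \<otimes>\<^bsub>P\<^esub> s) w = w"
        using w c by (simp add: W_def)
      finally show ?thesis .
    qed
    then show ?thesis
      using block_act_supported[OF PM[OF s] wE] by (simp add: W_def)
  qed
  have W_diff: "w - w' \<in> W" if "w \<in> W" "w' \<in> W" for w w'
  proof -
    have "block_act c h (w - w') = block_act c h w - block_act c h w'" for h
      by (auto simp: block_act_def fun_eq_iff algebra_simps sum_subtractf)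
    then show ?thesis
      using that supported_diff[of w "block c" w'] by (simp add: W_def)
  qed
  let ?\<delta> = "\<lambda>i k. if k = i then e else 0"
  \<comment> \<open>A transvection moves \<open>w\<close> by a multiple of a basis vector;
    \<open>a\<close> is chosen so that the difference, which stays in \<open>W\<close>, is the basis
    vector itself.\<close>
  have step: "?\<delta> i \<in> W" if w: "w \<in> W" "a \<in> K" "a * w j = e" and ij: "i \<in> block c" "j \<in> block c" "i \<noteq> j" for w a i j
  proof -
    obtain s where s: "s \<in> carrier P"
      "\<And>v. v \<in> supported K (block c) \<Longrightarrow> block_act c s v = (\<lambda>k. v k + (if k = i then a * v j else 0))"
      using transvection[OF ij w(2)] by blast
    have "block_act c s w - w = ?\<delta> i"
      using s(2)[of w] w(1,3) WE by (auto simp: fun_eq_iff subset_iff)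
    then show ?thesis
      using W_diff[OF W_act[OF s(1) w(1)] w(1)] by simp
  qed
  have vE: "v \<in> ?E"
    using v WE by blast
  obtain m where m: "v m \<noteq> 0"
    using v(2) by (auto simp: fun_eq_iff)
  then have m_block: "m \<in> block c"
    using supported_zero[OF vE] by blast
  obtain a where a: "a \<in> K" "v m * a = e"
    using inverse_ex[OF supported_K[OF vE] m] by blast
  have other: "?\<delta> i \<in> W" if "i \<in> block c" "i \<noteq> m" for i
    by (rule step[OF v(1) a(1) _ that(1) m_block that(2)]) (use a(2) in \<open>simp add: mult.commute\<close>)
  have "?\<delta> m \<in> W"
  proof (cases "block c = {m}")
    \<comment> \<open>A block of size one has no transvections. There the fixed vector
      \<open>v\<close> itself forces the diagonal entry to be \<open>e\<close>. In larger blocks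
      another basis vector leads back to the one at \<open>m\<close>.\<close>
    case True
    have "block_act c h (?\<delta> m) = ?\<delta> m" if h: "h \<in> N" for h
    proof -
      have hK: "emb h x \<in> K" for x
        using supported_K[OF emb_supported[OF PM[OF subsetD[OF NP h]]]] .
      have "block_act c h v = v"
        using v h by (simp add: W_def)
      then have "block_act c h v m = v m"
        by (rule fun_cong)
      then have "emb h (m, m) * v m = v m"
        using True by (simp add: block_act_def)
      then have "emb h (m, m) * v m * a = v m * a"
        by simp
      then have "emb h (m, m) = e"
        unfolding mult.assoc a(2) using hK by simp
      then show ?thesis
        using True by (auto simp: block_act_def fun_eq_iff)
    qed
    then show ?thesis
      using supported_delta[OF m_block] by (simp add: W_def)
  next
    case False
    then obtain i where i: "i \<in> block c" "i \<noteq> m"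
      using m_block by blast
    show ?thesis
      by (rule step[OF other[OF i] unit_K _ m_block i(1)]) (use i in auto)
  qed
  then have "?\<delta> j \<in> W"
    using other ij by (cases "j = m") auto
  then have "block_act c g (?\<delta> j) = ?\<delta> j"
    using g by (simp add: W_def)
  then have "block_act c g (?\<delta> j) i = ?\<delta> j i"
    by (rule fun_cong)
  then have "(\<Sum>k\<in>block c. emb g (i, k) * ?\<delta> j k) = ?\<delta> j i"
    unfolding block_act_def if_P[OF ij(1)] .
  moreover have "(\<Sum>k\<in>block c. emb g (i, k) * ?\<delta> j k) = (\<Sum>k\<in>block c. if k = j then emb g (i, j) else 0)"
    using supported_K[OF emb_supported[OF PM[OF subsetD[OF NP g]]]] by (intro sum.cong refl) auto
  ultimately show ?thesis
    using ij finite_block by simp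
qed

lemma normal_p_subgroup_subset_uni:
  assumes N: "N \<lhd> P" and card_N: "card N = p ^ k" and p: "prime p" and q: "card K = p ^ r" "1 \<le> r"
  shows "N \<subseteq> uni"
proof
  fix g assume g: "g \<in> N"
  have "N \<subseteq> carrier P"
    using normal_imp_subgroup[OF N] by (rule subgroup.subset)
  then have gM: "g \<in> carrier M" "emb g \<in> supported K block_upper"
    using g carrier_P_emb by auto
  have "(emb g - idm n) (i, j) = 0" if ij: "(i, j) \<notin> U" for i j
  proof (cases "(i, j) \<in> block_upper")
    case True
    then have "i \<in> block (l i)" "j \<in> block (l i)"
      using ij by (auto simp: block_upper_def U_def block_def)
    then show ?thesis
      using normal_p_subgroup_block[OF N card_N p q g, of i "l i" j]
      by (auto simp: idm_def block_def)
  next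
    case False
    then show ?thesis
      using supported_zero[OF gM(2)] supported_zero[OF idm_block_upper] by simp
  qed
  moreover have "(emb g - idm n) x \<in> K" for x
    using supported_K[OF gM(2)] supported_K[OF idm_block_upper] by (simp add: closed_K)
  ultimately show "g \<in> uni"
    using gM(1) by (auto simp: uni_def supported_def)
qed

text \<open>The order of \<open>uni\<close> is a power of \<open>card K\<close>, hence of
  \<open>p\<close>, and every normal \<open>p\<close>-subgroup has identity diagonal blocks, so
  \<open>uni\<close> is the greatest one.\<close>

lemma p_core_eq:
  assumes p: "prime p" and q: "card K = p ^ r" "1 \<le> r"
  shows "p_core p P = uni"
  unfolding p_core_def
proof (rule Greatest_equality)
  have "card uni = p ^ (r * card U)"
    by (simp add: card_uni q power_mult)
  then show "uni \<lhd> P \<and> (\<exists>k. card uni = p ^ k)"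
    using normal_uni by blast
  show "N \<le> uni" if "N \<lhd> P \<and> (\<exists>k. card N = p ^ k)" for N
    using that normal_p_subgroup_subset_uni[OF _ _ p q] by blast
qed

text \<open>In the product of two matrices of the form identity plus strictly triangular, every term
  except the product of the triangular parts is symmetric.\<close>

lemma uni_commute_iff:
  assumes "X \<in> uni" "Y \<in> uni"
  shows "X \<otimes>\<^bsub>M\<^esub> Y = Y \<otimes>\<^bsub>M\<^esub> X \<longleftrightarrow>
    mm n (emb X - idm n) (emb Y - idm n) = mm n (emb Y - idm n) (emb X - idm n)"
proof -
  obtain x y where x: "x \<in> supported K U" "emb X = idm n + x" "X \<in> carrier M"
    and y: "y \<in> supported K U" "emb Y = idm n + y" "Y \<in> carrier M"
    using assms by (metis uni_emb)
  have xN: "x \<in> supported K N2" and yN: "y \<in> supported K N2"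
    using supported_mono[OF x(1) U_N2(1)] supported_mono[OF y(1) U_N2(1)] .
  have "X \<otimes>\<^bsub>M\<^esub> Y = Y \<otimes>\<^bsub>M\<^esub> X \<longleftrightarrow> emb (X \<otimes>\<^bsub>M\<^esub> Y) = emb (Y \<otimes>\<^bsub>M\<^esub> X)"
    using emb_inj[OF emb_mult(1)[OF x(3) y(3)] emb_mult(1)[OF y(3) x(3)]] by simp
  also have "\<dots> \<longleftrightarrow> mm n x y = mm n y x"
    unfolding emb_mult(2)[OF x(3) y(3)] emb_mult(2)[OF y(3) x(3)] x(2) y(2)
      mm_idm_add[OF xN yN] mm_idm_add[OF yN xN] by (simp add: add.commute[of y x])
  finally show ?thesis
    unfolding x(2) y(2) by simp
qed

text \<open>Burnside's lemma for conjugation, where the fixed points of \<open>g\<close> form its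
  centralizer. Subtracting the identity then turns commuting pairs of the group into commuting pairs
  of the nilpotent algebra.\<close>

lemma card_conj_classes:
  assumes p: "prime p" and q: "card K = p ^ r" "1 \<le> r"
  shows "conj_class_number (unipotent_radical p F n ds) * card K ^ card U =
    card {(x, y). x \<in> supported K U \<and> y \<in> supported K U \<and> mm n x y = mm n y x}"
proof -
  define G where "G = P\<lparr>carrier := uni\<rparr>"
  interpret P: group P
    by (rule group_P)
  interpret G: group G
    unfolding G_def by (rule subgroup.subgroup_is_group[OF subgroup_uni group_P])
  have G_simps: "carrier G = uni" "monoid.mult G = monoid.mult M"
    by (simp_all add: G_def P_simps)
  have G: "unipotent_radical p F n ds = G"
    by (simp add: unipotent_radical_def p_core_eq[OF p q] G_def)
  let ?\<phi> = "\<lambda>g. \<lambda>h\<in>carrier G. g \<otimes>\<^bsub>G\<^esub> h \<otimes>\<^bsub>G\<^esub> inv\<^bsub>G\<^esub> g"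
  interpret A: group_action G "carrier G" ?\<phi>
    by (rule G.action_by_conjugation)
  \<comment> \<open>\<open>conj_class_number\<close> uses the unrestricted conjugation map, while
    \<open>burnside\<close> concerns the restricted one; both have the same orbits on the
    carrier.\<close>
  have "conj_class_number G = card (orbits G (carrier G) ?\<phi>)"
  proof -
    have "orbit G (\<lambda>g x. g \<otimes>\<^bsub>G\<^esub> x \<otimes>\<^bsub>G\<^esub> inv\<^bsub>G\<^esub> g) x = orbit G ?\<phi> x" if "x \<in> carrier G" for x
      using that by (simp add: orbit_def)
    then have "orbits G (carrier G) (\<lambda>g x. g \<otimes>\<^bsub>G\<^esub> x \<otimes>\<^bsub>G\<^esub> inv\<^bsub>G\<^esub> g) = orbits G (carrier G) ?\<phi>"
      unfolding orbits_def by (metis (no_types, lifting))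
    then show ?thesis
      by (simp add: conj_class_number_def)
  qed
  moreover have "Coset.order G = card K ^ card U"
    by (simp add: Coset.order_def G_simps card_uni)
  moreover have "card (orbits G (carrier G) ?\<phi>) * Coset.order G = (\<Sum>g\<in>carrier G. card (invariants (carrier G) ?\<phi> g))"
    by (rule A.burnside) (simp_all add: G_simps finite_uni)
  moreover have "invariants (carrier G) ?\<phi> g = {h \<in> uni. g \<otimes>\<^bsub>M\<^esub> h = h \<otimes>\<^bsub>M\<^esub> g}" if g: "g \<in> uni" for g
  proof -
    have "?\<phi> g h = h \<longleftrightarrow> g \<otimes>\<^bsub>M\<^esub> h = h \<otimes>\<^bsub>M\<^esub> g" if h: "h \<in> uni" for h
    proof -
      have c: "g \<in> carrier G" "h \<in> carrier G"
        using g h by (simp_all add: G_simps)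
      have "g \<otimes>\<^bsub>G\<^esub> h \<otimes>\<^bsub>G\<^esub> inv\<^bsub>G\<^esub> g = h \<longleftrightarrow> g \<otimes>\<^bsub>G\<^esub> h = h \<otimes>\<^bsub>G\<^esub> g"
        using c G.inv_solve_right'[of h "g \<otimes>\<^bsub>G\<^esub> h" g] by auto
      then show ?thesis
        using c by (simp add: G_simps(2))
    qed
    then show ?thesis
      by (auto simp: invariants_def G_simps(1))
  qed
  ultimately have "conj_class_number (unipotent_radical p F n ds) * card K ^ card U =
      (\<Sum>g\<in>uni. card {h \<in> uni. g \<otimes>\<^bsub>M\<^esub> h = h \<otimes>\<^bsub>M\<^esub> g})"
    unfolding G G_simps(1) by simp
  also have "\<dots> = card (Sigma uni (\<lambda>g. {h \<in> uni. g \<otimes>\<^bsub>M\<^esub> h = h \<otimes>\<^bsub>M\<^esub> g}))"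
    using finite_uni by (intro card_SigmaI[symmetric]) auto
  also have "\<dots> = card {(x, y). x \<in> supported K U \<and> y \<in> supported K U \<and> mm n x y = mm n y x}"
  proof (rule bij_betw_same_card)
    let ?t = "\<lambda>X. emb X - idm n"
    have t: "inj_on ?t uni" "?t ` uni = supported K U"
      using bij_uni by (auto simp: bij_betw_def)
    show "bij_betw (\<lambda>(X, Y). (?t X, ?t Y)) (Sigma uni (\<lambda>g. {h \<in> uni. g \<otimes>\<^bsub>M\<^esub> h = h \<otimes>\<^bsub>M\<^esub> g}))
      {(x, y). x \<in> supported K U \<and> y \<in> supported K U \<and> mm n x y = mm n y x}"
      unfolding bij_betw_def
    proof
      show "inj_on (\<lambda>(X, Y). (?t X, ?t Y)) (Sigma uni (\<lambda>g. {h \<in> uni. g \<otimes>\<^bsub>M\<^esub> h = h \<otimes>\<^bsub>M\<^esub> g}))"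
      proof (rule inj_onI)
        fix a b assume ab: "a \<in> Sigma uni (\<lambda>g. {h \<in> uni. g \<otimes>\<^bsub>M\<^esub> h = h \<otimes>\<^bsub>M\<^esub> g})"
          "b \<in> Sigma uni (\<lambda>g. {h \<in> uni. g \<otimes>\<^bsub>M\<^esub> h = h \<otimes>\<^bsub>M\<^esub> g})"
          "(\<lambda>(X, Y). (?t X, ?t Y)) a = (\<lambda>(X, Y). (?t X, ?t Y)) b"
        then have "?t (fst a) = ?t (fst b)" "?t (snd a) = ?t (snd b)"
          by (simp_all add: case_prod_unfold)
        moreover have "fst a \<in> uni" "snd a \<in> uni" "fst b \<in> uni" "snd b \<in> uni"
          using ab(1,2) by auto
        ultimately have "fst a = fst b" "snd a = snd b"
          using inj_onD[OF t(1)] by blast+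
        then show "a = b"
          by (rule prod_eqI)
      qed
      show "(\<lambda>(X, Y). (?t X, ?t Y)) ` Sigma uni (\<lambda>g. {h \<in> uni. g \<otimes>\<^bsub>M\<^esub> h = h \<otimes>\<^bsub>M\<^esub> g}) =
        {(x, y). x \<in> supported K U \<and> y \<in> supported K U \<and> mm n x y = mm n y x}"
      proof (intro equalityI subsetI)
        fix z assume "z \<in> (\<lambda>(X, Y). (?t X, ?t Y)) ` Sigma uni (\<lambda>g. {h \<in> uni. g \<otimes>\<^bsub>M\<^esub> h = h \<otimes>\<^bsub>M\<^esub> g})"
        then obtain c where c: "z = (\<lambda>(X, Y). (?t X, ?t Y)) c"
          "c \<in> Sigma uni (\<lambda>g. {h \<in> uni. g \<otimes>\<^bsub>M\<^esub> h = h \<otimes>\<^bsub>M\<^esub> g})"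
          by (rule imageE)
        obtain X Y where "c = (X, Y)"
          by (cases c)
        then have XY: "X \<in> uni" "Y \<in> uni" "X \<otimes>\<^bsub>M\<^esub> Y = Y \<otimes>\<^bsub>M\<^esub> X" "z = (?t X, ?t Y)"
          using c by simp_all
        have "?t X \<in> supported K U" "?t Y \<in> supported K U"
          using imageI[OF XY(1), of ?t] imageI[OF XY(2), of ?t] unfolding t(2) by simp_all
        then show "z \<in> {(x, y). x \<in> supported K U \<and> y \<in> supported K U \<and> mm n x y = mm n y x}"
          using iffD1[OF uni_commute_iff[OF XY(1,2)] XY(3)]
          unfolding XY(4) mem_Collect_eq prod.case by (intro conjI)
      next
        fix z assume "z \<in> {(x, y). x \<in> supported K U \<and> y \<in> supported K U \<and> mm n x y = mm n y x}"
        then obtain x y where z: "z = (x, y)" "x \<in> ?t ` uni" "y \<in> ?t ` uni" "mm n x y = mm n y x"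
          unfolding t(2) by blast
        from z(2) obtain X where X: "X \<in> uni" "x = ?t X"
          by blast
        from z(3) obtain Y where Y: "Y \<in> uni" "y = ?t Y"
          by blast
        have "X \<otimes>\<^bsub>M\<^esub> Y = Y \<otimes>\<^bsub>M\<^esub> X"
          using iffD2[OF uni_commute_iff[OF X(1) Y(1)]] z(4) X(2) Y(2) by simp
        then have "(X, Y) \<in> Sigma uni (\<lambda>g. {h \<in> uni. g \<otimes>\<^bsub>M\<^esub> h = h \<otimes>\<^bsub>M\<^esub> g})"
          using X Y by simp
        then show "z \<in> (\<lambda>(X, Y). (?t X, ?t Y)) ` Sigma uni (\<lambda>g. {h \<in> uni. g \<otimes>\<^bsub>M\<^esub> h = h \<otimes>\<^bsub>M\<^esub> g})"
          unfolding z(1) X(2) Y(2) by (intro image_eqI[of _ _ "(X, Y)"]) simp_all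
      qed
    qed
  qed
  finally show ?thesis .
qed

end

section \<open>A ring containing all finite fields\<close>

text \<open>
  The product of all commutative rings of type \<open>nat ring\<close>. Each of them sits in it as the factor at
  its own index, which turns a variable field, given by a record, into a variable subset of one fixed
  type with class-based arithmetic.
\<close>

typedef ring_family = "{f :: nat ring \<Rightarrow> nat. \<forall>F. f F \<in> (if cring F then carrier F else {0})}"
proof -
  have "\<forall>F. (if cring F then \<zero>\<^bsub>F\<^esub> else 0) \<in> (if cring F then carrier F else {0 :: nat})"
    using ring.ring_simprules(2)[OF cring.axioms(1)] by auto
  then show ?thesis
    by (intro exI[of _ "\<lambda>F. if cring F then \<zero>\<^bsub>F\<^esub> else 0"]) simp
qed

lemma Rep_cring: "cring F \<Longrightarrow> Rep_ring_family x F \<in> carrier F"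
  and Rep_not_cring: "\<not> cring F \<Longrightarrow> Rep_ring_family x F = 0"
  using Rep_ring_family[of x] by (auto dest: spec[of _ F])

text \<open>The value 0 at records that are not commutative rings is the default prescribed by the
  type definition; it keeps representatives unique.\<close>

definition family :: "(nat ring \<Rightarrow> nat) \<Rightarrow> ring_family" where
  "family f = Abs_ring_family (\<lambda>F. if cring F then f F else 0)"

lemma Rep_family:
  assumes "\<And>F. cring F \<Longrightarrow> f F \<in> carrier F"
  shows "Rep_ring_family (family f) F = (if cring F then f F else 0)"
  unfolding family_def using assms by (subst Abs_ring_family_inverse) auto

lemma ring_family_eqI:
  assumes "\<And>F. cring F \<Longrightarrow> Rep_ring_family x F = Rep_ring_family y F"
  shows "x = y"
proof -
  have "Rep_ring_family x F = Rep_ring_family y F" for F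
    using assms[of F] Rep_not_cring[of F] by (cases "cring F") auto
  then show ?thesis
    by (simp add: fun_eq_iff flip: Rep_ring_family_inject)
qed

instantiation ring_family :: comm_ring
begin

definition "0 = family (\<lambda>F. \<zero>\<^bsub>F\<^esub>)"
definition "x + y = family (\<lambda>F. Rep_ring_family x F \<oplus>\<^bsub>F\<^esub> Rep_ring_family y F)"
definition "x * y = family (\<lambda>F. Rep_ring_family x F \<otimes>\<^bsub>F\<^esub> Rep_ring_family y F)"
definition "- x = family (\<lambda>F. \<ominus>\<^bsub>F\<^esub> Rep_ring_family x F)"
definition "x - y = family (\<lambda>F. Rep_ring_family x F \<ominus>\<^bsub>F\<^esub> Rep_ring_family y F)"

lemma Rep_ring_family_simps:
  assumes "cring F"
  shows "Rep_ring_family 0 F = \<zero>\<^bsub>F\<^esub>"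
    "Rep_ring_family (x + y) F = Rep_ring_family x F \<oplus>\<^bsub>F\<^esub> Rep_ring_family y F"
    "Rep_ring_family (x * y) F = Rep_ring_family x F \<otimes>\<^bsub>F\<^esub> Rep_ring_family y F"
    "Rep_ring_family (- x) F = \<ominus>\<^bsub>F\<^esub> Rep_ring_family x F"
    "Rep_ring_family (x - y) F = Rep_ring_family x F \<ominus>\<^bsub>F\<^esub> Rep_ring_family y F"
proof -
  have c: "\<zero>\<^bsub>F\<^esub> \<in> carrier F"
    "Rep_ring_family x F \<oplus>\<^bsub>F\<^esub> Rep_ring_family y F \<in> carrier F"
    "Rep_ring_family x F \<otimes>\<^bsub>F\<^esub> Rep_ring_family y F \<in> carrier F"
    "\<ominus>\<^bsub>F\<^esub> Rep_ring_family x F \<in> carrier F"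
    "Rep_ring_family x F \<ominus>\<^bsub>F\<^esub> Rep_ring_family y F \<in> carrier F" if "cring F" for F
  proof -
    interpret cring F by fact
    show "\<zero>\<^bsub>F\<^esub> \<in> carrier F"
      "Rep_ring_family x F \<oplus>\<^bsub>F\<^esub> Rep_ring_family y F \<in> carrier F"
      "Rep_ring_family x F \<otimes>\<^bsub>F\<^esub> Rep_ring_family y F \<in> carrier F"
      "\<ominus>\<^bsub>F\<^esub> Rep_ring_family x F \<in> carrier F"
      "Rep_ring_family x F \<ominus>\<^bsub>F\<^esub> Rep_ring_family y F \<in> carrier F"
      using Rep_cring[OF that] by simp_all
  qed
  show "Rep_ring_family 0 F = \<zero>\<^bsub>F\<^esub>"
    "Rep_ring_family (x + y) F = Rep_ring_family x F \<oplus>\<^bsub>F\<^esub> Rep_ring_family y F"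
    "Rep_ring_family (x * y) F = Rep_ring_family x F \<otimes>\<^bsub>F\<^esub> Rep_ring_family y F"
    "Rep_ring_family (- x) F = \<ominus>\<^bsub>F\<^esub> Rep_ring_family x F"
    "Rep_ring_family (x - y) F = Rep_ring_family x F \<ominus>\<^bsub>F\<^esub> Rep_ring_family y F"
    unfolding zero_ring_family_def plus_ring_family_def times_ring_family_def uminus_ring_family_def
      minus_ring_family_def
    by (subst Rep_family; simp add: c assms)+
qed

instance
proof
  fix x y z :: ring_family
  show "x * y * z = x * (y * z)"
  proof (rule ring_family_eqI)
    fix F :: "nat ring" assume F: "cring F"
    then interpret cring F .
    show "Rep_ring_family (x * y * z) F = Rep_ring_family (x * (y * z)) F"
      using Rep_cring[OF F] by (simp add: Rep_ring_family_simps[OF F] m_assoc)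
  qed
  show "x * y = y * x"
  proof (rule ring_family_eqI)
    fix F :: "nat ring" assume F: "cring F"
    then interpret cring F .
    show "Rep_ring_family (x * y) F = Rep_ring_family (y * x) F"
      using Rep_cring[OF F] by (simp add: Rep_ring_family_simps[OF F] m_comm)
  qed
  show "x + y + z = x + (y + z)"
  proof (rule ring_family_eqI)
    fix F :: "nat ring" assume F: "cring F"
    then interpret cring F .
    show "Rep_ring_family (x + y + z) F = Rep_ring_family (x + (y + z)) F"
      using Rep_cring[OF F] by (simp add: Rep_ring_family_simps[OF F] a_assoc)
  qed
  show "x + y = y + x"
  proof (rule ring_family_eqI)
    fix F :: "nat ring" assume F: "cring F"
    then interpret cring F .
    show "Rep_ring_family (x + y) F = Rep_ring_family (y + x) F"
      using Rep_cring[OF F] by (simp add: Rep_ring_family_simps[OF F] a_comm)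
  qed
  show "0 + x = x"
  proof (rule ring_family_eqI)
    fix F :: "nat ring" assume F: "cring F"
    then interpret cring F .
    show "Rep_ring_family (0 + x) F = Rep_ring_family x F"
      using Rep_cring[OF F] by (simp add: Rep_ring_family_simps[OF F])
  qed
  show "- x + x = 0"
  proof (rule ring_family_eqI)
    fix F :: "nat ring" assume F: "cring F"
    then interpret cring F .
    show "Rep_ring_family (- x + x) F = Rep_ring_family 0 F"
      using Rep_cring[OF F] by (simp add: Rep_ring_family_simps[OF F] l_neg)
  qed
  show "x - y = x + - y"
  proof (rule ring_family_eqI)
    fix F :: "nat ring" assume F: "cring F"
    then interpret cring F .
    show "Rep_ring_family (x - y) F = Rep_ring_family (x + - y) F"
      using Rep_cring[OF F] by (simp add: Rep_ring_family_simps[OF F] a_minus_def)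
  qed
  show "(x + y) * z = x * z + y * z"
  proof (rule ring_family_eqI)
    fix F :: "nat ring" assume F: "cring F"
    then interpret cring F .
    show "Rep_ring_family ((x + y) * z) F = Rep_ring_family (x * z + y * z) F"
      using Rep_cring[OF F] by (simp add: Rep_ring_family_simps[OF F] l_distr)
  qed
qed

end

text \<open>Inclusion of one factor into the product. It preserves sums and products but not the
  unit: the image of one is the idempotent concentrated at index \<open>F\<close>, which serves as
  \<open>e\<close>.\<close>

definition family_embedding :: "nat ring \<Rightarrow> nat \<Rightarrow> ring_family" where
  "family_embedding F a = family (\<lambda>G. if G = F then a else \<zero>\<^bsub>G\<^esub>)"

lemma Rep_family_embedding:
  assumes "cring F" "a \<in> carrier F" "cring G"
  shows "Rep_ring_family (family_embedding F a) G = (if G = F then a else \<zero>\<^bsub>G\<^esub>)"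
proof -
  have z: "\<zero>\<^bsub>H\<^esub> \<in> carrier H" if "cring H" for H :: "nat ring"
    using ring.ring_simprules(2)[OF cring.axioms(1)[OF that]] .
  show ?thesis
    unfolding family_embedding_def using assms z by (subst Rep_family) auto
qed

lemma matrix_embedding_family:
  fixes F :: "nat ring" (structure)
  assumes "field F" and fin: "finite (carrier F)"
  shows "matrix_embedding F (family_embedding F ` carrier F) (family_embedding F \<one>\<^bsub>F\<^esub>) (family_embedding F)"
proof -
  interpret field F by fact
  let ?\<phi> = "family_embedding F"
  have R: "Rep_ring_family (?\<phi> a) G = (if G = F then a else \<zero>\<^bsub>G\<^esub>)" if "a \<in> carrier F" "cring G" for a G
    using Rep_family_embedding[OF is_cring that] .
  have z: "\<zero>\<^bsub>G\<^esub> \<oplus>\<^bsub>G\<^esub> \<zero>\<^bsub>G\<^esub> = \<zero>\<^bsub>G\<^esub>" "\<zero>\<^bsub>G\<^esub> \<otimes>\<^bsub>G\<^esub> \<zero>\<^bsub>G\<^esub> = \<zero>\<^bsub>G\<^esub>" "\<zero>\<^bsub>G\<^esub> \<ominus>\<^bsub>G\<^esub> \<zero>\<^bsub>G\<^esub> = \<zero>\<^bsub>G\<^esub>"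
    if "cring G" for G :: "nat ring"
  proof -
    interpret G: cring G by fact
    show "\<zero>\<^bsub>G\<^esub> \<oplus>\<^bsub>G\<^esub> \<zero>\<^bsub>G\<^esub> = \<zero>\<^bsub>G\<^esub>" "\<zero>\<^bsub>G\<^esub> \<otimes>\<^bsub>G\<^esub> \<zero>\<^bsub>G\<^esub> = \<zero>\<^bsub>G\<^esub>" "\<zero>\<^bsub>G\<^esub> \<ominus>\<^bsub>G\<^esub> \<zero>\<^bsub>G\<^esub> = \<zero>\<^bsub>G\<^esub>"
      by (simp_all add: a_minus_def)
  qed
  have add: "?\<phi> (a \<oplus> b) = ?\<phi> a + ?\<phi> b" if "a \<in> carrier F" "b \<in> carrier F" for a b
    by (rule ring_family_eqI) (use that z in \<open>simp add: R Rep_ring_family_simps\<close>)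
  have diff: "?\<phi> (a \<ominus> b) = ?\<phi> a - ?\<phi> b" if "a \<in> carrier F" "b \<in> carrier F" for a b
    by (rule ring_family_eqI) (use that z in \<open>simp add: R Rep_ring_family_simps\<close>)
  have mult: "?\<phi> (a \<otimes> b) = ?\<phi> a * ?\<phi> b" if "a \<in> carrier F" "b \<in> carrier F" for a b
    by (rule ring_family_eqI) (use that z in \<open>simp add: R Rep_ring_family_simps\<close>)
  have inj: "a = b" if "a \<in> carrier F" "b \<in> carrier F" "?\<phi> a = ?\<phi> b" for a b
    using arg_cong[OF that(3), of "\<lambda>x. Rep_ring_family x F"] that(1,2) by (simp add: R is_cring)
  have zero: "?\<phi> \<zero> = 0"
    using add[of \<zero> \<zero>] by simp
  show ?thesis
  proof (intro matrix_embedding.intro matrix_embedding_axioms.intro)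
    show "field F"
      by fact
    show "finite_subfield (?\<phi> ` carrier F) (?\<phi> \<one>)"
    proof
      show "finite (?\<phi> ` carrier F)"
        using fin by simp
      show "x - y \<in> ?\<phi> ` carrier F" if xy: "x \<in> ?\<phi> ` carrier F" "y \<in> ?\<phi> ` carrier F" for x y
      proof -
        obtain a b where ab: "a \<in> carrier F" "b \<in> carrier F" "x = ?\<phi> a" "y = ?\<phi> b"
          using xy by blast
        have "x - y = ?\<phi> (a \<ominus> b)" "a \<ominus> b \<in> carrier F"
          using ab diff by simp_all
        then show ?thesis
          by blast
      qed
      show "x * y \<in> ?\<phi> ` carrier F" if xy: "x \<in> ?\<phi> ` carrier F" "y \<in> ?\<phi> ` carrier F" for x y
      proof -
        obtain a b where ab: "a \<in> carrier F" "b \<in> carrier F" "x = ?\<phi> a" "y = ?\<phi> b"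
          using xy by blast
        have "x * y = ?\<phi> (a \<otimes> b)" "a \<otimes> b \<in> carrier F"
          using ab mult by simp_all
        then show ?thesis
          by blast
      qed
      show "?\<phi> \<one> \<in> ?\<phi> ` carrier F"
        by simp
      show "?\<phi> \<one> \<noteq> 0"
        using inj[of \<one> \<zero>] zero by auto
      show "?\<phi> \<one> * x = x" if "x \<in> ?\<phi> ` carrier F" for x
        using that mult[of \<one>] by auto
      show "\<exists>y\<in>?\<phi> ` carrier F. x * y = ?\<phi> \<one>" if x: "x \<in> ?\<phi> ` carrier F" "x \<noteq> 0" for x
      proof -
        obtain a where a: "a \<in> carrier F" "x = ?\<phi> a"
          using x(1) by blast
        then have "a \<noteq> \<zero>"
          using x(2) zero by auto
        then have "a \<in> Units F"
          using a field_Units by simp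
        then have "inv a \<in> carrier F" "a \<otimes> inv a = \<one>"
          by simp_all
        then show ?thesis
          using mult[OF a(1)] a(2) by (metis imageI)
      qed
    qed
    show "bij_betw ?\<phi> (carrier F) (?\<phi> ` carrier F)"
      using inj by (auto simp: bij_betw_def inj_on_def)
  qed (use add mult in auto)
qed

section \<open>Integer coefficients\<close>

text \<open>The residue field on the integers from 0 to \<open>p - 1\<close>, transported along
  \<open>nat\<close>. It shows that the counting identity has an instance at every prime, which
  removing the denominator requires.\<close>

lemma exists_prime_field:
  assumes p: "prime (p :: nat)"
  shows "\<exists>F :: nat ring. field F \<and> card (carrier F) = p"
proof -
  interpret residues_prime p "residue_ring (int p)"
    by unfold_locales (use p prime_gt_1_nat[OF p] in auto)
  have c: "carrier (residue_ring (int p)) = {0..int p - 1}"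
    by (simp add: residue_ring_def)
  have "inj_on nat (carrier (residue_ring (int p)))"
    unfolding c by (auto simp: inj_on_def)
  then have "field (image_ring nat (residue_ring (int p)))"
    by (rule field.inj_imp_image_ring_is_field[OF is_field])
  moreover have "card (carrier (image_ring nat (residue_ring (int p)))) = p"
    using card_image[OF \<open>inj_on nat _\<close>] unfolding image_ring_carrier c by simp
  ultimately show ?thesis
    by blast
qed

text \<open>The constant coefficient of \<open>g\<close> is divisible by all primes, hence zero.\<close>

lemma poly_divide_power:
  fixes g :: "int poly" and S :: "nat set" and f :: "nat \<Rightarrow> 'b \<Rightarrow> int"
  assumes "\<And>q F. R q F \<Longrightarrow> f q F * int q ^ m = poly g (int q)"
    and "\<And>p. prime p \<Longrightarrow> \<exists>F. R p F" and "\<And>q F. R q F \<Longrightarrow> 0 < q"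
  shows "\<exists>h :: int poly. \<forall>q F. R q F \<longrightarrow> f q F = poly h (int q)"
  using assms(1)
proof (induction m arbitrary: g)
  case 0
  then show ?case
    by auto
next
  case (Suc m)
  obtain c h where g: "g = pCons c h"
    by (cases g)
  have "c = 0"
  proof -
    obtain p where p: "prime p" "nat \<bar>c\<bar> < p"
      using bigger_prime by blast
    obtain F where "R p F"
      using assms(2)[OF p(1)] by blast
    then have "c = int p * (f p F * int p ^ m - poly h (int p))"
      using Suc.prems[of p F] by (simp add: g algebra_simps)
    then have "int p dvd c"
      by (rule dvdI)
    then show "c = 0"
      using p(2) dvd_imp_le_int[of c "int p"] by fastforce
  qed
  have "f q F * int q ^ m = poly h (int q)" if R: "R q F" for q F
  proof -
    have "int q * (f q F * int q ^ m) = int q * poly h (int q)"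
      using Suc.prems[OF R] by (simp add: g \<open>c = 0\<close> mult.left_commute)
    then show ?thesis
      using assms(3)[OF R] by simp
  qed
  then show ?case
    by (rule Suc.IH)
qed

theorem theorem1p2:
  fixes t n :: nat and ds :: "nat list"
  assumes "1 \<le> t" and "t \<le> 5" and "1 \<le> n"
    and "length ds = t" and "sorted ds" and "last ds = n"
  shows "\<exists>f :: int poly. \<forall>(p::nat) (e::nat) (q::nat) (F :: nat ring).
    prime p \<and> 1 \<le> e \<and> q = p ^ e \<and> field F \<and> card (carrier F) = q \<longrightarrow>
    int (conj_class_number (unipotent_radical p F n ds)) = poly f (int q)"
proof -
  let ?U = "flag_levels.U n (flag_embedding.l ds)"
  \<comment> \<open>The characteristic and the field are packed into one pair, so that
    \<open>poly_divide_power\<close> can treat all models of a given order as one parameter.\<close>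
  define k where "k pF = int (conj_class_number (unipotent_radical (fst pF) (snd pF) n ds))"
    for pF :: "nat \<times> nat ring"
  define R where "R q pF \<longleftrightarrow> (\<exists>e. prime (fst pF) \<and> 1 \<le> e \<and> q = fst pF ^ e \<and> field (snd pF) \<and>
    card (carrier (snd pF)) = q)" for q :: nat and pF :: "nat \<times> nat ring"
  have emb: "flag_embedding F (family_embedding F ` carrier F) (family_embedding F \<one>\<^bsub>F\<^esub>)
      (family_embedding F) n ds" if "field F" "finite (carrier F)" for F
    using matrix_embedding_family[OF that] assms
    by (intro flag_embedding.intro flag_embedding_axioms.intro) auto
  \<comment> \<open>The levels depend on \<open>ds\<close> alone, but their properties were derived
    inside a locale that fixes a field; the field with two elements serves as a sample. The pattern
    \<open>?U\<close> is thus available before \<open>q\<close> is chosen.\<close>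
  have "flag_levels n (flag_embedding.l ds)"
  proof -
    obtain F :: "nat ring" where F: "field F" "card (carrier F) = 2"
      using exists_prime_field[OF two_is_prime_nat] by blast
    then interpret flag_embedding F "family_embedding F ` carrier F" "family_embedding F \<one>\<^bsub>F\<^esub>"
      "family_embedding F" n ds
      by (intro emb card_ge_0_finite) simp_all
    show ?thesis
      by (rule flag_levels_axioms)
  qed
  then have "laurent_count (\<lambda>(K :: ring_family set) e.
      int (card {(x, y). x \<in> supported K ?U \<and> y \<in> supported K ?U \<and> mm n x y = mm n y x}))"
    by (rule flag_levels.laurent_count_commuting_U)
  then obtain g m where g: "\<And>(K :: ring_family set) e. finite_subfield K e \<Longrightarrow>
      int (card {(x, y). x \<in> supported K ?U \<and> y \<in> supported K ?U \<and> mm n x y = mm n y x}) *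
      int (card K) ^ m = poly g (int (card K))"
    unfolding laurent_count_def by blast
  \<comment> \<open>The exponent combines the order \<open>q ^ card ?U\<close> of the group, from
    Burnside's lemma, with the denominator \<open>m\<close> of the commuting pair count.\<close>
  have count: "k pF * int q ^ (card ?U + m) = poly g (int q)" if R: "R q pF" for q pF
  proof -
    obtain p F where pF: "pF = (p, F)"
      by (cases pF)
    obtain r where r: "prime p" "1 \<le> r" "q = p ^ r" "field F" "card (carrier F) = q"
      using R by (auto simp: R_def pF)
    have "0 < q"
      using r(1,3) prime_gt_0_nat by simp
    then have "finite (carrier F)"
      using r(5) by (simp add: card_ge_0_finite)
    then interpret flag_embedding F "family_embedding F ` carrier F" "family_embedding F \<one>\<^bsub>F\<^esub>"
      "family_embedding F" n ds
      by (rule emb[OF r(4)])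
    have cK: "card (family_embedding F ` carrier F) = q"
      using bij_betw_same_card[OF \<phi>_bij] r(5) by simp
    have "card (family_embedding F ` carrier F) = p ^ r"
      unfolding cK by (rule r(3))
    then have "k pF * int q ^ card ?U =
        int (card {(x, y). x \<in> supported (family_embedding F ` carrier F) ?U \<and>
          y \<in> supported (family_embedding F ` carrier F) ?U \<and> mm n x y = mm n y x})"
      using arg_cong[OF card_conj_classes[OF r(1) _ r(2)], of int]
      unfolding cK k_def pF by simp
    then have "k pF * int q ^ card ?U * int q ^ m = poly g (int q)"
      using g[OF finite_subfield_axioms] unfolding cK by (simp only:)
    then show ?thesis
      by (simp only: power_add mult.assoc)
  qed
  have "\<exists>h :: int poly. \<forall>q pF. R q pF \<longrightarrow> k pF = poly h (int q)"
  proof (rule poly_divide_power[where f = "\<lambda>q. k", OF count])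
    fix p :: nat assume p: "prime p"
    obtain F :: "nat ring" where "field F" "card (carrier F) = p"
      using exists_prime_field[OF p] by blast
    then have "R p (p, F)"
      using p by (auto simp: R_def intro!: exI[of _ 1])
    then show "\<exists>pF. R p pF" ..
  next
    fix q pF assume "R q pF"
    then show "0 < q"
      using prime_gt_0_nat by (auto simp: R_def)
  qed
  then obtain h :: "int poly" where h: "\<And>q pF. R q pF \<Longrightarrow> k pF = poly h (int q)"
    by blast
  show ?thesis
  proof (intro exI[of _ h] allI impI)
    fix p e q :: nat and F :: "nat ring"
    assume "prime p \<and> 1 \<le> e \<and> q = p ^ e \<and> field F \<and> card (carrier F) = q"
    then have "R q (p, F)"
      by (auto simp: R_def)
    then show "int (conj_class_number (unipotent_radical p F n ds)) = poly h (int q)"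
      using h by (fastforce simp: k_def)
  qed
qed

end
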